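(* Let $n\ge 1$ and $0\le m\le n$ be integers. Let $a_j,b_{jk}\in C^1_{2\pi}$ for all $j,k\le n$, with $a_j(x,t)\ne 0$ for all $(x,t)\in[0,1]\times\mathbb{R}$ and $j\le n$, and suppose that for all $1\le j\ne k\le n$ there exists $\tilde b_{jk}\in C^1_{2\pi}$ such that $b_{jk}=\tilde b_{jk}(a_k-a_j)$. Let $R=(R_1,\dots,R_n)$ be a bounded linear operator from $C_{n,2\pi}$ to $C_{n,2\pi}(\mathbb{R})$ whose restriction to $C^1_{n,2\pi}$ is a bounded linear operator from $C^1_{n,2\pi}$ to $C^1_{n,2\pi}(\mathbb{R})$. Let $C\in\mathcal{L}(C_{n,2\pi})$ be the operator $$(Cv)_j(x,t)=\begin{cases} c_j(0,x,t)\,(Rv)_j(\omega_j(0,x,t)), & 1\le j\le m,\\ c_j(1,x,t)\,(Rv)_j(\omega_j(1,x,t)), & m<j\le n,\end{cases}$$ and assume that there exists $\ell\in\mathbb{N}$ such that $\|C^\ell\|_{\mathcal{L}(C_{n,2\pi})}<1$. Consider the problem $$\partial_t u_j+a_j(x,t)\partial_x u_j+\sum_{k=1}^n b_{jk}(x,t)u_k=f_j(x,t),\quad (x,t)\in(0,1)\times\mathbb{R},\ j\le n,$$ $$u_j(x,t)=u_j(x,t+2\pi),\quad j\le n,$$ $$u_j(0,t)=(Ru)_j(t)\ (1\le j\le m),\qquad u_j(1,t)=(Ru)_j(t)\ (m<j\le n),\quad t\in\mathbb{R}.$$ Let $\mathcal{K}$ denote the vector space of all continuous solutions (in the sense defined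 in the context) to this problem with $f=0$. Then: (i) $\dim\mathcal{K}<\infty$, and the vector space of all $f\in C_{n,2\pi}$ such that there exists a continuous solution to the problem is a closed subspace of codimension $\dim\mathcal{K}$ in $C_{n,2\pi}$. (ii) If $\dim\mathcal{K}=0$, then for any $f\in C_{n,2\pi}$ there exists a unique continuous solution $u$ to the problem.
   Context: Spaces. $C_{n,2\pi}$ is the Banach space of all continuous maps $u:[0,1]\times\mathbb{R}\to\mathbb{R}^n$ that are $2\pi$-periodic in the second variable $t$, with norm $\|u\|_\infty=\max_{j\le n}\max_{x\in[0,1]}\max_{t\in\mathbb{R}}|u_j(x,t)|$. $C^1_{n,2\pi}$ is the Banach space of all $u\in C_{n,2\pi}$ with $\partial_xu,\partial_tu\in C_{n,2\pi}$, with norm $\|u\|_1=\|u\|_\infty+\|\partial_xu\|_\infty+\|\partial_tu\|_\infty$. $C_{n,2\pi}(\mathbb{R})$ is the space of continuous $2\pi$-periodic maps $v:\mathbb{R}\to\mathbb{R}^n$ (sup norm), and $C^1_{n,2\pi}(\mathbb{R})$ is the space of $v\in C_{n,2\pi}(\mathbb{R})$ with $v'\in C_{n,2\pi}(\mathbb{R})$ ($C^1$ norm). The subscript $n$ is dropped when $n=1$. $\mathcal{L}(X)$ is the space of bounded linear operators on $X$ with the operator norm. Characteristics. For $j\le n$, $x\in[0,1]$, $t\in\mathbb{R}$, the function $\xi\in[0,1]\mapsto\omega_j(\xi,x,t)\in\mathbb{R}$ is the solution of $$\partial_\xi\omega_j(\xi,x,t)=\frac{1}{a_j(\xi,\omega_j(\xi,x,t))},\qquad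 \omega_j(x,x,t)=t.$$ Set $$c_j(\xi,x,t)=\exp\int_x^\xi\Big(\frac{b_{jj}}{a_j}\Big)(\eta,\omega_j(\eta,x,t))\,d\eta,\qquad d_j(\xi,x,t)=\frac{c_j(\xi,x,t)}{a_j(\xi,\omega_j(\xi,x,t))}.$$ Continuous solution. Put $x_j=0$ for $1\le j\le m$ and $x_j=1$ for $m<j\le n$. Given $f=(f_1,\dots,f_n)\in C_{n,2\pi}$, a function $u\in C_{n,2\pi}$ is called a continuous solution to the problem if for all $j\le n$, $(x,t)\in[0,1]\times\mathbb{R}$, writing $\omega_j(\xi)=\omega_j(\xi,x,t)$, $$u_j(x,t)=c_j(x_j,x,t)(Ru)_j(\omega_j(x_j))-\int_{x_j}^x d_j(\xi,x,t)\sum_{k\ne j}b_{jk}(\xi,\omega_j(\xi))u_k(\xi,\omega_j(\xi))\,d\xi+\int_{x_j}^x d_j(\xi,x,t)f_j(\xi,\omega_j(\xi))\,d\xi.$$ *)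

theory Defs
  imports "HOL-Analysis.Analysis"
begin

section \<open>The space of continuous maps on the strip, periodic in time\<close>

text \<open>
  The library norm of \<^typ>\<open>real ^ 'n\<close> is the Euclidean one; \<^const>\<open>infnorm\<close> is the maximum of the
  absolute values of the components. Elements of the type below are maps on
  $[0,1] \times \mathbb{R}$; as HOL functions are total, they are extended by 0 outside.
  With \<^typ>\<open>real ^ 'n\<close> for the type parameter this is $C_{n,2\pi}$, with \<^typ>\<open>real\<close> it is $C_{2\pi}$.
\<close>

typedef (overloaded) 'b::euclidean_space per_strip =
  "{u :: real \<Rightarrow> real \<Rightarrow> 'b.
      continuous_on ({0..1} \<times> UNIV) (\<lambda>(x, t). u x t) \<and>
      (\<forall>x\<in>{0..1}. \<forall>t. u x (t + 2 * pi) = u x t) \<and>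
      (\<forall>x t. x \<notin> {0..1} \<longrightarrow> u x t = 0)}"
  morphisms strip_apply Strip
  by (rule exI[of _ "\<lambda>_ _. 0"]) (auto simp: case_prod_unfold)

declare [[coercion "strip_apply :: 'b::euclidean_space per_strip \<Rightarrow> real \<Rightarrow> real \<Rightarrow> 'b"]]

lemma strip_cont: "continuous_on ({0..1} \<times> UNIV) (\<lambda>(x, t). strip_apply u x t)"
  and strip_per: "x \<in> {0..1} \<Longrightarrow> strip_apply u x (t + 2 * pi) = strip_apply u x t"
  and strip_outside: "x \<notin> {0..1} \<Longrightarrow> strip_apply u x t = 0"
  using strip_apply[of u] by blast+

lemma Strip_apply:
  assumes "continuous_on ({0..1} \<times> UNIV) (\<lambda>(x, t). u x t)"
    and "\<And>x t. x \<in> {0..1} \<Longrightarrow> u x (t + 2 * pi) = u x t"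
    and "\<And>x t. x \<notin> {0..1} \<Longrightarrow> u x t = 0"
  shows "strip_apply (Strip u) = u"
  using assms by (intro Strip_inverse) auto

lemma strip_eqI: "(\<And>x t. x \<in> {0..1} \<Longrightarrow> strip_apply u x t = strip_apply v x t) \<Longrightarrow> u = v"
  by (metis strip_apply_inject strip_outside ext)

lemma periodic_reduce:
  fixes f :: "real \<Rightarrow> 'b"
  assumes per: "\<And>t. f (t + 2 * pi) = f t"
  obtains s where "s \<in> {0..2 * pi}" "f t = f s"
proof -
  have nat: "f (t + real k * (2 * pi)) = f t" for k t
  proof (induction k)
    case (Suc k)
    have "f (t + real (Suc k) * (2 * pi)) = f ((t + real k * (2 * pi)) + 2 * pi)"
      by (simp add: algebra_simps)
    then show ?case using per Suc by simp
  qed simp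
  have int: "f (t + of_int k * (2 * pi)) = f t" for k t
  proof (cases "k \<ge> 0")
    case True
    then show ?thesis using nat[of t "nat k"] by simp
  next
    case False
    then show ?thesis using nat[of "t + of_int k * (2 * pi)" "nat (- k)"] by simp
  qed
  define s where "s = t + of_int (- \<lfloor>t / (2 * pi)\<rfloor>) * (2 * pi)"
  have "of_int \<lfloor>t / (2 * pi)\<rfloor> \<le> t / (2 * pi)" "t / (2 * pi) \<le> of_int \<lfloor>t / (2 * pi)\<rfloor> + 1"
    by linarith+
  then have "of_int \<lfloor>t / (2 * pi)\<rfloor> * (2 * pi) \<le> t"
      "t \<le> (of_int \<lfloor>t / (2 * pi)\<rfloor> + 1) * (2 * pi)"
    using pi_gt_zero pos_le_divide_eq[of "2 * pi" "of_int \<lfloor>t / (2 * pi)\<rfloor>" t]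
      pos_divide_le_eq[of "2 * pi" t "of_int \<lfloor>t / (2 * pi)\<rfloor> + 1"] by auto
  then have "s \<in> {0..2 * pi}"
    unfolding s_def by (simp add: algebra_simps)
  then show thesis using that int[of t] s_def by metis
qed

lemma strip_bounded:
  fixes u :: "'b::euclidean_space per_strip"
  shows "bdd_above ((\<lambda>(x, t). infnorm (strip_apply u x t)) ` ({0..1} \<times> UNIV))"
proof -
  have "compact ((\<lambda>(x, t). infnorm (strip_apply u x t)) ` ({0..1} \<times> {0..2 * pi}))"
  proof (intro compact_continuous_image compact_Times compact_Icc)
    have "continuous_on ({0..1} \<times> {0..2 * pi}) (\<lambda>p. infnorm ((\<lambda>(x, t). strip_apply u x t) p))"
      by (intro continuous_on_infnorm continuous_on_subset[OF strip_cont]) auto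
    then show "continuous_on ({0..1} \<times> {0..2 * pi}) (\<lambda>(x, t). infnorm (strip_apply u x t))"
      by (simp add: case_prod_unfold)
  qed
  moreover have "(\<lambda>(x, t). infnorm (strip_apply u x t)) ` ({0..1} \<times> UNIV)
      \<subseteq> (\<lambda>(x, t). infnorm (strip_apply u x t)) ` ({0..1} \<times> {0..2 * pi})"
  proof clarify
    fix x t :: real assume x: "x \<in> {0..1}"
    obtain s where "s \<in> {0..2 * pi}" "strip_apply u x t = strip_apply u x s"
      using periodic_reduce[of "strip_apply u x" t] strip_per[OF x] by metis
    then show "infnorm (strip_apply u x t)
        \<in> (\<lambda>(x, t). infnorm (strip_apply u x t)) ` ({0..1} \<times> {0..2 * pi})"
      using x by (intro image_eqI[of _ _ "(x, s)"]) auto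
  qed
  ultimately show ?thesis
    by (intro bdd_above_mono[OF bounded_imp_bdd_above[OF compact_imp_bounded]])
qed

instantiation per_strip :: (euclidean_space) real_vector
begin

definition "0 = Strip (\<lambda>_ _. 0)"
definition "u + v = Strip (\<lambda>x t. strip_apply u x t + strip_apply v x t)"
definition "u - v = Strip (\<lambda>x t. strip_apply u x t - strip_apply v x t)"
definition "- u = Strip (\<lambda>x t. - strip_apply u x t)"
definition "r *\<^sub>R u = Strip (\<lambda>x t. r *\<^sub>R strip_apply u x t)"

lemma strip_apply_zero: "strip_apply 0 = (\<lambda>_ _. 0)"
  unfolding zero_per_strip_def by (rule Strip_apply) (auto simp: case_prod_unfold)

lemma strip_apply_plus: "strip_apply (u + v) = (\<lambda>x t. strip_apply u x t + strip_apply v x t)"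
  unfolding plus_per_strip_def
  using continuous_on_add[OF strip_cont[of u] strip_cont[of v]]
  by (intro Strip_apply) (auto simp: case_prod_unfold strip_per strip_outside)

lemma strip_apply_minus: "strip_apply (u - v) = (\<lambda>x t. strip_apply u x t - strip_apply v x t)"
  unfolding minus_per_strip_def
  using continuous_on_diff[OF strip_cont[of u] strip_cont[of v]]
  by (intro Strip_apply) (auto simp: case_prod_unfold strip_per strip_outside)

lemma strip_apply_uminus: "strip_apply (- u) = (\<lambda>x t. - strip_apply u x t)"
  unfolding uminus_per_strip_def
  using continuous_on_minus[OF strip_cont[of u]]
  by (intro Strip_apply) (auto simp: case_prod_unfold strip_per strip_outside)

lemma strip_apply_scaleR: "strip_apply (r *\<^sub>R u) = (\<lambda>x t. r *\<^sub>R strip_apply u x t)"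
  unfolding scaleR_per_strip_def
  using continuous_on_scaleR[OF continuous_on_const strip_cont[of u]]
  by (intro Strip_apply) (auto simp: case_prod_unfold strip_per strip_outside)

instance
proof
  fix u v w :: "'a per_strip" and r s :: real
  note A = strip_apply_zero strip_apply_plus strip_apply_minus strip_apply_uminus
    strip_apply_scaleR
  show "u + v + w = u + (v + w)" "u + v = v + u" "0 + u = u" "- u + u = 0" "u - v = u + - v"
    "r *\<^sub>R (u + v) = r *\<^sub>R u + r *\<^sub>R v" "(r + s) *\<^sub>R u = r *\<^sub>R u + s *\<^sub>R u"
    "r *\<^sub>R s *\<^sub>R u = (r * s) *\<^sub>R u" "1 *\<^sub>R u = u"
    by (rule strip_eqI, simp add: A algebra_simps)+
qed

end

instantiation per_strip :: (euclidean_space) real_normed_vector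
begin

definition norm_per_strip :: "'a per_strip \<Rightarrow> real" where
  "norm u = (SUP (x, t) \<in> {0..1} \<times> UNIV. infnorm (strip_apply u x t))"
definition dist_per_strip :: "'a per_strip \<Rightarrow> 'a per_strip \<Rightarrow> real" where
  "dist (u :: 'a per_strip) v = norm (u - v)"
definition sgn_per_strip :: "'a per_strip \<Rightarrow> 'a per_strip" where
  "sgn (u :: 'a per_strip) = u /\<^sub>R norm u"
definition uniformity_per_strip :: "('a per_strip \<times> 'a per_strip) filter" where
  "uniformity_per_strip = (INF e\<in>{0 <..}. principal {(u, v). dist u v < e})"
definition open_per_strip :: "'a per_strip set \<Rightarrow> bool" where
  "open_per_strip U \<longleftrightarrow> (\<forall>u\<in>U. \<forall>\<^sub>F (u', v) in uniformity. u' = u \<longrightarrow> v \<in> U)"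

lemma strip_norm_upper: "x \<in> {0..1} \<Longrightarrow> infnorm (strip_apply u x t) \<le> norm u"
  unfolding norm_per_strip_def
  using cSUP_upper[OF _ strip_bounded[of u], of "(x, t)"] by auto

lemma strip_norm_least:
  "(\<And>x t. x \<in> {0..1} \<Longrightarrow> infnorm (strip_apply u x t) \<le> B) \<Longrightarrow> norm u \<le> B"
  unfolding norm_per_strip_def by (rule cSUP_least) auto

instance
proof
  fix u v w :: "'a per_strip" and r s :: real
  note A = strip_apply_zero strip_apply_plus strip_apply_minus strip_apply_uminus
    strip_apply_scaleR
  show "dist u v = norm (u - v)" by (rule dist_per_strip_def)
  show "sgn u = u /\<^sub>R norm u" by (rule sgn_per_strip_def)
  show "uniformity = (INF e\<in>{0 <..}. principal {(u, v :: 'a per_strip). dist u v < e})"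
    by (rule uniformity_per_strip_def)
  show "open U \<longleftrightarrow> (\<forall>u\<in>U. \<forall>\<^sub>F (u', v) in uniformity. u' = u \<longrightarrow> v \<in> U)" for U :: "'a per_strip set"
    by (rule open_per_strip_def)
  show "norm u = 0 \<longleftrightarrow> u = 0"
  proof
    assume "norm u = 0"
    then have "infnorm (strip_apply u x t) \<le> 0" if "x \<in> {0..1}" for x t
      using strip_norm_upper[OF that, of u t] by simp
    then show "u = 0"
      by (intro strip_eqI) (metis A(1) infnorm_pos_lt not_le)
  next
    assume "u = 0"
    then show "norm u = 0"
      by (simp add: norm_per_strip_def A(1) infnorm_0 case_prod_unfold)
  qed
  show "norm (u + v) \<le> norm u + norm v"
    by (rule strip_norm_least)
      (auto simp: A intro!: order_trans[OF infnorm_triangle] add_mono strip_norm_upper)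
  have le: "norm (r *\<^sub>R u) \<le> \<bar>r\<bar> * norm u" for r and u :: "'a per_strip"
    by (rule strip_norm_least) (auto simp: A infnorm_mul intro!: mult_left_mono strip_norm_upper)
  show "norm (r *\<^sub>R u) = \<bar>r\<bar> * norm u"
  proof (rule antisym[OF le])
    show "\<bar>r\<bar> * norm u \<le> norm (r *\<^sub>R u)"
    proof (cases "r = 0")
      case True
      then show ?thesis
        using order_trans[OF infnorm_pos_le strip_norm_upper[of 0 "r *\<^sub>R u" 0]] by simp
    next
      case False
      have "inverse r *\<^sub>R r *\<^sub>R u = u"
        using False by (intro strip_eqI) (simp add: A)
      then have "norm u \<le> \<bar>inverse r\<bar> * norm (r *\<^sub>R u)"
        using le[of "inverse r" "r *\<^sub>R u"] by simp
      then show ?thesis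
        using False by (simp add: field_simps)
    qed
  qed
qed

end

instance per_strip :: (euclidean_space) banach
proof
  fix U :: "nat \<Rightarrow> 'a per_strip"
  assume U: "Cauchy U"
  define I :: "(real \<times> real) set" where "I = {0..1} \<times> UNIV"
  define F where "F k = (\<lambda>(x, t). strip_apply (U k) x t)" for k
  define N where "N = sqrt (DIM('a))"
  have N: "N > 0" by (simp add: N_def)
  have dist_le: "dist (F k p) (F l p) \<le> N * dist (U k) (U l)" if pI: "p \<in> I" for k l p
  proof -
    obtain x t where p: "p = (x, t)" "x \<in> {0..1}" using pI unfolding I_def by blast
    have "dist (F k p) (F l p) \<le> N * infnorm (strip_apply (U k - U l) x t)"
      using norm_le_infnorm[of "strip_apply (U k - U l) x t"]
      by (simp add: p F_def dist_norm strip_apply_minus N_def)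
    also have "\<dots> \<le> N * dist (U k) (U l)"
      unfolding dist_norm using N p by (intro mult_left_mono strip_norm_upper) auto
    finally show ?thesis .
  qed
  have "uniformly_Cauchy_on I F"
  proof (rule uniformly_Cauchy_onI)
    fix e :: real assume "e > 0"
    then have "e / N > 0" using N by simp
    then obtain M where M: "dist (U k) (U l) < e / N" if "k \<ge> M" "l \<ge> M" for k l
      using U unfolding Cauchy_def by metis
    show "\<exists>M. \<forall>p\<in>I. \<forall>k\<ge>M. \<forall>l\<ge>M. dist (F k p) (F l p) < e"
    proof (intro exI ballI allI impI)
      fix p k l assume "p \<in> I" "k \<ge> M" "l \<ge> M"
      then have "dist (F k p) (F l p) \<le> N * dist (U k) (U l)" "dist (U k) (U l) < e / N"
        using dist_le M by auto
      then show "dist (F k p) (F l p) < e"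
        using N by (simp add: field_simps)
    qed
  qed
  then obtain G where G: "uniform_limit I F G sequentially"
    using Cauchy_uniformly_convergent uniformly_convergent_on_def by blast
  have lim: "(\<lambda>k. F k p) \<longlonglongrightarrow> G p" if "p \<in> I" for p
    using tendsto_uniform_limitI[OF G that] .
  define g where "g x t = (if x \<in> {0..1} then G (x, t) else 0)" for x t
  have "continuous_on I G"
    by (rule uniform_limit_theorem[OF _ G]) (auto simp: F_def I_def strip_cont)
  then have "continuous_on ({0..1} \<times> UNIV) (\<lambda>(x, t). g x t)"
    by (subst continuous_on_cong[OF refl, of _ _ G]) (auto simp: g_def I_def)
  moreover have "g x (t + 2 * pi) = g x t" if "x \<in> {0..1}" for x t
    using lim[of "(x, t)"] lim[of "(x, t + 2 * pi)"] that
    by (auto simp: g_def I_def F_def strip_per intro: LIMSEQ_unique)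
  ultimately have g: "strip_apply (Strip g) = g"
    by (intro Strip_apply) (auto simp: g_def)
  have "U \<longlonglongrightarrow> Strip g"
  proof (rule tendstoI)
    fix e :: real assume "e > 0"
    then have "e / 2 > 0" by simp
    from uniform_limitD[OF G this]
    have "\<forall>\<^sub>F k in sequentially. \<forall>p\<in>I. dist (F k p) (G p) < e / 2" .
    then show "\<forall>\<^sub>F k in sequentially. dist (U k) (Strip g) < e"
    proof eventually_elim
      case (elim k)
      have "norm (U k - Strip g) \<le> e / 2"
      proof (rule strip_norm_least)
        fix x t :: real assume "x \<in> {0..1}"
        then have "dist (F k (x, t)) (G (x, t)) < e / 2" using elim by (auto simp: I_def)
        then show "infnorm (strip_apply (U k - Strip g) x t) \<le> e / 2"
          using infnorm_le_norm[of "strip_apply (U k) x t - g x t"] \<open>x \<in> {0..1}\<close>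
          by (simp add: strip_apply_minus g F_def dist_norm g_def)
      qed
      then show ?case using \<open>e > 0\<close> by (simp add: dist_norm)
    qed
  qed
  then show "convergent U" by (rule convergentI)
qed

section \<open>The space of continuous periodic maps on the real line\<close>

typedef (overloaded) 'b::euclidean_space per_line =
  "{v :: real \<Rightarrow> 'b. continuous_on UNIV v \<and> (\<forall>t. v (t + 2 * pi) = v t)}"
  morphisms line_apply Line
  by (rule exI[of _ "\<lambda>_. 0"]) auto

declare [[coercion "line_apply :: 'b::euclidean_space per_line \<Rightarrow> real \<Rightarrow> 'b"]]

lemma line_cont: "continuous_on UNIV (line_apply v)"
  and line_per: "line_apply v (t + 2 * pi) = line_apply v t"
  using line_apply[of v] by blast+

lemma Line_apply:
  assumes "continuous_on UNIV v" "\<And>t. v (t + 2 * pi) = v t"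
  shows "line_apply (Line v) = v"
  using assms by (intro Line_inverse) auto

lemma line_eqI: "(\<And>t. line_apply u t = line_apply v t) \<Longrightarrow> u = v"
  by (metis line_apply_inject ext)

lemma line_bounded:
  fixes v :: "'b::euclidean_space per_line"
  shows "bdd_above (range (\<lambda>t. infnorm (line_apply v t)))"
proof -
  have "compact ((\<lambda>t. infnorm (line_apply v t)) ` {0..2 * pi})"
    by (intro compact_continuous_image compact_Icc continuous_on_infnorm
        continuous_on_subset[OF line_cont]) auto
  moreover have "range (\<lambda>t. infnorm (line_apply v t))
      \<subseteq> (\<lambda>t. infnorm (line_apply v t)) ` {0..2 * pi}"
  proof clarify
    fix t :: real
    obtain s where "s \<in> {0..2 * pi}" "line_apply v t = line_apply v s"
      using periodic_reduce[of "line_apply v" t] line_per by metis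
    then show "infnorm (line_apply v t) \<in> (\<lambda>t. infnorm (line_apply v t)) ` {0..2 * pi}"
      by auto
  qed
  ultimately show ?thesis
    by (intro bdd_above_mono[OF bounded_imp_bdd_above[OF compact_imp_bounded]])
qed

instantiation per_line :: (euclidean_space) real_vector
begin

definition "0 = Line (\<lambda>_. 0)"
definition "u + v = Line (\<lambda>t. line_apply u t + line_apply v t)"
definition "u - v = Line (\<lambda>t. line_apply u t - line_apply v t)"
definition "- u = Line (\<lambda>t. - line_apply u t)"
definition "r *\<^sub>R u = Line (\<lambda>t. r *\<^sub>R line_apply u t)"

lemma line_apply_zero: "line_apply 0 = (\<lambda>_. 0)"
  unfolding zero_per_line_def by (rule Line_apply) (auto simp: case_prod_unfold)

lemma line_apply_plus: "line_apply (u + v) = (\<lambda>t. line_apply u t + line_apply v t)"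
  unfolding plus_per_line_def
  using continuous_on_add[OF line_cont[of u] line_cont[of v]]
  by (intro Line_apply) (auto simp: case_prod_unfold line_per)

lemma line_apply_minus: "line_apply (u - v) = (\<lambda>t. line_apply u t - line_apply v t)"
  unfolding minus_per_line_def
  using continuous_on_diff[OF line_cont[of u] line_cont[of v]]
  by (intro Line_apply) (auto simp: case_prod_unfold line_per)

lemma line_apply_uminus: "line_apply (- u) = (\<lambda>t. - line_apply u t)"
  unfolding uminus_per_line_def
  using continuous_on_minus[OF line_cont[of u]]
  by (intro Line_apply) (auto simp: case_prod_unfold line_per)

lemma line_apply_scaleR: "line_apply (r *\<^sub>R u) = (\<lambda>t. r *\<^sub>R line_apply u t)"
  unfolding scaleR_per_line_def
  using continuous_on_scaleR[OF continuous_on_const line_cont[of u]]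
  by (intro Line_apply) (auto simp: case_prod_unfold line_per)

instance
proof
  fix u v w :: "'a per_line" and r s :: real
  note A = line_apply_zero line_apply_plus line_apply_minus line_apply_uminus
    line_apply_scaleR
  show "u + v + w = u + (v + w)" "u + v = v + u" "0 + u = u" "- u + u = 0" "u - v = u + - v"
    "r *\<^sub>R (u + v) = r *\<^sub>R u + r *\<^sub>R v" "(r + s) *\<^sub>R u = r *\<^sub>R u + s *\<^sub>R u"
    "r *\<^sub>R s *\<^sub>R u = (r * s) *\<^sub>R u" "1 *\<^sub>R u = u"
    by (rule line_eqI, simp add: A algebra_simps)+
qed

end

instantiation per_line :: (euclidean_space) real_normed_vector
begin

definition norm_per_line :: "'a per_line \<Rightarrow> real" where
  "norm u = (SUP t. infnorm (line_apply u t))"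
definition dist_per_line :: "'a per_line \<Rightarrow> 'a per_line \<Rightarrow> real" where
  "dist (u :: 'a per_line) v = norm (u - v)"
definition sgn_per_line :: "'a per_line \<Rightarrow> 'a per_line" where
  "sgn (u :: 'a per_line) = u /\<^sub>R norm u"
definition uniformity_per_line :: "('a per_line \<times> 'a per_line) filter" where
  "uniformity_per_line = (INF e\<in>{0 <..}. principal {(u, v). dist u v < e})"
definition open_per_line :: "'a per_line set \<Rightarrow> bool" where
  "open_per_line U \<longleftrightarrow> (\<forall>u\<in>U. \<forall>\<^sub>F (u', v) in uniformity. u' = u \<longrightarrow> v \<in> U)"

lemma line_norm_upper: "infnorm (line_apply u t) \<le> norm u"
  unfolding norm_per_line_def
  using cSUP_upper[OF _ line_bounded[of u], of t] by auto

lemma line_norm_least: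
  "(\<And>t. infnorm (line_apply u t) \<le> B) \<Longrightarrow> norm u \<le> B"
  unfolding norm_per_line_def by (rule cSUP_least) auto

instance
proof
  fix u v w :: "'a per_line" and r s :: real
  note A = line_apply_zero line_apply_plus line_apply_minus line_apply_uminus
    line_apply_scaleR
  show "dist u v = norm (u - v)" by (rule dist_per_line_def)
  show "sgn u = u /\<^sub>R norm u" by (rule sgn_per_line_def)
  show "uniformity = (INF e\<in>{0 <..}. principal {(u, v :: 'a per_line). dist u v < e})"
    by (rule uniformity_per_line_def)
  show "open U \<longleftrightarrow> (\<forall>u\<in>U. \<forall>\<^sub>F (u', v) in uniformity. u' = u \<longrightarrow> v \<in> U)" for U :: "'a per_line set"
    by (rule open_per_line_def)
  show "norm u = 0 \<longleftrightarrow> u = 0"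
  proof
    assume "norm u = 0"
    then have "infnorm (line_apply u t) \<le> 0" for t
      using line_norm_upper[of u t] by simp
    then show "u = 0"
      by (intro line_eqI) (metis A(1) infnorm_pos_lt not_le)
  next
    assume "u = 0"
    then show "norm u = 0"
      by (simp add: norm_per_line_def A(1) infnorm_0 case_prod_unfold)
  qed
  show "norm (u + v) \<le> norm u + norm v"
    by (rule line_norm_least)
      (auto simp: A intro!: order_trans[OF infnorm_triangle] add_mono line_norm_upper)
  have le: "norm (r *\<^sub>R u) \<le> \<bar>r\<bar> * norm u" for r and u :: "'a per_line"
    by (rule line_norm_least) (auto simp: A infnorm_mul intro!: mult_left_mono line_norm_upper)
  show "norm (r *\<^sub>R u) = \<bar>r\<bar> * norm u"
  proof (rule antisym[OF le])
    show "\<bar>r\<bar> * norm u \<le> norm (r *\<^sub>R u)"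
    proof (cases "r = 0")
      case True
      then show ?thesis
        using order_trans[OF infnorm_pos_le line_norm_upper[of "r *\<^sub>R u" 0]] by simp
    next
      case False
      have "inverse r *\<^sub>R r *\<^sub>R u = u"
        using False by (intro line_eqI) (simp add: A)
      then have "norm u \<le> \<bar>inverse r\<bar> * norm (r *\<^sub>R u)"
        using le[of "inverse r" "r *\<^sub>R u"] by simp
      then show ?thesis
        using False by (simp add: field_simps)
    qed
  qed
qed

end

instance per_line :: (euclidean_space) banach
proof
  fix U :: "nat \<Rightarrow> 'a per_line"
  assume U: "Cauchy U"
  define F where "F k = line_apply (U k)" for k
  define N where "N = sqrt (DIM('a))"
  have N: "N > 0" by (simp add: N_def)
  have dist_le: "dist (F k p) (F l p) \<le> N * dist (U k) (U l)" for k l p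
  proof -
    have "dist (F k p) (F l p) \<le> N * infnorm (line_apply (U k - U l) p)"
      using norm_le_infnorm[of "line_apply (U k - U l) p"]
      by (simp add: F_def dist_norm line_apply_minus N_def)
    also have "\<dots> \<le> N * dist (U k) (U l)"
      unfolding dist_norm using N by (intro mult_left_mono line_norm_upper) auto
    finally show ?thesis .
  qed
  have "uniformly_Cauchy_on UNIV F"
  proof (rule uniformly_Cauchy_onI)
    fix e :: real assume "e > 0"
    then have "e / N > 0" using N by simp
    then obtain M where M: "dist (U k) (U l) < e / N" if "k \<ge> M" "l \<ge> M" for k l
      using U unfolding Cauchy_def by metis
    show "\<exists>M. \<forall>p\<in>UNIV. \<forall>k\<ge>M. \<forall>l\<ge>M. dist (F k p) (F l p) < e"
    proof (intro exI ballI allI impI)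
      fix p k l assume "k \<ge> M" "l \<ge> M"
      then have "dist (F k p) (F l p) \<le> N * dist (U k) (U l)" "dist (U k) (U l) < e / N"
        using dist_le M by auto
      then show "dist (F k p) (F l p) < e"
        using N by (simp add: field_simps)
    qed
  qed
  then obtain G where G: "uniform_limit UNIV F G sequentially"
    using Cauchy_uniformly_convergent uniformly_convergent_on_def by blast
  have lim: "(\<lambda>k. F k p) \<longlonglongrightarrow> G p" for p
    using tendsto_uniform_limitI[OF G UNIV_I] .
  have "continuous_on UNIV G"
    by (rule uniform_limit_theorem[OF _ G]) (auto simp: F_def line_cont)
  moreover have "G (t + 2 * pi) = G t" for t
    using lim[of t] lim[of "t + 2 * pi"]
    by (auto simp: F_def line_per intro: LIMSEQ_unique)
  ultimately have g: "line_apply (Line G) = G"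
    by (intro Line_apply) auto
  have "U \<longlonglongrightarrow> Line G"
  proof (rule tendstoI)
    fix e :: real assume "e > 0"
    then have "e / 2 > 0" by simp
    from uniform_limitD[OF G this]
    have "\<forall>\<^sub>F k in sequentially. \<forall>p\<in>UNIV. dist (F k p) (G p) < e / 2" .
    then show "\<forall>\<^sub>F k in sequentially. dist (U k) (Line G) < e"
    proof eventually_elim
      case (elim k)
      have "norm (U k - Line G) \<le> e / 2"
      proof (rule line_norm_least)
        fix t :: real
        have "dist (F k t) (G t) < e / 2" using elim by auto
        then show "infnorm (line_apply (U k - Line G) t) \<le> e / 2"
          using infnorm_le_norm[of "line_apply (U k) t - G t"]
          by (simp add: line_apply_minus g F_def dist_norm)
      qed
      then show ?case using \<open>e > 0\<close> by (simp add: dist_norm)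
    qed
  qed
  then show "convergent U" by (rule convergentI)
qed


section \<open>Continuously differentiable maps\<close>

definition has_dx :: "'b::euclidean_space per_strip \<Rightarrow> 'b per_strip \<Rightarrow> bool" where
  "has_dx u w \<longleftrightarrow> (\<forall>x\<in>{0..1}. \<forall>t. ((\<lambda>y. u y t) has_vector_derivative w x t) (at x within {0..1}))"

definition has_dt :: "'b::euclidean_space per_strip \<Rightarrow> 'b per_strip \<Rightarrow> bool" where
  "has_dt u w \<longleftrightarrow> (\<forall>x\<in>{0..1}. \<forall>t. ((\<lambda>s. u x s) has_vector_derivative w x t) (at t))"

definition C1_strip :: "'b::euclidean_space per_strip set" where
  "C1_strip = {u. (\<exists>w. has_dx u w) \<and> (\<exists>w. has_dt u w)}"

definition norm_C1_strip :: "'b::euclidean_space per_strip \<Rightarrow> real" where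
  "norm_C1_strip u = norm u + norm (THE w. has_dx u w) + norm (THE w. has_dt u w)"

definition has_deriv_line :: "'b::euclidean_space per_line \<Rightarrow> 'b per_line \<Rightarrow> bool" where
  "has_deriv_line v w \<longleftrightarrow> (\<forall>t. (line_apply v has_vector_derivative w t) (at t))"

definition C1_line :: "'b::euclidean_space per_line set" where
  "C1_line = {v. \<exists>w. has_deriv_line v w}"

definition norm_C1_line :: "'b::euclidean_space per_line \<Rightarrow> real" where
  "norm_C1_line v = norm v + norm (THE w. has_deriv_line v w)"

section \<open>Characteristics, continuous solutions and the boundary operator\<close>

text \<open>
  The value at \<open>\<xi>\<close> of the solution of the initial value problem on $[0,1]$. The description operator
  ranges over values and not over solutions, because a solution is determined on $[0,1]$ only.
\<close>

definition char_curve :: "('n \<Rightarrow> real per_strip) \<Rightarrow> 'n \<Rightarrow> real \<Rightarrow> real \<Rightarrow> real \<Rightarrow> real" where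
  "char_curve a j \<xi> x t = (THE y. \<exists>w. w x = t \<and>
     (\<forall>\<eta>\<in>{0..1}. (w has_real_derivative 1 / a j \<eta> (w \<eta>)) (at \<eta> within {0..1})) \<and> w \<xi> = y)"

text \<open>\<^const>\<open>interval_lebesgue_integral\<close> is oriented, so the limits may come in either order.\<close>

definition c_coeff ::
  "('n \<Rightarrow> real per_strip) \<Rightarrow> ('n \<Rightarrow> 'n \<Rightarrow> real per_strip) \<Rightarrow> 'n \<Rightarrow> real \<Rightarrow> real \<Rightarrow> real \<Rightarrow> real" where
  "c_coeff a b j \<xi> x t =
     exp (LBINT \<eta>=x..\<xi>. b j j \<eta> (char_curve a j \<eta> x t) / a j \<eta> (char_curve a j \<eta> x t))"

definition d_coeff ::
  "('n \<Rightarrow> real per_strip) \<Rightarrow> ('n \<Rightarrow> 'n \<Rightarrow> real per_strip) \<Rightarrow> 'n \<Rightarrow> real \<Rightarrow> real \<Rightarrow> real \<Rightarrow> real" where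
  "d_coeff a b j \<xi> x t = c_coeff a b j \<xi> x t / a j \<xi> (char_curve a j \<xi> x t)"

text \<open>
  In what follows \<open>idx\<close> numbers the components by \<open>1, \<dots>, n\<close>, where \<open>n\<close> is the cardinality of the
  index type, and the first \<open>m\<close> components carry the boundary condition at $x = 0$.
\<close>

definition bdry_pt :: "('n \<Rightarrow> nat) \<Rightarrow> nat \<Rightarrow> 'n \<Rightarrow> real" where
  "bdry_pt idx m j = (if idx j \<le> m then 0 else 1)"

definition continuous_solution ::
  "('n::finite \<Rightarrow> nat) \<Rightarrow> nat \<Rightarrow> ('n \<Rightarrow> real per_strip) \<Rightarrow> ('n \<Rightarrow> 'n \<Rightarrow> real per_strip) \<Rightarrow>
    ((real ^ 'n) per_strip \<Rightarrow> (real ^ 'n) per_line) \<Rightarrow>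
    (real ^ 'n) per_strip \<Rightarrow> (real ^ 'n) per_strip \<Rightarrow> bool" where
  "continuous_solution idx m a b R f u \<longleftrightarrow>
     (\<forall>j. \<forall>x\<in>{0..1}. \<forall>t.
        let xj = bdry_pt idx m j; \<omega> = (\<lambda>\<xi>. char_curve a j \<xi> x t) in
        u x t $ j =
          c_coeff a b j xj x t * R u (\<omega> xj) $ j
          - (LBINT \<xi>=xj..x. d_coeff a b j \<xi> x t * (\<Sum>k\<in>UNIV - {j}. b j k \<xi> (\<omega> \<xi>) * u \<xi> (\<omega> \<xi>) $ k))
          + (LBINT \<xi>=xj..x. d_coeff a b j \<xi> x t * f \<xi> (\<omega> \<xi>) $ j))"

text \<open>
  The operator $C$. For coefficients in $C^1_{2\pi}$ with nonvanishing \<open>a j\<close> the map passed to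
  \<^const>\<open>Strip\<close> is continuous and periodic, so \<^const>\<open>strip_apply\<close> recovers it.
\<close>

definition boundary_operator ::
  "('n::finite \<Rightarrow> nat) \<Rightarrow> nat \<Rightarrow> ('n \<Rightarrow> real per_strip) \<Rightarrow> ('n \<Rightarrow> 'n \<Rightarrow> real per_strip) \<Rightarrow>
    ((real ^ 'n) per_strip \<Rightarrow> (real ^ 'n) per_line) \<Rightarrow>
    (real ^ 'n) per_strip \<Rightarrow> (real ^ 'n) per_strip" where
  "boundary_operator idx m a b R v = Strip (\<lambda>x t. if x \<in> {0..1} then
     (\<chi> j. if idx j \<le> m
           then c_coeff a b j 0 x t * R v (char_curve a j 0 x t) $ j
           else c_coeff a b j 1 x t * R v (char_curve a j 1 x t) $ j)
     else 0)"

section \<open>Dimension and codimension\<close>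

text \<open>\<^const>\<open>dim\<close> of an infinite-dimensional subspace is 0, so finiteness has to be stated separately.\<close>

definition finite_dimensional :: "'a::real_vector set \<Rightarrow> bool" where
  "finite_dimensional V \<longleftrightarrow> (\<exists>B. finite B \<and> span B = V)"

text \<open>
  The codimension of \<open>S\<close> is the dimension of the quotient by \<open>S\<close>, rendered here as the dimension of a
  linear complement (all of which are isomorphic to the quotient).
\<close>

definition has_codimension :: "'a::real_vector set \<Rightarrow> nat \<Rightarrow> bool" where
  "has_codimension S d \<longleftrightarrow> (\<exists>T. finite_dimensional T \<and> dim T = d \<and>
     S \<inter> T = {0} \<and> {s + t | s t. s \<in> S \<and> t \<in> T} = UNIV)"

end

theory Submission
  imports Defs "HOL-Complex_Analysis.Great_Picard"
begin

text \<open>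
  Integrating along the characteristics, the problem reads $u = Cu - FBu + Ff$, where $B$ multiplies by
  the off-diagonal coefficients. As $I - C$ is invertible, $v = f - Bu$ turns it into
  $(I + B(I - C)^{-1}F)v = f$ with $u = (I - C)^{-1}Fv$, so that everything follows from the Fredholm
  alternative for an operator with compact square: up to bounded factors the square is
  $FBF + FBC(I - C)^{-1}F$. The operators $FBF$ and $FBC$ are compact because of
  $b_{jk} = \tilde b_{jk}(a_k - a_j)$: if $w_k$ is differentiable along the $k$-th characteristics, then
  along the $j$-th ones $(a_k - a_j)w_k$ is, up to smooth factors and lower order terms, the
  derivative of an antiderivative of $w_k$ in time. Integration by parts then shows that $FBw$ is
  Lipschitz continuous in time, with a constant that does not involve time derivatives of $w$.
\<close>

section \<open>Riesz theory for operators with compact square\<close>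

text \<open>Two features dictate the reduction. \<open>F\<close> integrates each component along one
  family of characteristics; it gains regularity in that single direction and is not compact by
  itself. Coupling by \<open>B\<close> to a component with other characteristics and integrating
  once more supplies the transversal direction, which is why compactness appears only in the square.
  Moreover, (i) counts the admissible right-hand sides f and not the functions Ff, so the
  codimension cannot be read off directly from I - C + FB acting on u. In the unknown v = f - Bu the
  admissible f form exactly the range of I + BG, where G = (I - C)^{-1} F, and G maps the kernel of
  I + BG bijectively onto the solutions of the homogeneous problem. The inverse standing between B
  and F in the square has no explicit formula; G = F + CG trades it for F and C, whose values are
  differentiable along characteristics. That the index is zero, and not merely finite, comes from (I
  + T)(I - T) = I - T^2 with commuting factors: kernels and ranges of the powers of I - T become
  stationary.\<close>

definition compact_map :: "('a::real_normed_vector \<Rightarrow> 'b::real_normed_vector) \<Rightarrow> bool" where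
  "compact_map K \<longleftrightarrow> (\<forall>x::nat \<Rightarrow> 'a. bounded (range x) \<longrightarrow>
     (\<exists>r. strict_mono r \<and> convergent (\<lambda>n. K (x (r n)))))"

lemma compact_mapD:
  assumes "compact_map K" "\<And>n. norm (x n) \<le> B"
  obtains r l where "strict_mono (r :: nat \<Rightarrow> nat)" "(\<lambda>n. K (x (r n))) \<longlonglongrightarrow> l"
proof -
  have "bounded (range x)" using assms(2) by (auto simp: bounded_iff)
  then show ?thesis using assms(1) that unfolding compact_map_def convergent_def by blast
qed

lemma compact_mapI:
  fixes K :: "'a::real_normed_vector \<Rightarrow> 'b::real_normed_vector"
  assumes "\<And>(x::nat \<Rightarrow> 'a) B. (\<And>n. norm (x n) \<le> B) \<Longrightarrow> \<exists>r. strict_mono r \<and> convergent (\<lambda>n. K (x (r n)))"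
  shows "compact_map K"
  unfolding compact_map_def
proof (intro allI impI)
  fix x :: "nat \<Rightarrow> 'a" assume "bounded (range x)"
  then obtain B where "\<And>n. norm (x n) \<le> B" by (auto simp: bounded_iff)
  then show "\<exists>r. strict_mono r \<and> convergent (\<lambda>n. K (x (r n)))" by (rule assms)
qed

lemma compact_map_add:
  fixes K L :: "'a::real_normed_vector \<Rightarrow> 'b::real_normed_vector"
  assumes "compact_map K" "compact_map L"
  shows "compact_map (\<lambda>x. K x + L x)"
proof (rule compact_mapI)
  fix x :: "nat \<Rightarrow> 'a" and B assume B: "\<And>n. norm (x n) \<le> B"
  obtain r l where r: "strict_mono r" "(\<lambda>n. K (x (r n))) \<longlonglongrightarrow> l"
    using compact_mapD[OF assms(1) B] .
  obtain s l' where s: "strict_mono s" "(\<lambda>n. L (x (r (s n)))) \<longlonglongrightarrow> l'"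
    using compact_mapD[OF assms(2), of "\<lambda>n. x (r n)" B] B by blast
  have "(\<lambda>n. K (x (r (s n)))) \<longlonglongrightarrow> l"
    using LIMSEQ_subseq_LIMSEQ[OF r(2) s(1)] by (simp add: o_def)
  then have "(\<lambda>n. K (x ((r \<circ> s) n)) + L (x ((r \<circ> s) n))) \<longlonglongrightarrow> l + l'"
    using tendsto_add s(2) by fastforce
  then show "\<exists>r. strict_mono r \<and> convergent (\<lambda>n. K (x (r n)) + L (x (r n)))"
    using strict_mono_o[OF r(1) s(1)] convergentI by blast
qed

lemma compact_map_comp_left:
  fixes K :: "'a::real_normed_vector \<Rightarrow> 'b::real_normed_vector"
  assumes "bounded_linear B" "compact_map K"
  shows "compact_map (\<lambda>x. B (K x))"
proof (rule compact_mapI)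
  fix x :: "nat \<Rightarrow> 'a" and M assume M: "\<And>n. norm (x n) \<le> M"
  obtain r l where "strict_mono r" "(\<lambda>n. K (x (r n))) \<longlonglongrightarrow> l"
    using compact_mapD[OF assms(2) M] .
  then show "\<exists>r. strict_mono r \<and> convergent (\<lambda>n. B (K (x (r n))))"
    using bounded_linear.tendsto[OF assms(1)] convergentI by blast
qed

lemma compact_map_comp_right:
  fixes B :: "'a::real_normed_vector \<Rightarrow> 'b::real_normed_vector"
  assumes "bounded_linear B" "compact_map K"
  shows "compact_map (\<lambda>x. K (B x))"
proof (rule compact_mapI)
  fix x :: "nat \<Rightarrow> 'a" and M assume M: "\<And>n. norm (x n) \<le> M"
  obtain C where C: "\<And>x. norm (B x) \<le> norm x * C" "0 \<le> C"
    using bounded_linear.nonneg_bounded[OF assms(1)] by blast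
  have "norm (B (x n)) \<le> M * C" for n
    using C(1)[of "x n"] mult_right_mono[OF M C(2)] by (rule order_trans)
  then obtain r l where "strict_mono r" "(\<lambda>n. K (B (x (r n)))) \<longlonglongrightarrow> l"
    by (rule compact_mapD[OF assms(2)])
  then show "\<exists>r. strict_mono r \<and> convergent (\<lambda>n. K (B (x (r n))))"
    using convergentI by blast
qed

section \<open>Riesz's lemma and chains of closed subspaces\<close>

lemma Riesz_lemma:
  fixes F :: "'a::real_normed_vector set"
  assumes F: "subspace F" "closed F" and x: "x \<notin> F"
  obtains y where "y \<in> F" "x \<noteq> y" "\<And>z. z \<in> F \<Longrightarrow> 1/2 \<le> norm ((x - y) /\<^sub>R norm (x - y) - z)"
proof -
  have ne: "F \<noteq> {}" using F subspace_0 by blast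
  define d where "d = infdist x F"
  have d: "d > 0" using in_closed_iff_infdist_zero[OF F(2) ne, of x] x infdist_nonneg[of x F]
    by (auto simp: d_def order_less_le)
  \<comment> \<open>Any factor above 1 could replace 2; it produces the gap 1/2. Returning y instead
    of the unit vector keeps it visible that \<open>(x - y) /\<^sub>R norm (x - y)\<close> lies in
    every subspace containing F and x.\<close>
  obtain y where y: "y \<in> F" "dist x y < 2 * d"
    using cInf_lessD[of "dist x ` F" "2 * d"] ne d unfolding d_def infdist_def by auto
  show thesis
  proof (rule that[OF y(1)])
    show xy: "x \<noteq> y" using x y by blast
    fix z assume z: "z \<in> F"
    define e where "e = norm (x - y)"
    have e: "e > 0" "e < 2 * d" using xy y by (auto simp: e_def dist_norm)
    have "y + e *\<^sub>R z \<in> F" using F(1) y z by (simp add: subspace_add subspace_scale)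
    then have "d \<le> norm (x - (y + e *\<^sub>R z))"
      unfolding d_def using infdist_le[of _ F x] by (simp add: dist_norm)
    also have "x - (y + e *\<^sub>R z) = e *\<^sub>R ((x - y) /\<^sub>R e - z)"
      using e by (simp add: algebra_simps)
    finally have "d \<le> e * norm ((x - y) /\<^sub>R e - z)" using e by simp
    moreover have "e * norm ((x - y) /\<^sub>R e - z) \<le> 2 * d * norm ((x - y) /\<^sub>R e - z)"
      using e by (intro mult_right_mono) auto
    ultimately have "d * 1 \<le> d * (2 * norm ((x - y) /\<^sub>R e - z))" by simp
    then have "1 \<le> 2 * norm ((x - y) /\<^sub>R e - z)" using d by (simp only: mult_le_cancel_left_pos)
    then show "1/2 \<le> norm ((x - y) /\<^sub>R norm (x - y) - z)" by (simp add: e_def)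
  qed
qed

text \<open>The coefficient of x is controlled by the distance of x from \<open>span B\<close>, so
  along a convergent sequence in the larger span the coefficients are Cauchy. Subtracting their
  limit leads back to the closed \<open>span B\<close>.\<close>

lemma closed_span_insert:
  fixes x :: "'a::real_normed_vector"
  assumes cl: "closed (span B)"
  shows "closed (span (insert x B))"
proof (cases "x \<in> span B")
  case True
  then show ?thesis using cl by (simp add: span_redundant)
next
  case False
  have ne: "span B \<noteq> {}" using span_zero by blast
  define d where "d = infdist x (span B)"
  have d: "d > 0"
    using in_closed_iff_infdist_zero[OF cl ne, of x] False infdist_nonneg[of x "span B"]
    by (auto simp: d_def order_less_le)
  have bound: "\<bar>k\<bar> * d \<le> norm (y + k *\<^sub>R x)" if "y \<in> span B" for y k
  proof (cases "k = 0")
    case False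
    have "- (inverse k) *\<^sub>R y \<in> span B" using that span_scale by blast
    then have "d \<le> norm (x - (- (inverse k) *\<^sub>R y))"
      unfolding d_def using infdist_le[of _ "span B" x] by (metis dist_norm)
    then have "\<bar>k\<bar> * d \<le> norm (k *\<^sub>R (x - (- (inverse k) *\<^sub>R y)))"
      by (simp add: mult_left_mono)
    also have "k *\<^sub>R (x - (- (inverse k) *\<^sub>R y)) = y + k *\<^sub>R x"
      using False by (simp add: algebra_simps)
    finally show ?thesis .
  qed simp
  show ?thesis
    unfolding closed_sequential_limits
  proof (intro allI impI)
    fix u l assume "(\<forall>n. u n \<in> span (insert x B)) \<and> u \<longlonglongrightarrow> l"
    then have u: "\<forall>n. \<exists>k. u n - k *\<^sub>R x \<in> span B" and lim: "u \<longlonglongrightarrow> l"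
      by (auto simp: span_breakdown_eq)
    from u obtain k where k: "\<And>n. u n - k n *\<^sub>R x \<in> span B" by metis
    have kd: "\<bar>k m - k n\<bar> * d \<le> norm (u m - u n)" for m n
    proof -
      have "(u m - k m *\<^sub>R x) - (u n - k n *\<^sub>R x) \<in> span B" using k span_diff by blast
      from bound[OF this, of "k m - k n"] show ?thesis by (simp add: algebra_simps)
    qed
    have "Cauchy k"
    proof (rule metric_CauchyI)
      fix e :: real assume "e > 0"
      then have "e * d > 0" using d by simp
      then obtain M where M: "\<And>m n. m \<ge> M \<Longrightarrow> n \<ge> M \<Longrightarrow> dist (u m) (u n) < e * d"
        using metric_CauchyD[OF LIMSEQ_imp_Cauchy[OF lim]] by blast
      have "dist (k m) (k n) < e" if "m \<ge> M" "n \<ge> M" for m n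
      proof -
        have "\<bar>k m - k n\<bar> * d < e * d"
          using kd[of m n] M[OF that] by (simp add: dist_norm)
        then show ?thesis using d by (simp add: dist_real_def)
      qed
      then show "\<exists>M. \<forall>m\<ge>M. \<forall>n\<ge>M. dist (k m) (k n) < e" by blast
    qed
    then obtain c where c: "k \<longlonglongrightarrow> c" using Cauchy_convergent_iff convergent_def by blast
    have "(\<lambda>n. u n - k n *\<^sub>R x) \<longlonglongrightarrow> l - c *\<^sub>R x"
      by (intro tendsto_intros lim c)
    from closed_sequentially[OF cl k this] have "l - c *\<^sub>R x \<in> span B" .
    then show "l \<in> span (insert x B)" by (auto simp: span_breakdown_eq)
  qed
qed

lemma closed_span_finite:
  fixes B :: "'a::real_normed_vector set"
  shows "finite B \<Longrightarrow> closed (span B)"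
  by (induction B rule: finite_induct) (auto intro: closed_span_insert)

lemma compact_map_not_separated:
  fixes z :: "nat \<Rightarrow> 'a::real_normed_vector"
  assumes "compact_map S" and "\<And>n. norm (z n) \<le> 1"
    and sep: "\<And>m n. m < n \<Longrightarrow> 1/2 \<le> norm (S (z m) - S (z n))"
  shows False
proof -
  obtain r l where r: "strict_mono r" and l: "(\<lambda>n. S (z (r n))) \<longlonglongrightarrow> l"
    using compact_mapD[OF assms(1,2)] .
  obtain M where M: "\<And>m n. m \<ge> M \<Longrightarrow> n \<ge> M \<Longrightarrow> dist (S (z (r m))) (S (z (r n))) < 1/2"
    using metric_CauchyD[OF LIMSEQ_imp_Cauchy[OF l], of "1/2"] by auto
  show False
    using M[of M "Suc M"] sep[of "r M" "r (Suc M)"] r by (simp add: dist_norm strict_mono_less)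
qed

text \<open>A strictly increasing chain would provide unit vectors z n in F (n+1) at distance at
  least 1/2 from F n. Modulo F n, S (z n) equals z n, while S (z m) lies in F n for m < n. The
  images are thus 1/2-separated, against compactness.\<close>

lemma ascending_chain_stops:
  fixes F :: "nat \<Rightarrow> 'a::real_normed_vector set"
  assumes S: "compact_map S"
    and F: "\<And>n. subspace (F n)" "\<And>n. closed (F n)" "\<And>n. F n \<subseteq> F (Suc n)"
    and inv: "\<And>n x. x \<in> F n \<Longrightarrow> S x \<in> F n"
    and diff: "\<And>n x. x \<in> F (Suc n) \<Longrightarrow> x - S x \<in> F n"
  shows "\<exists>n. F (Suc n) = F n"
proof (rule ccontr)
  assume "\<nexists>n. F (Suc n) = F n"
  then have "\<exists>x. x \<in> F (Suc n) \<and> x \<notin> F n" for n using F(3) by blast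
  then obtain x where x: "\<And>n. x n \<in> F (Suc n)" "\<And>n. x n \<notin> F n" by metis
  have mono: "m \<le> n \<Longrightarrow> F m \<subseteq> F n" for m n using F(3) by (rule lift_Suc_mono_le)
  have "\<exists>z. z \<in> F (Suc n) \<and> norm z \<le> 1 \<and> (\<forall>y\<in>F n. 1/2 \<le> norm (z - y))" for n
  proof -
    obtain y where y: "y \<in> F n" "x n \<noteq> y"
      "\<And>z. z \<in> F n \<Longrightarrow> 1/2 \<le> norm ((x n - y) /\<^sub>R norm (x n - y) - z)"
      using Riesz_lemma[OF F(1,2) x(2)] by metis
    have "(x n - y) /\<^sub>R norm (x n - y) \<in> F (Suc n)"
      using y x F(1,3) by (meson subspace_diff subspace_scale subsetD)
    then show ?thesis using y by (intro exI[of _ "(x n - y) /\<^sub>R norm (x n - y)"]) auto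
  qed
  then obtain z where z: "\<And>n. z n \<in> F (Suc n)" "\<And>n. norm (z n) \<le> 1"
    "\<And>n y. y \<in> F n \<Longrightarrow> 1/2 \<le> norm (z n - y)" by metis
  show False
  proof (rule compact_map_not_separated[OF S z(2)])
    fix m n :: nat assume "m < n"
    then have "S (z m) \<in> F n" using inv[OF z(1)[of m]] mono[of "Suc m" n] by auto
    then have "(z n - S (z n)) + S (z m) \<in> F n" using diff[OF z(1)] F(1) subspace_add by blast
    from z(3)[OF this] show "1/2 \<le> norm (S (z m) - S (z n))"
      by (simp add: norm_minus_commute algebra_simps)
  qed
qed

text \<open>Mirror image of the ascending case: z m is chosen in F m away from F (m+1), and now the
  vector with the smaller index is the one that stays apart from all the others.\<close>

lemma descending_chain_stops:
  fixes F :: "nat \<Rightarrow> 'a::real_normed_vector set"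
  assumes S: "compact_map S"
    and F: "\<And>n. subspace (F n)" "\<And>n. closed (F n)" "\<And>n. F (Suc n) \<subseteq> F n"
    and inv: "\<And>n x. x \<in> F n \<Longrightarrow> S x \<in> F n"
    and diff: "\<And>n x. x \<in> F n \<Longrightarrow> x - S x \<in> F (Suc n)"
  shows "\<exists>n. F (Suc n) = F n"
proof (rule ccontr)
  assume "\<nexists>n. F (Suc n) = F n"
  then have "\<exists>x. x \<in> F n \<and> x \<notin> F (Suc n)" for n using F(3) by blast
  then obtain x where x: "\<And>n. x n \<in> F n" "\<And>n. x n \<notin> F (Suc n)" by metis
  have mono: "m \<le> n \<Longrightarrow> F n \<subseteq> F m" for m n using F(3) by (rule lift_Suc_antimono_le)
  have "\<exists>z. z \<in> F n \<and> norm z \<le> 1 \<and> (\<forall>y\<in>F (Suc n). 1/2 \<le> norm (z - y))" for n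
  proof -
    obtain y where y: "y \<in> F (Suc n)" "x n \<noteq> y"
      "\<And>z. z \<in> F (Suc n) \<Longrightarrow> 1/2 \<le> norm ((x n - y) /\<^sub>R norm (x n - y) - z)"
      using Riesz_lemma[OF F(1,2) x(2)] by metis
    have "(x n - y) /\<^sub>R norm (x n - y) \<in> F n"
      using y x F(1,3) by (meson subspace_diff subspace_scale subsetD)
    then show ?thesis using y by (intro exI[of _ "(x n - y) /\<^sub>R norm (x n - y)"]) auto
  qed
  then obtain z where z: "\<And>n. z n \<in> F n" "\<And>n. norm (z n) \<le> 1"
    "\<And>n y. y \<in> F (Suc n) \<Longrightarrow> 1/2 \<le> norm (z n - y)" by metis
  show False
  proof (rule compact_map_not_separated[OF S z(2)])
    fix m n :: nat assume "m < n"
    then have "S (z n) \<in> F (Suc m)" using inv[OF z(1)[of n]] mono[of "Suc m" n] by auto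
    then have "(z m - S (z m)) + S (z n) \<in> F (Suc m)"
      using diff[OF z(1)] F(1) subspace_add by blast
    from z(3)[OF this] show "1/2 \<le> norm (S (z m) - S (z n))"
      by (simp add: algebra_simps)
  qed
qed

text \<open>On N the map S is the identity, so x - S x = 0 lies in every subspace, and the spans of
  the first n members of an infinite independent set would form a chain that never stops.\<close>

lemma finite_dimensional_fixed_points:
  fixes N :: "'a::real_normed_vector set"
  assumes N: "subspace N" and S: "compact_map S" "\<And>x. x \<in> N \<Longrightarrow> S x = x"
  shows "finite_dimensional N"
proof -
  obtain B where B: "B \<subseteq> N" "independent B" "N \<subseteq> span B"
    using maximal_independent_subset[of N] by blast
  have BN: "span B = N" using B N by (metis span_minimal subset_antisym)
  have "finite B"
  proof (rule ccontr)
    assume "infinite B"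
    then obtain f :: "nat \<Rightarrow> 'a" where f: "inj f" "range f \<subseteq> B"
      using infinite_countable_subset by blast
    define F where "F n = span (f ` {..<n})" for n
    have FN: "F n \<subseteq> N" for n
      unfolding F_def using f(2) B(1) N by (intro span_minimal) auto
    have "\<exists>n. F (Suc n) = F n"
    proof (rule ascending_chain_stops[OF S(1)])
      show "subspace (F n)" "closed (F n)" "F n \<subseteq> F (Suc n)" for n
        unfolding F_def by (auto intro!: closed_span_finite span_mono)
      show "S x \<in> F n" if "x \<in> F n" for n x using that FN S(2) by (metis subsetD)
      show "x - S x \<in> F n" if "x \<in> F (Suc n)" for n x
        using that FN S(2)[of x] span_zero by (auto simp: F_def subset_iff)
    qed
    then obtain n where "F (Suc n) = F n" ..
    then have "f n \<in> span (f ` {..<n})"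
      unfolding F_def using span_base[of "f n" "f ` {..<Suc n}"] by auto
    also have "\<dots> \<subseteq> span (B - {f n})"
      using f by (intro span_mono) (auto dest: injD)
    finally have "dependent B" using f(2) unfolding dependent_def by blast
    then show False using B(2) by blast
  qed
  then show ?thesis unfolding finite_dimensional_def using BN by blast
qed

text \<open>B inverts A up to a compact perturbation. This makes A bounded below modulo its kernel,
  so a convergent sequence in the range has bounded preimages, from which a convergent subsequence
  can be extracted.\<close>

lemma closed_range_left_regularizer:
  fixes A :: "'a::real_normed_vector \<Rightarrow> 'b::real_normed_vector"
  assumes A: "bounded_linear A" and B: "bounded_linear B" and S: "compact_map S"
    and BA: "\<And>x. B (A x) = x - S x"
  shows "closed (range A)"
proof -
  interpret A: bounded_linear A by fact
  interpret B: bounded_linear B by fact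
  define N where "N = {x. A x = 0}"
  have N: "subspace N" "closed N"
    unfolding N_def using A.linear_axioms linear_subspace_kernel
    by (auto intro!: closed_Collect_eq continuous_on_const A.continuous_on continuous_on_id)
  \<comment> \<open>The identity v = B (A v) + S v turns convergence of A (v n), and of S (v n)
    along a subsequence, into convergence of v itself along that subsequence.\<close>
  have conv: "\<exists>r l. strict_mono r \<and> (\<lambda>n. v (r n)) \<longlonglongrightarrow> l \<and> A l = y"
    if v: "\<And>n. norm (v n) \<le> M" and y: "(\<lambda>n. A (v n)) \<longlonglongrightarrow> y" for v :: "nat \<Rightarrow> 'a" and M y
  proof -
    obtain r l where r: "strict_mono r" and l: "(\<lambda>n. S (v (r n))) \<longlonglongrightarrow> l"
      using compact_mapD[OF S v] .
    have y': "(\<lambda>n. A (v (r n))) \<longlonglongrightarrow> y" using LIMSEQ_subseq_LIMSEQ[OF y r] by (simp add: o_def)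
    have "(\<lambda>n. B (A (v (r n))) + S (v (r n))) \<longlonglongrightarrow> B y + l"
      by (intro tendsto_add B.tendsto y' l)
    then have lim: "(\<lambda>n. v (r n)) \<longlonglongrightarrow> B y + l" by (simp add: BA)
    then have "A (B y + l) = y" using A.tendsto[OF lim] y' LIMSEQ_unique by blast
    then show ?thesis using r lim by blast
  qed
  \<comment> \<open>Otherwise there are unit vectors at distance at least 1/2 from N whose images
    under A tend to 0; by \<open>conv\<close> they would accumulate at a point of N.\<close>
  have "\<exists>c. \<forall>x. \<exists>z\<in>N. norm (x - z) \<le> c * norm (A x)"
  proof (rule ccontr)
    assume *: "\<nexists>c. \<forall>x. \<exists>z\<in>N. norm (x - z) \<le> c * norm (A x)"
    have "\<exists>w. norm w = 1 \<and> (\<forall>z\<in>N. 1/2 \<le> norm (w - z)) \<and> norm (A w) \<le> inverse (real (Suc n))" for n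
    proof -
      obtain x where x: "\<And>z. z \<in> N \<Longrightarrow> real (Suc n) * norm (A x) < norm (x - z)"
        using * by (meson not_le)
      then have "x \<notin> N" unfolding N_def by force
      then obtain y where y: "y \<in> N" "x \<noteq> y"
        "\<And>z. z \<in> N \<Longrightarrow> 1/2 \<le> norm ((x - y) /\<^sub>R norm (x - y) - z)"
        using Riesz_lemma[OF N] by metis
      have "norm (A ((x - y) /\<^sub>R norm (x - y))) = norm (A x) / norm (x - y)"
        using y(1) by (simp add: A.scaleR A.diff N_def divide_inverse_commute)
      also have "\<dots> \<le> inverse (real (Suc n))"
        using x[OF y(1)] y(2) by (simp add: field_simps)
      finally show ?thesis using y by (intro exI[of _ "(x - y) /\<^sub>R norm (x - y)"]) auto
    qed
    then obtain w where w: "\<And>n. norm (w n) = 1" "\<And>n z. z \<in> N \<Longrightarrow> 1/2 \<le> norm (w n - z)"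
      "\<And>n. norm (A (w n)) \<le> inverse (real (Suc n))" by metis
    have "(\<lambda>n. A (w n)) \<longlonglongrightarrow> 0"
      by (rule Lim_null_comparison[OF _ LIMSEQ_inverse_real_of_nat]) (use w(3) in auto)
    then obtain r l where r: "(\<lambda>n. w (r n)) \<longlonglongrightarrow> l" "A l = 0"
      using conv[of w 1 0] w(1) by auto
    obtain n where "norm (w (r n) - l) < 1/2"
      using LIMSEQ_D[OF r(1), of "1/2"] by auto
    then show False using w(2)[of l "r n"] r(2) by (auto simp: N_def)
  qed
  then obtain c where c: "\<And>x. \<exists>z\<in>N. norm (x - z) \<le> c * norm (A x)" by blast
  show ?thesis
    unfolding closed_sequential_limits
  proof (intro allI impI)
    fix u y assume "(\<forall>n. u n \<in> range A) \<and> u \<longlonglongrightarrow> y"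
    then have lim: "u \<longlonglongrightarrow> y" and "\<And>n. \<exists>x. u n = A x" by blast+
    then obtain x where x: "\<And>n. u n = A (x n)" by metis
    have "\<exists>v. A v = u n \<and> norm v \<le> c * norm (u n)" for n
    proof -
      obtain z where "A z = 0" "norm (x n - z) \<le> c * norm (A (x n))"
        using c[of "x n"] by (auto simp: N_def)
      then show ?thesis by (intro exI[of _ "x n - z"]) (simp add: x A.diff)
    qed
    then obtain v where v: "\<And>n. A (v n) = u n" "\<And>n. norm (v n) \<le> c * norm (u n)" by metis
    obtain M where M: "\<And>n. norm (u n) \<le> M"
      using convergent_imp_bounded[OF lim] by (auto simp: bounded_iff)
    have "norm (v n) \<le> \<bar>c\<bar> * M" for n
    proof -
      have "c * norm (u n) \<le> \<bar>c\<bar> * M"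
        using M[of n] by (intro mult_mono) auto
      then show ?thesis using v(2)[of n] by linarith
    qed
    then show "y \<in> range A" using conv[of v "\<bar>c\<bar> * M" y] v(1) lim by auto
  qed
qed

section \<open>Complements, rank-nullity and codimension\<close>

lemma complement_in_finite_dimensional:
  fixes N :: "'a::real_vector set"
  assumes fin: "finite_dimensional N" and U: "subspace U" "U \<subseteq> N"
  obtains V where "subspace V" "V \<subseteq> N" "finite_dimensional V" "U \<inter> V = {0}"
    "\<And>x. x \<in> N \<Longrightarrow> \<exists>u\<in>U. \<exists>v\<in>V. x = u + v" "dim V + dim U = dim N" "finite_dimensional U"
proof -
  obtain G where G: "finite G" "span G = N" using fin unfolding finite_dimensional_def by blast
  obtain B where B: "B \<subseteq> U" "independent B" "U \<subseteq> span B"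
    using maximal_independent_subset by blast
  obtain B' where B': "B \<subseteq> B'" "B' \<subseteq> N" "independent B'" "N \<subseteq> span B'"
    using maximal_independent_subset_extend[OF subset_trans[OF B(1) U(2)] B(2)] by metis
  have finB': "finite B'" using independent_span_bound[OF G(1) B'(3)] B'(2) G(2) by auto
  have UB: "span B = U" using B U(1) by (metis span_minimal subset_antisym)
  have NB: "span B' = N" using B' G(2) by (metis span_minimal subset_antisym subspace_span)
  define V where "V = span (B' - B)"
  show thesis
  proof (rule that)
    show "subspace V" "finite_dimensional V" "V \<subseteq> N"
      unfolding V_def finite_dimensional_def using finB' NB by (auto intro!: span_mono)
    show "U \<inter> V = {0}"
    proof -
      \<comment> \<open>Coordinates with respect to B' are unique, so those of x are supported both
        in B and in B' - B.\<close>
      have "x = 0" if x: "x \<in> span B" "x \<in> span (B' - B)" for x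
      proof -
        have "representation B' x = representation B x"
          "representation B' x = representation (B' - B) x"
          by (rule representation_extend[OF B'(3)]; use x B'(1) in auto)+
        then have "representation B' x b = 0" for b
          using representation_ne_zero[of B x b] representation_ne_zero[of "B' - B" x b] by auto
        moreover have "x \<in> span B'" using x(1) B'(1) span_mono by blast
        ultimately show "x = 0"
          using sum_nonzero_representation_eq[OF B'(3), of x] by simp
      qed
      then show ?thesis using span_zero by (auto simp: V_def UB[symmetric])
    qed
    show "\<exists>u\<in>U. \<exists>v\<in>V. x = u + v" if "x \<in> N" for x
    proof -
      have "x \<in> span (B \<union> (B' - B))" using that NB B'(1) by (simp add: Un_absorb1)
      then show ?thesis unfolding span_Un UB V_def by blast
    qed
    have "independent (B' - B)" using B'(3) independent_mono by blast
    then have "dim V = card (B' - B)" by (simp add: V_def dim_eq_card_independent)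
    moreover have "dim U = card B" using B by (metis UB dim_span_eq_card_independent)
    moreover have "dim N = card B'" using B' by (metis NB dim_span_eq_card_independent)
    ultimately show "dim V + dim U = dim N"
      using B'(1) finB' by (simp add: card_Diff_subset card_mono finite_subset)
    show "finite_dimensional U"
      unfolding finite_dimensional_def using UB finite_subset[OF B'(1) finB'] by blast
  qed
qed

lemma dim_linear_image_inj:
  fixes f :: "'a::real_vector \<Rightarrow> 'b::real_vector"
  assumes f: "linear f" and inj: "inj_on f (span S)"
  shows "dim (f ` S) = dim S"
proof -
  obtain B where B: "B \<subseteq> S" "independent B" "S \<subseteq> span B" "card B = dim S"
    using basis_exists by blast
  have BS: "span B = span S" using B by (metis span_mono span_span subset_antisym)
  have "independent (f ` B)"
    using linear_independent_injective_image[OF f B(2)] inj BS by simp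
  moreover have "f ` B \<subseteq> f ` S" "f ` S \<subseteq> span (f ` B)"
    using B by (auto simp: linear_span_image[OF f])
  moreover have "card (f ` B) = card B"
    using inj B(1) span_superset[of S] by (intro card_image inj_on_subset[OF inj]) blast
  ultimately show ?thesis using dim_unique[of "f ` B" "f ` S"] B(4) by simp
qed

text \<open>Rank-nullity for the restriction of A to N; the hypothesis \<open>ker\<close> ensures
  that N sees the whole kernel of A.\<close>

lemma kernel_range_dimension:
  fixes A :: "'a::real_vector \<Rightarrow> 'a"
  assumes A: "linear A" and N: "subspace N" "finite_dimensional N" "A ` N \<subseteq> N"
    and ker: "\<And>x. A x = 0 \<Longrightarrow> x \<in> N"
  shows "finite_dimensional {x. A x = 0}" "dim (A ` N) + dim {x. A x = 0} = dim N"
proof -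
  define Z where "Z = {x. A x = 0}"
  have Z: "subspace Z" "Z \<subseteq> N"
    unfolding Z_def using linear_subspace_kernel[OF A] ker by auto
  obtain V where V: "subspace V" "V \<subseteq> N" "Z \<inter> V = {0}"
    "\<And>x. x \<in> N \<Longrightarrow> \<exists>u\<in>Z. \<exists>v\<in>V. x = u + v" "dim V + dim Z = dim N" "finite_dimensional Z"
    using complement_in_finite_dimensional[OF N(2) Z] by metis
  have "inj_on A (span V)"
  proof (rule inj_onI)
    fix x y assume xy: "x \<in> span V" "y \<in> span V" "A x = A y"
    then have "x - y \<in> V" "x - y \<in> Z"
      using V(1) by (auto simp: Z_def linear_diff[OF A] subspace_diff span_eq_iff[THEN iffD2])
    then have "x - y \<in> Z \<inter> V" by blast
    then show "x = y" unfolding V(3) by simp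
  qed
  then have "dim (A ` V) = dim V" by (rule dim_linear_image_inj[OF A])
  moreover have "A ` N = A ` V"
  proof
    show "A ` N \<subseteq> A ` V"
    proof
      fix y assume "y \<in> A ` N"
      then obtain u v where "y = A (u + v)" "u \<in> Z" "v \<in> V" using V(4) by blast
      then show "y \<in> A ` V" by (auto simp: Z_def linear_add[OF A])
    qed
    show "A ` V \<subseteq> A ` N" using V(2) by blast
  qed
  ultimately show "dim (A ` N) + dim {x. A x = 0} = dim N" using V(5) by (simp add: Z_def)
  show "finite_dimensional {x. A x = 0}" using V(6) by (simp add: Z_def)
qed

text \<open>Once the powers are stationary, the space is the sum of the generalised kernel N and the
  range of \<open>A ^^ p\<close>. On the finite-dimensional N, dim N - dim (A N) = dim ker A, and a
  complement V of A N in N turns out to be a complement of the range of A in the whole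
  space.\<close>

lemma codimension_range_eq_dim_kernel:
  fixes A :: "'a::real_vector \<Rightarrow> 'a"
  assumes A: "linear A" and fin: "finite_dimensional {x. (A ^^ p) x = 0}"
    and ker: "\<And>x. (A ^^ Suc p) x = 0 \<Longrightarrow> (A ^^ p) x = 0"
    and ran: "range (A ^^ p) \<subseteq> range (A ^^ (p + p))" and p: "p > 0"
  shows "has_codimension (range A) (dim {x. A x = 0})"
proof -
  have lin: "linear (A ^^ n)" for n
    by (induction n) (auto intro: linear_compose[OF _ A] simp: linear_ident id_def simp del: o_apply)
  have comm: "(A ^^ n) (A x) = A ((A ^^ n) x)" for n x by (simp add: funpow_swap1)
  define N where "N = {x. (A ^^ p) x = 0}"
  have N: "subspace N" "A ` N \<subseteq> N"
    unfolding N_def using linear_subspace_kernel[OF lin] by (auto simp: comm linear_0[OF A])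
  have kerN: "x \<in> N" if "A x = 0" for x
    using that p linear_0[OF lin, of "p - 1"] funpow_Suc_right[of "p - 1" A]
    by (auto simp: N_def)
  have sub: "subspace (A ` N)" using A N(1) linear_subspace_image by blast
  note dims = kernel_range_dimension[OF A N(1) _ N(2) kerN] 
  have finN: "finite_dimensional N" using fin by (simp add: N_def)
  obtain V where V: "subspace V" "V \<subseteq> N" "finite_dimensional V" "A ` N \<inter> V = {0}"
    "\<And>x. x \<in> N \<Longrightarrow> \<exists>u\<in>A ` N. \<exists>v\<in>V. x = u + v" "dim V + dim (A ` N) = dim N"
    using complement_in_finite_dimensional[OF finN sub N(2)] by metis
  have "dim V = dim {x. A x = 0}" using V(6) dims(2)[OF finN] by simp
  moreover have "range A \<inter> V = {0}"
  proof -
    \<comment> \<open>As A x is in N, \<open>A ^^ Suc p\<close> kills x; by stability x itself is in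
      N, and A x lies in the intersection of A N with V.\<close>
    have "A x = 0" if "A x \<in> V" for x
    proof -
      have "A x \<in> N" using that V(2) by blast
      then have "x \<in> N" using ker by (simp add: N_def comm)
      then show ?thesis using V(4) that by blast
    qed
    moreover have "0 \<in> range A" using linear_0[OF A] by (metis rangeI)
    ultimately show ?thesis using subspace_0[OF V(1)] by auto
  qed
  moreover have "{s + t |s t. s \<in> range A \<and> t \<in> V} = UNIV"
  proof -
    have "\<exists>s\<in>range A. \<exists>t\<in>V. z = s + t" for z
    proof -
      \<comment> \<open>This y splits z: z - \<open>(A ^^ p) y\<close> is in N, and
        \<open>(A ^^ p) y\<close> is in the range of A because p > 0.\<close>
      obtain y where y: "(A ^^ p) z = (A ^^ (p + p)) y" using ran by blast
      have "z - (A ^^ p) y \<in> N"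
        using y by (simp add: N_def linear_diff[OF lin] funpow_add)
      then obtain n v where nv: "v \<in> V" "z - (A ^^ p) y = A n + v" using V(5) by blast
      have "(A ^^ p) y = A ((A ^^ (p - 1)) y)" using p by (cases p) auto
      then have "z = A (n + (A ^^ (p - 1)) y) + v"
        using nv(2) by (simp add: linear_add[OF A] algebra_simps)
      then show ?thesis using nv(1) by blast
    qed
    then show ?thesis by blast
  qed
  ultimately show ?thesis unfolding has_codimension_def using V(3) by blast
qed

text \<open>With B = I + T one has A B = B A = I - S for the compact S = T^2. Thus B regularises A
  on both sides and commutes with it, and Riesz's argument for compact T goes through: kernels and
  ranges of the powers of A both become stationary.\<close>

theorem Fredholm_alternative_compact_square:
  fixes T :: "'a::real_normed_vector \<Rightarrow> 'a"
  assumes T: "bounded_linear T" and comp: "compact_map (\<lambda>x. T (T x))"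
  defines "A \<equiv> \<lambda>x. x - T x"
  shows "finite_dimensional {x. A x = 0}" "closed (range A)"
    "has_codimension (range A) (dim {x. A x = 0})"
proof -
  interpret T: bounded_linear T by fact
  define B where "B x = x + T x" for x
  define S where "S x = T (T x)" for x
  have A: "bounded_linear A" unfolding A_def by (intro bounded_linear_intros T)
  have B: "bounded_linear B" unfolding B_def by (intro bounded_linear_intros T)
  interpret A: bounded_linear A by fact
  have S: "compact_map S" using comp by (simp add: S_def[abs_def])
  have BA: "B (A x) = x - S x" and AB: "A (B x) = x - S x" and SA: "S (A x) = A (S x)" for x
    by (simp_all add: A_def B_def S_def T.diff T.add)
  have blA: "bounded_linear (A ^^ n)" for n
    by (induction n) (auto intro: bounded_linear_compose[OF A] simp: o_def id_def)
  have comm: "(A ^^ n) (A x) = A ((A ^^ n) x)" for n x by (simp add: funpow_swap1)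
  \<comment> \<open>Composing n factors B inverts \<open>A ^^ n\<close> up to a compact map.
    Finite-dimensional kernels and closed ranges then follow for all powers at once, as the chain
    lemmas demand.\<close>
  have "\<exists>B' S'. bounded_linear B' \<and> compact_map S' \<and> (\<forall>x. B' ((A ^^ n) x) = x - S' x)" for n
  proof (induction n)
    case 0
    have "compact_map (\<lambda>x::'a. 0 :: 'a)"
      by (rule compact_mapI) (use strict_mono_id in \<open>auto simp: convergent_const\<close>)
    then show ?case by (intro exI[of _ "\<lambda>x. x"] exI[of _ "\<lambda>x. 0"]) simp
  next
    case (Suc n)
    then obtain B' S' where B': "bounded_linear B'" "compact_map S'"
      "\<And>x. B' ((A ^^ n) x) = x - S' x" by blast
    have "B (B' ((A ^^ Suc n) x)) = x - (S x + B (S' (A x)))" for x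
      using B'(3)[of "A x"] linear_diff[OF bounded_linear.linear[OF B]] BA[of x]
      by (simp add: comm[symmetric])
    then show ?case
      using bounded_linear_compose[OF B B'(1)]
        compact_map_add[OF S compact_map_comp_left[OF B compact_map_comp_right[OF A B'(2)]]]
      by blast
  qed
  then obtain B' S' where B': "\<And>n. bounded_linear (B' n)" "\<And>n. compact_map (S' n)"
      "\<And>n x. B' n ((A ^^ n) x) = x - S' n x" by metis
  define ker where "ker n = {x. (A ^^ n) x = 0}" for n
  have sub_ker: "subspace (ker n)" for n
    unfolding ker_def using blA bounded_linear.linear linear_subspace_kernel by blast
  have fin: "finite_dimensional (ker n)" for n
  proof (rule finite_dimensional_fixed_points[OF sub_ker B'(2)[of n]])
    fix x assume "x \<in> ker n"
    then show "S' n x = x"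
      using B'(3)[of n x] linear_0[OF bounded_linear.linear[OF B'(1)[of n]]] by (simp add: ker_def)
  qed
  have SAn: "S ((A ^^ n) x) = (A ^^ n) (S x)" for n x by (induction n) (auto simp: SA)
  have "\<exists>n. ker (Suc n) = ker n"
  proof (rule ascending_chain_stops[OF S sub_ker])
    show "closed (ker n)" for n
      using fin[of n] closed_span_finite unfolding finite_dimensional_def by metis
    show "ker n \<subseteq> ker (Suc n)" for n by (auto simp: ker_def A.zero)
    show "S x \<in> ker n" if "x \<in> ker n" for n x
      using that SAn[of n x] by (simp add: ker_def S_def T.zero)
    show "x - S x \<in> ker n" if "x \<in> ker (Suc n)" for n x
    proof -
      have AnB: "(A ^^ n) (B y) = B ((A ^^ n) y)" for y
      proof (induction n arbitrary: y)
        case (Suc n)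
        then show ?case using AB BA by simp
      qed simp
      have "(A ^^ n) (B (A x)) = B (A ((A ^^ n) x))" by (simp add: AnB comm)
      then show ?thesis using that by (simp add: ker_def BA[symmetric] B_def T.zero)
    qed
  qed
  then obtain n where n: "ker (Suc n) = ker n" ..
  have "\<exists>n. range (A ^^ Suc n) = range (A ^^ n)"
  proof (rule descending_chain_stops[OF S])
    show "subspace (range (A ^^ n))" for n
      by (rule linear_subspace_image[OF bounded_linear.linear[OF blA] subspace_UNIV])
    show "closed (range (A ^^ n))" for n
      using closed_range_left_regularizer[OF blA B'] .
    show "range (A ^^ Suc n) \<subseteq> range (A ^^ n)" for n
      by (auto simp: comm[symmetric] simp del: funpow.simps simp add: funpow_Suc_right)
    show "S x \<in> range (A ^^ n)" if "x \<in> range (A ^^ n)" for n x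
      using that SAn by auto
    show "x - S x \<in> range (A ^^ Suc n)" if x: "x \<in> range (A ^^ n)" for n x
    proof -
      obtain y where "x = (A ^^ n) y" using x by blast
      then have "x - S x = (A ^^ n) (A (B y))"
        by (simp add: SAn AB linear_diff[OF bounded_linear.linear[OF blA]])
      then show ?thesis by (auto simp: comm)
    qed
  qed
  then obtain q where q: "range (A ^^ Suc q) = range (A ^^ q)" ..
  have kn: "ker (n + i) = ker n" for i
  proof (induction i)
    case (Suc i)
    have "x \<in> ker n" if "x \<in> ker (Suc (n + i))" for x
    proof -
      have "A x \<in> ker (n + i)" using that by (simp add: ker_def comm)
      then have "A x \<in> ker n" using Suc by simp
      then have "x \<in> ker (Suc n)" by (simp add: ker_def comm)
      then show ?thesis using n by blast
    qed
    moreover have "ker n \<subseteq> ker (Suc (n + i))"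
    proof
      fix x assume "x \<in> ker n"
      then have "x \<in> ker (n + i)" using Suc by simp
      then show "x \<in> ker (Suc (n + i))" by (simp add: ker_def A.zero)
    qed
    ultimately show ?case by auto
  qed simp
  have rq: "range (A ^^ (q + i)) = range (A ^^ q)" for i
  proof (induction i)
    case (Suc i)
    have "range (A ^^ Suc (q + i)) = A ` range (A ^^ (q + i))" by (auto simp: image_image)
    also have "\<dots> = range (A ^^ Suc q)" by (auto simp: Suc image_image)
    finally show ?case using q by simp
  qed simp
  \<comment> \<open>Beyond both stopping indices; the extra 1 makes p positive.\<close>
  define p where "p = n + q + 1"
  show "has_codimension (range A) (dim {x. A x = 0})"
  proof (rule codimension_range_eq_dim_kernel[of A p])
    show "linear A" by (rule A.linear_axioms)
    show "finite_dimensional {x. (A ^^ p) x = 0}" using fin[of p] by (simp add: ker_def)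
    show "(A ^^ p) x = 0" if "(A ^^ Suc p) x = 0" for x
    proof -
      have "x \<in> ker (n + (q + 2))" using that by (simp add: ker_def p_def)
      then have "x \<in> ker (n + (q + 1))" using kn by blast
      then show ?thesis by (simp add: ker_def p_def)
    qed
    show "range (A ^^ p) \<subseteq> range (A ^^ (p + p))"
    proof -
      have "p = q + (n + 1)" "p + p = q + (n + 1 + p)" by (simp_all add: p_def)
      then show ?thesis using rq by (metis order_refl)
    qed
    show "p > 0" by (simp add: p_def)
  qed
  show "finite_dimensional {x. A x = 0}" using fin[of 1] by (simp add: ker_def)
  show "closed (range A)"
    using closed_range_left_regularizer[OF A B S BA] .
qed

text \<open>Only a power of C is contractive, so the fixed point of x -> C x + y is found for the
  l-th iterate of this map. The map commutes with its iterate, whose fixed point is unique, and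
  therefore fixes that point as well.\<close>

lemma bounded_inverse_of_contracting_power:
  fixes C :: "'a::banach \<Rightarrow> 'a"
  assumes C: "bounded_linear C" and contr: "onorm (C ^^ l) < 1"
  obtains Q where "bounded_linear Q" "\<And>x. Q (x - C x) = x" "\<And>x. Q x - C (Q x) = x"
proof -
  interpret C: bounded_linear C by fact
  have blC: "bounded_linear (C ^^ n)" for n
    by (induction n) (auto intro: bounded_linear_compose[OF C] simp: o_def id_def)
  define q where "q = onorm (C ^^ l)"
  have q: "0 \<le> q" "q < 1" using contr onorm_pos_le[OF blC] by (auto simp: q_def)
  have qC: "norm ((C ^^ l) x) \<le> q * norm x" for x
    unfolding q_def by (rule onorm[OF blC])
  define G where "G n y = (\<Sum>i<n. (C ^^ i) y)" for n y
  have iter: "((\<lambda>x. C x + y) ^^ n) x = (C ^^ n) x + G n y" for n x y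
    by (induction n) (simp_all add: G_def C.add C.sum sum.lessThan_Suc_shift del: sum.lessThan_Suc)
  have ex: "\<exists>x. C x + y = x" for y
  proof -
    define \<Phi> where "\<Phi> x = C x + y" for x
    have "dist ((\<Phi> ^^ l) u) ((\<Phi> ^^ l) v) \<le> q * dist u v" for u v
      using qC[of "u - v"] linear_diff[OF bounded_linear.linear[OF blC]]
      by (simp add: dist_norm iter \<Phi>_def[abs_def])
    then have "\<exists>!x\<in>UNIV. (\<Phi> ^^ l) x = x"
      using q by (intro Banach_fix[of UNIV q]) (auto simp: complete_UNIV)
    then obtain x where x: "(\<Phi> ^^ l) x = x" "\<And>x'. (\<Phi> ^^ l) x' = x' \<Longrightarrow> x' = x" by auto
    have "(\<Phi> ^^ l) (\<Phi> x) = \<Phi> x" using x(1) by (simp add: funpow_swap1[symmetric])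
    then show ?thesis using x(2) by (auto simp: \<Phi>_def)
  qed
  then obtain Q where Q: "\<And>y. C (Q y) + y = Q y" by metis
  have inj: "x = 0" if "C x = x" for x
  proof -
    have "(C ^^ n) x = x" for n by (induction n) (simp_all add: that)
    then have "(1 - q) * norm x \<le> 0" using qC[of x] by (simp add: algebra_simps)
    then show ?thesis using q by (simp add: mult_le_0_iff)
  qed
  have uniq: "Q y = v" if "C v + y = v" for y v
  proof -
    have "C (Q y - v) = (C (Q y) + y) - (C v + y)" by (simp add: C.diff)
    also have "\<dots> = Q y - v" by (simp add: Q that)
    finally show ?thesis using inj[of "Q y - v"] by simp
  qed
  have QC: "Q (x - C x) = x" for x by (rule uniq) simp
  have "bounded_linear Q"
  proof (rule bounded_linear_intro)
    show "Q (x + y) = Q x + Q y" for x y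
    proof (rule uniq)
      have "C (Q x + Q y) + (x + y) = (C (Q x) + x) + (C (Q y) + y)" by (simp add: C.add)
      then show "C (Q x + Q y) + (x + y) = Q x + Q y" by (simp only: Q)
    qed
    show "Q (r *\<^sub>R x) = r *\<^sub>R Q x" for r x
      by (rule uniq) (metis Q C.scaleR scaleR_add_right)
    have blG: "bounded_linear (G l)"
      unfolding G_def[abs_def] by (intro bounded_linear_sum blC)
    \<comment> \<open>Expanding Q y = C (Q y) + y in l steps gives Q y as
      \<open>(C ^^ l) (Q y)\<close> plus the partial Neumann sum G l y; as q < 1, the first term is
      absorbed on the left.\<close>
    show "norm (Q y) \<le> norm y * (onorm (G l) / (1 - q))" for y
    proof -
      have fix_pow: "((\<lambda>x. C x + y) ^^ n) (Q y) = Q y" for n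
        by (induction n) (simp_all add: Q)
      have "norm (Q y) \<le> norm ((C ^^ l) (Q y)) + norm (G l y)"
        using iter[where n = l and x = "Q y" and y = y] fix_pow[of l] norm_triangle_ineq
        by metis
      also have "\<dots> \<le> q * norm (Q y) + onorm (G l) * norm y"
        by (intro add_mono qC onorm[OF blG])
      finally have "(1 - q) * norm (Q y) \<le> onorm (G l) * norm y" by (simp add: algebra_simps)
      then show ?thesis using q by (simp add: field_simps)
    qed
  qed
  then show thesis using that[of Q] QC Q by (metis add_diff_cancel_left')
qed

lemma finite_dimensional_dim_0:
  assumes "finite_dimensional V" "dim V = 0"
  shows "V = {0}"
proof -
  obtain G where G: "finite G" "span G = V" using assms(1) unfolding finite_dimensional_def by blast
  obtain B where B: "B \<subseteq> V" "independent B" "V \<subseteq> span B" "card B = dim V"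
    using basis_exists by blast
  have "finite B" using independent_span_bound[OF G(1) B(2)] B(1) G(2) by simp
  then have "B = {}" using B(4) assms(2) by simp
  then have "V \<subseteq> {0}" using B(3) by simp
  then show ?thesis using G(2) span_zero[of G] by auto
qed

theorem Fredholm_alternative_boundary_problem:
  fixes C F B :: "'a::banach \<Rightarrow> 'a"
  assumes C: "bounded_linear C" and F: "bounded_linear F" and B: "bounded_linear B"
    and contr: "onorm (C ^^ l) < 1"
    and FBF: "compact_map (\<lambda>x. F (B (F x)))" and FBC: "compact_map (\<lambda>x. F (B (C x)))"
    and sol: "\<And>f u. sol f u \<longleftrightarrow> u = C u - F (B u) + F f"
  defines "K \<equiv> {u. sol 0 u}" and "S \<equiv> {f. \<exists>u. sol f u}"
  shows "finite_dimensional K" "subspace S" "closed S" "has_codimension S (dim K)"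
    "dim K = 0 \<Longrightarrow> \<exists>!u. sol f u"
proof -
  interpret C: bounded_linear C by fact
  interpret F: bounded_linear F by fact
  interpret B: bounded_linear B by fact
  obtain Q where Q: "bounded_linear Q" "\<And>x. Q (x - C x) = x" "\<And>x. Q x - C (Q x) = x"
    using bounded_inverse_of_contracting_power[OF C contr] by metis
  interpret Q: bounded_linear Q by fact
  define G where "G v = Q (F v)" for v
  have G: "bounded_linear G"
    using bounded_linear_compose[OF Q(1) F] by (simp add: G_def[abs_def])
  interpret G: bounded_linear G by fact
  define T where "T v = - B (G v)" for v
  have T: "bounded_linear T"
    unfolding T_def by (intro bounded_linear_minus bounded_linear_compose[OF B G])
  have sol': "sol f u \<longleftrightarrow> u = G (f - B u)" for f u
  proof -
    have "sol f u \<longleftrightarrow> u - C u = F (f - B u)" unfolding sol by (auto simp: F.diff algebra_simps)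
    also have "\<dots> \<longleftrightarrow> u = G (f - B u)" unfolding G_def using Q(2,3) by metis
    finally show ?thesis .
  qed
  have "T (T v) = B (Q (F (B (F v)) + F (B (C (G v)))))" for v
  proof -
    \<comment> \<open>This is Q = I + C Q applied to F v: it removes the implicit inverse from F B Q
      F, so that F B meets only values of F and C.\<close>
    have "G v = F v + C (G v)" using Q(3)[of "F v"] by (simp add: G_def algebra_simps)
    then have "F (B (G v)) = F (B (F v)) + F (B (C (G v)))" by (metis B.add F.add)
    then have "G (B (G v)) = Q (F (B (F v)) + F (B (C (G v))))" by (simp add: G_def)
    then show ?thesis
      by (simp add: T_def linear_neg[OF B.linear_axioms] linear_neg[OF G.linear_axioms])
  qed
  moreover have "compact_map (\<lambda>v. B (Q (F (B (F v)) + F (B (C (G v))))))"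
    by (intro compact_map_comp_left[OF B] compact_map_comp_left[OF Q(1)] compact_map_add FBF
        compact_map_comp_right[OF G FBC])
  ultimately have "compact_map (\<lambda>v. T (T v))" by simp
  note Fredholm = Fredholm_alternative_compact_square[OF T this]
  define Z where "Z = {v. v - T v = 0}"
  have Z: "v \<in> Z \<longleftrightarrow> v = - B (G v)" for v by (simp add: Z_def T_def eq_neg_iff_add_eq_0)
  have K: "K = G ` Z"
  proof
    show "K \<subseteq> G ` Z"
    proof
      fix u assume "u \<in> K"
      then have "u = G (- B u)" by (simp add: K_def sol')
      then show "u \<in> G ` Z" by (intro image_eqI[of _ _ "- B u"]) (auto simp: Z)
    qed
    show "G ` Z \<subseteq> K" by (auto simp: K_def sol' Z)
  qed
  have Zsub: "subspace Z"
  proof -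
    have "linear (\<lambda>v. v - T v)"
      using T by (intro bounded_linear.linear bounded_linear_intros)
    from linear_subspace_kernel[OF this] show ?thesis by (simp add: Z_def)
  qed
  \<comment> \<open>On Z the vector v is recovered from G v as - B (G v).\<close>
  have "inj_on G (span Z)"
    using Zsub by (intro inj_onI) (metis Z span_eq_iff)
  then have dimK: "dim K = dim Z" unfolding K by (rule dim_linear_image_inj[OF G.linear_axioms])
  show finK: "finite_dimensional K"
  proof -
    obtain E where E: "finite E" "span E = Z"
      using Fredholm(1) unfolding finite_dimensional_def Z_def by blast
    have "span (G ` E) = K" using linear_span_image[OF G.linear_axioms, of E] E(2) K by simp
    then show ?thesis unfolding finite_dimensional_def using E(1) by blast
  qed
  have S: "S = range (\<lambda>v. v - T v)"
  proof
    show "S \<subseteq> range (\<lambda>v. v - T v)"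
    proof
      fix f assume "f \<in> S"
      then obtain u where "u = G (f - B u)" by (auto simp: S_def sol')
      then show "f \<in> range (\<lambda>v. v - T v)"
        by (intro image_eqI[of _ _ "f - B u"]) (auto simp: T_def)
    qed
    show "range (\<lambda>v. v - T v) \<subseteq> S"
    proof clarify
      fix v show "v - T v \<in> S" unfolding S_def mem_Collect_eq sol'
        by (intro exI[of _ "G v"]) (simp add: T_def)
    qed
  qed
  show "subspace S"
    unfolding S using T
    by (intro linear_subspace_image subspace_UNIV bounded_linear.linear bounded_linear_intros)
  show "closed S" unfolding S by (rule Fredholm(2))
  show codim: "has_codimension S (dim K)" unfolding S dimK Z_def by (rule Fredholm(3))
  show "\<exists>!u. sol f u" if dim0: "dim K = 0"
  proof -
    have K0: "K = {0}" using finite_dimensional_dim_0[OF finK dim0] .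
    obtain V where V: "finite_dimensional V" "dim V = 0" "{s + t |s t. s \<in> S \<and> t \<in> V} = UNIV"
      using codim dim0 unfolding has_codimension_def by auto
    have "f \<in> S" using V(3) finite_dimensional_dim_0[OF V(1,2)] by auto
    then obtain u where u: "sol f u" by (auto simp: S_def)
    have "u' = u" if "sol f u'" for u'
    proof -
      have "u' - u = G (f - B u') - G (f - B u)" using u that by (metis sol')
      also have "\<dots> = G (0 - B (u' - u))" by (simp add: G.diff B.diff algebra_simps)
      finally have "u' - u \<in> K" unfolding K_def mem_Collect_eq sol' .
      then show ?thesis using K0 by simp
    qed
    then show ?thesis using u by blast
  qed
qed

section \<open>Characteristic curves\<close>

text \<open>The position of z relative to x is recorded for limits in which y tends to x; at the
  ends of [0,1] only one-sided derivatives exist.\<close>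

lemma within_deriv_mvt:
  fixes g :: "real \<Rightarrow> real"
  assumes g: "\<And>x. x \<in> {0..1} \<Longrightarrow> (g has_real_derivative g' x) (at x within {0..1})"
    and x: "x \<in> {0..1}" "y \<in> {0..1}"
  obtains z where "z \<in> {0..1}" "\<bar>z - x\<bar> \<le> \<bar>y - x\<bar>" "g y - g x = g' z * (y - x)"
proof -
  have *: "\<exists>z\<in>{x..y}. g y - g x = g' z * (y - x)" if "x \<le> y" "{x..y} \<subseteq> {0..1}" for x y
  proof (rule mvt_very_simple[OF that(1)])
    show "(g has_derivative (*) (g' z)) (at z within {x..y})" if "x \<le> z" "z \<le> y" for z
      using g[of z] that \<open>{x..y} \<subseteq> {0..1}\<close> unfolding has_field_derivative_def
      by (auto intro: has_derivative_subset)
  qed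
  show thesis
  proof (cases "x \<le> y")
    case True
    then obtain z where "z \<in> {x..y}" "g y - g x = g' z * (y - x)" using *[of x y] x by auto
    then show thesis using that[of z] x by auto
  next
    case False
    then obtain z where "z \<in> {y..x}" "g x - g y = g' z * (x - y)" using *[of y x] x by auto
    then show thesis using that[of z] x by (auto simp: algebra_simps)
  qed
qed

lemma within_deriv_Lipschitz:
  fixes g :: "real \<Rightarrow> real"
  assumes "\<And>x. x \<in> {0..1} \<Longrightarrow> (g has_real_derivative g' x) (at x within {0..1})"
    and "\<And>x. x \<in> {0..1} \<Longrightarrow> \<bar>g' x\<bar> \<le> B" and "x \<in> {0..1}" "y \<in> {0..1}"
  shows "\<bar>g y - g x\<bar> \<le> B * \<bar>y - x\<bar>"
proof -
  obtain z where z: "z \<in> {0..1}" "g y - g x = g' z * (y - x)"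
    using within_deriv_mvt[OF assms(1,3,4)] by metis
  then show ?thesis using assms(2)[OF z(1)] by (simp add: abs_mult mult_right_mono)
qed

section \<open>Integrals from 0 over the unit interval\<close>

definition primitive :: "(real \<Rightarrow> real) \<Rightarrow> real \<Rightarrow> real" where
  "primitive g x = integral {0..x} g"

lemma primitive_0 [simp]: "primitive g 0 = 0"
  by (simp add: primitive_def)

lemma primitive_cong:
  "x \<in> {0..1} \<Longrightarrow> (\<And>y. y \<in> {0..1} \<Longrightarrow> g y = h y) \<Longrightarrow> primitive g x = primitive h x"
  unfolding primitive_def by (rule integral_cong) auto

lemma primitive_deriv:
  assumes "continuous_on {0..1} g" "x \<in> {0..1}"
  shows "(primitive g has_real_derivative g x) (at x within {0..1})"
  using integral_has_real_derivative[OF assms] by (simp add: primitive_def[abs_def])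

lemma primitive_Lipschitz:
  assumes "continuous_on {0..1} g" "\<And>x. x \<in> {0..1} \<Longrightarrow> \<bar>g x\<bar> \<le> B" "x \<in> {0..1}" "y \<in> {0..1}"
  shows "\<bar>primitive g y - primitive g x\<bar> \<le> B * \<bar>y - x\<bar>"
  using within_deriv_Lipschitz[OF primitive_deriv[OF assms(1)] assms(2-4)] .

lemma primitive_bound:
  assumes "continuous_on {0..1} g" "\<And>x. x \<in> {0..1} \<Longrightarrow> \<bar>g x\<bar> \<le> B" "x \<in> {0..1}" "y \<in> {0..1}"
  shows "\<bar>primitive g y - primitive g x\<bar> \<le> B"
proof -
  have "B \<ge> 0" using assms(2)[of 0] by auto
  then have "B * \<bar>y - x\<bar> \<le> B * 1" using assms(3,4) by (intro mult_left_mono) auto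
  then show ?thesis using primitive_Lipschitz[OF assms] by simp
qed

lemma primitive_diff:
  assumes "continuous_on {0..1} g" "continuous_on {0..1} h" "x \<in> {0..1}"
  shows "primitive (\<lambda>y. g y - h y) x = primitive g x - primitive h x"
proof -
  have "g integrable_on {0..x}" "h integrable_on {0..x}"
    using assms by (auto intro!: integrable_continuous_interval intro: continuous_on_subset)
  then show ?thesis unfolding primitive_def by (rule integral_diff)
qed

lemma primitive_add:
  assumes "continuous_on {0..1} g" "continuous_on {0..1} h" "x \<in> {0..1}"
  shows "primitive (\<lambda>y. g y + h y) x = primitive g x + primitive h x"
  using primitive_diff[of "\<lambda>y. g y + h y" h x] assms by (simp add: continuous_on_add)

lemma primitive_cmult: "primitive (\<lambda>y. r * g y) x = r * primitive g x"
  by (simp add: primitive_def)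

lemma primitive_sum:
  assumes "finite K" "\<And>k. k \<in> K \<Longrightarrow> continuous_on {0..1} (g k)" "x \<in> {0..1}"
  shows "primitive (\<lambda>y. \<Sum>k\<in>K. g k y) x = (\<Sum>k\<in>K. primitive (g k) x)"
  using assms(1,2)
proof (induction K rule: finite_induct)
  case (insert k K)
  then show ?case using assms(3) by (simp add: primitive_add continuous_on_sum)
qed (simp add: primitive_def)

lemma LBINT_eq_primitive:
  assumes g: "continuous_on {0..1} g" and ab: "a \<in> {0..1}" "b \<in> {0..1}"
  shows "(LBINT x=a..b. g x) = primitive g b - primitive g a"
proof (rule interval_integral_FTC_finite)
  have sub: "{min a b..max a b} \<subseteq> {0..1}" using ab by auto
  show "continuous_on {min a b..max a b} g" using g sub continuous_on_subset by blast
  show "(primitive g has_vector_derivative g x) (at x within {min a b..max a b})"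
    if "min a b \<le> x" "x \<le> max a b" for x
  proof -
    have "x \<in> {0..1}" using that ab by auto
    then show ?thesis
      using primitive_deriv[OF g]
      by (intro has_vector_derivative_within_subset[OF _ sub])
        (simp add: has_real_derivative_iff_has_vector_derivative)
  qed
qed

lemma continuous_on_strip_slice:
  assumes "continuous_on ({0..1} \<times> UNIV) (\<lambda>(x, s). g x s)"
    and "continuous_on {0..1} h"
  shows "continuous_on {0..1} (\<lambda>x. g x (h x))"
  by (rule continuous_on_compose2[OF assms(1), of "{0..1}" "\<lambda>x. (x, h x)", simplified])
    (auto intro!: continuous_intros assms(2))

lemma continuous_on_strip_compose:
  assumes "continuous_on ({0..1} \<times> UNIV) (\<lambda>(x, s). g x s)"
    and "continuous_on S h" "continuous_on S k" "k ` S \<subseteq> {0..1}"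
  shows "continuous_on S (\<lambda>p. g (k p) (h p))"
  using assms(4)
  by (intro continuous_on_compose2[OF assms(1), of S "\<lambda>p. (k p, h p)", simplified])
    (auto intro!: continuous_intros assms(2,3))

text \<open>The substitution y = \<theta> x moves the variable limit into the integrand. The
  integral then runs over the fixed interval [0,1] and depends continuously on its
  parameters.\<close>

lemma continuous_on_primitive:
  fixes g :: "real \<Rightarrow> real \<Rightarrow> real"
  assumes g: "continuous_on ({0..1} \<times> UNIV) (\<lambda>(x, s). g x s)"
  shows "continuous_on ({0..1} \<times> UNIV) (\<lambda>(x, s). primitive (\<lambda>y. g y s) x)"
proof -
  have gs: "continuous_on {0..1} (\<lambda>y. g y s)" for s
    using continuous_on_strip_slice[OF g, of "\<lambda>_. s"] by simp
  have eq: "primitive (\<lambda>y. g y s) x = integral {0..1} (\<lambda>\<theta>. x * g (\<theta> * x) s)" if x: "x \<in> {0..1}" for x s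
  proof -
    have "((\<lambda>\<theta>. primitive (\<lambda>y. g y s) (\<theta> * x)) has_vector_derivative (x * g (\<theta> * x) s))
        (at \<theta> within {0..1})" if "\<theta> \<in> {0..1}" for \<theta>
    proof -
      have "\<theta> * x \<in> {0..1}" "(\<lambda>\<theta>. \<theta> * x) ` {0..1} \<subseteq> {0..1}" using that x by (auto simp: mult_le_one)
      then have "((primitive (\<lambda>y. g y s)) \<circ> (\<lambda>\<theta>. \<theta> * x) has_real_derivative g (\<theta> * x) s * x)
          (at \<theta> within {0..1})"
        by (intro DERIV_image_chain has_field_derivative_subset[OF primitive_deriv[OF gs]])
          (auto intro!: derivative_eq_intros)
      then show ?thesis
        by (simp add: has_real_derivative_iff_has_vector_derivative o_def mult.commute)
    qed
    from fundamental_theorem_of_calculus[OF _ this] show ?thesis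
      by (auto dest: integral_unique)
  qed
  have "continuous_on (({0..1} \<times> UNIV) \<times> cbox 0 1)
      (\<lambda>(p, \<theta>). fst p * g (\<theta> * fst p) (snd p :: real))"
    unfolding case_prod_unfold
    by (intro continuous_intros continuous_on_strip_compose[OF g]) (auto simp: mult_le_one)
  then have "continuous_on ({0..1} \<times> UNIV)
      (\<lambda>p. integral (cbox 0 1) (\<lambda>\<theta>. fst p * g (\<theta> * fst p) (snd p :: real)))"
    by (intro integral_continuous_on_param) (simp add: case_prod_unfold)
  then show ?thesis
    by (subst continuous_on_cong[OF refl, where g =
      "\<lambda>p. integral (cbox 0 1) (\<lambda>\<theta>. fst p * g (\<theta> * fst p) (snd p :: real))"]) (auto simp: eq)
qed

section \<open>Flow of a scalar equation with periodic right-hand side\<close>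

locale periodic_field =
  fixes f ft :: "real \<Rightarrow> real \<Rightarrow> real" and L :: real
  assumes cont_f: "continuous_on ({0..1} \<times> UNIV) (\<lambda>(x, t). f x t)"
    and cont_ft: "continuous_on ({0..1} \<times> UNIV) (\<lambda>(x, t). ft x t)"
    and deriv_f: "x \<in> {0..1} \<Longrightarrow> (f x has_real_derivative ft x t) (at t)"
    and bound_f: "x \<in> {0..1} \<Longrightarrow> \<bar>f x t\<bar> \<le> L"
    and bound_ft: "x \<in> {0..1} \<Longrightarrow> \<bar>ft x t\<bar> \<le> L"
    and per_f: "x \<in> {0..1} \<Longrightarrow> f x (t + 2 * pi) = f x t"
    and L_pos: "L > 0"
begin

lemma Lipschitz_f:
  assumes "x \<in> {0..1}"
  shows "\<bar>f x s - f x t\<bar> \<le> L * \<bar>s - t\<bar>"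
  using field_differentiable_bound[of UNIV "f x" "ft x" L s t] deriv_f[OF assms] bound_ft[OF assms]
  by simp

definition solution :: "(real \<Rightarrow> real) \<Rightarrow> bool" where
  "solution w \<longleftrightarrow> (\<forall>\<eta>\<in>{0..1}. (w has_real_derivative f \<eta> (w \<eta>)) (at \<eta> within {0..1}))"

lemma solution_deriv: "solution w \<Longrightarrow> \<eta> \<in> {0..1} \<Longrightarrow> (w has_real_derivative f \<eta> (w \<eta>)) (at \<eta> within {0..1})"
  by (simp add: solution_def)

lemma solution_Lipschitz:
  assumes "solution w" "x \<in> {0..1}" "y \<in> {0..1}"
  shows "\<bar>w y - w x\<bar> \<le> L * \<bar>y - x\<bar>"
  using within_deriv_Lipschitz[OF solution_deriv[OF assms(1)] bound_f assms(2,3)] .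

text \<open>Gronwall's argument for the square of the difference, which is differentiable where the
  absolute value need not be: times exp (-2 L z) it is nonincreasing, times exp (2 L z)
  nondecreasing. Both versions are required, as y may lie on either side of x.\<close>

lemma solution_compare:
  assumes w: "solution w" "solution v" and x: "x \<in> {0..1}" and y: "y \<in> {0..1}"
  shows "\<bar>w y - v y\<bar> \<le> exp L * \<bar>w x - v x\<bar>"
proof -
  define D where "D z = (w z - v z)\<^sup>2" for z
  define D' where "D' z = 2 * (w z - v z) * (f z (w z) - f z (v z))" for z
  have D': "\<bar>D' z\<bar> \<le> 2 * L * D z" if "z \<in> {0..1}" for z
  proof -
    have "\<bar>D' z\<bar> \<le> 2 * \<bar>w z - v z\<bar> * (L * \<bar>w z - v z\<bar>)"
      unfolding D'_def abs_mult using Lipschitz_f[OF that] by (intro mult_mono) auto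
    also have "\<dots> = 2 * L * (\<bar>w z - v z\<bar> * \<bar>w z - v z\<bar>)" by simp
    finally show ?thesis by (simp only: D_def power2_eq_square abs_mult_self_eq)
  qed
  have deriv: "((\<lambda>z. D z * exp (c * z)) has_real_derivative (D' z + c * D z) * exp (c * z))
      (at z within {0..1})" if "z \<in> {0..1}" for z c
    unfolding D_def D'_def
    by (auto intro!: derivative_eq_intros solution_deriv[OF w(1) that] solution_deriv[OF w(2) that]
        simp: algebra_simps)
  have mono: "D y * exp (- (2 * L) * y) \<le> D x * exp (- (2 * L) * x)" if "x \<le> y"
  proof -
    obtain z where z: "z \<in> {0..1}" "D y * exp (- (2 * L) * y) - D x * exp (- (2 * L) * x) =
        (D' z + - (2 * L) * D z) * exp (- (2 * L) * z) * (y - x)"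
      using within_deriv_mvt[OF deriv x y] by metis
    have "(D' z + - (2 * L) * D z) * exp (- (2 * L) * z) * (y - x) \<le> 0"
      using D'[OF z(1)] that by (intro mult_nonpos_nonneg) auto
    then show ?thesis using z(2) by simp
  qed
  have mono': "D y * exp (2 * L * y) \<le> D x * exp (2 * L * x)" if "y \<le> x"
  proof -
    obtain z where z: "z \<in> {0..1}" "D y * exp (2 * L * y) - D x * exp (2 * L * x) =
        (D' z + 2 * L * D z) * exp (2 * L * z) * (y - x)"
      using within_deriv_mvt[OF deriv x y] by metis
    have "(D' z + 2 * L * D z) * exp (2 * L * z) * (y - x) \<le> 0"
      using D'[OF z(1)] that by (intro mult_nonneg_nonpos) auto
    then show ?thesis using z(2) by simp
  qed
  have "D y \<le> D x * exp (2 * L * \<bar>y - x\<bar>)"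
  proof (cases "x \<le> y")
    case True
    have "D y = D y * exp (- (2 * L) * y) * exp (2 * L * y)" by (simp add: exp_minus)
    also have "\<dots> \<le> D x * exp (- (2 * L) * x) * exp (2 * L * y)"
      using mono[OF True] by (rule mult_right_mono) simp
    also have "\<dots> = D x * exp (2 * L * \<bar>y - x\<bar>)"
      using True by (simp add: mult.assoc exp_add[symmetric] algebra_simps)
    finally show ?thesis .
  next
    case False
    have "D y = D y * exp (2 * L * y) * exp (- (2 * L) * y)" by (simp add: exp_minus)
    also have "\<dots> \<le> D x * exp (2 * L * x) * exp (- (2 * L) * y)"
      using mono' False by (intro mult_right_mono) auto
    also have "\<dots> = D x * exp (2 * L * \<bar>y - x\<bar>)"
      using False by (simp add: mult.assoc exp_add[symmetric] algebra_simps)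
    finally show ?thesis .
  qed
  also have "\<dots> \<le> D x * exp (2 * L)"
    using x y L_pos by (intro mult_left_mono) (auto simp: D_def)
  also have "\<dots> = (exp L * \<bar>w x - v x\<bar>)\<^sup>2"
    by (simp add: D_def power_mult_distrib exp_double)
  finally have "(w y - v y)\<^sup>2 \<le> (exp L * \<bar>w x - v x\<bar>)\<^sup>2" by (simp add: D_def)
  then show ?thesis using abs_le_square_iff[of "w y - v y" "exp L * \<bar>w x - v x\<bar>"] by simp
qed

text \<open>Picard iteration for $e^{-2L\xi}(w(\xi) - \sigma)$, for which it is a contraction in the sup norm.\<close>

lemma solution_exists: "\<exists>w. solution w \<and> w 0 = \<sigma>"
proof -
  \<comment> \<open>Bounded continuous functions live on the whole line; clamping the argument to
    [0,1] extends the iterates by constants.\<close>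
  define cl where "cl \<xi> = max 0 (min 1 \<xi>)" for \<xi> :: real
  have cl: "cl \<xi> \<in> {0..1}" "\<xi> \<in> {0..1} \<Longrightarrow> cl \<xi> = \<xi>" for \<xi> by (auto simp: cl_def)
  define g where "g z \<eta> = f \<eta> (\<sigma> + exp (2 * L * \<eta>) * apply_bcontfun z \<eta>)" for z \<eta>
  define P where "P z \<xi> = exp (- (2 * L * cl \<xi>)) * primitive (g z) (cl \<xi>)" for z \<xi>
  have cont_g: "continuous_on {0..1} (g z)" for z
    unfolding g_def by (intro continuous_on_strip_slice[OF cont_f] continuous_intros
        continuous_on_apply_bcontfun)
  have cont_prim: "continuous_on {0..1} (primitive (g z))" for z
    using primitive_deriv[OF cont_g] DERIV_continuous_on by blast
  have P: "P z \<in> bcontfun" for z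
  proof (rule bcontfun_normI)
    have "continuous_on UNIV (\<lambda>\<xi>. primitive (g z) (cl \<xi>))"
      by (rule continuous_on_compose2[OF cont_prim]) (auto simp: cl_def intro!: continuous_intros)
    then show "continuous_on UNIV (P z)"
      unfolding P_def cl_def by (intro continuous_intros) 
    fix \<xi>
    have "\<bar>primitive (g z) (cl \<xi>)\<bar> \<le> L"
      using primitive_bound[OF cont_g, of z L 0 "cl \<xi>"] bound_f cl(1)[of \<xi>] by (simp add: g_def)
    moreover have "exp (- (2 * L * cl \<xi>)) \<le> 1" using cl(1)[of \<xi>] L_pos by simp
    ultimately have "\<bar>P z \<xi>\<bar> \<le> 1 * L"
      unfolding P_def abs_mult by (intro mult_mono) auto
    then show "norm (P z \<xi>) \<le> L" by simp
  qed
  define \<Phi> where "\<Phi> z = Bcontfun (P z)" for z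
  have \<Phi>: "apply_bcontfun (\<Phi> z) = P z" for z unfolding \<Phi>_def using P by (rule Bcontfun_inverse)
  have "dist (\<Phi> z) (\<Phi> v) \<le> 1/2 * dist z v" for z v
  proof (rule dist_bound)
    fix \<xi>
    define x where "x = cl \<xi>"
    have x: "x \<in> {0..1}" using cl by (simp add: x_def)
    have sub: "continuous_on {0..x} h" if "continuous_on {0..1} h" for h :: "real \<Rightarrow> real"
      using that x by (auto intro: continuous_on_subset)
    \<comment> \<open>The weight pays off here: integrating L exp (2 L \<eta>) gives less than exp
      (2 L x) / 2, and the outer factor exp (-2 L x) leaves the contraction constant 1/2.\<close>
    have hi: "((\<lambda>\<eta>. L * exp (2 * L * \<eta>) * dist z v) has_integral
        (exp (2 * L * x) / 2 * dist z v - exp (2 * L * 0) / 2 * dist z v)) {0..x}"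
      using x by (intro fundamental_theorem_of_calculus)
        (auto simp: has_real_derivative_iff_has_vector_derivative[symmetric]
          intro!: derivative_eq_intros)
    have "norm (integral {0..x} (\<lambda>\<eta>. g z \<eta> - g v \<eta>)) \<le> integral {0..x} (\<lambda>\<eta>. L * exp (2 * L * \<eta>) * dist z v)"
    proof (rule integral_norm_bound_integral)
      show "(\<lambda>\<eta>. g z \<eta> - g v \<eta>) integrable_on {0..x}"
        by (intro integrable_continuous_interval sub continuous_intros cont_g)
      show "(\<lambda>\<eta>. L * exp (2 * L * \<eta>) * dist z v) integrable_on {0..x}" using hi by blast
      fix \<eta> assume "\<eta> \<in> {0..x}"
      then have "\<eta> \<in> {0..1}" using x by auto
      then have "\<bar>g z \<eta> - g v \<eta>\<bar> \<le> L * (exp (2 * L * \<eta>) * \<bar>apply_bcontfun z \<eta> - apply_bcontfun v \<eta>\<bar>)"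
        using Lipschitz_f[of \<eta> "\<sigma> + exp (2 * L * \<eta>) * apply_bcontfun z \<eta>"
            "\<sigma> + exp (2 * L * \<eta>) * apply_bcontfun v \<eta>"]
        by (simp add: g_def right_diff_distrib[symmetric] abs_mult)
      also have "\<dots> \<le> L * (exp (2 * L * \<eta>) * dist z v)"
        using L_pos dist_bounded[of z \<eta> v] by (intro mult_left_mono) (auto simp: dist_real_def)
      finally show "norm (g z \<eta> - g v \<eta>) \<le> L * exp (2 * L * \<eta>) * dist z v" by simp
    qed
    also have "\<dots> \<le> exp (2 * L * x) / 2 * dist z v"
      using integral_unique[OF hi] by simp
    finally have *: "\<bar>primitive (g z) x - primitive (g v) x\<bar> \<le> exp (2 * L * x) / 2 * dist z v"
      using primitive_diff[OF cont_g cont_g x, of z v] by (simp add: primitive_def)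
    have "dist (P z \<xi>) (P v \<xi>) = exp (- (2 * L * x)) * \<bar>primitive (g z) x - primitive (g v) x\<bar>"
      by (simp add: P_def x_def dist_real_def right_diff_distrib[symmetric] abs_mult)
    also have "\<dots> \<le> exp (- (2 * L * x)) * (exp (2 * L * x) / 2 * dist z v)"
      using * by (intro mult_left_mono) auto
    also have "\<dots> = 1/2 * dist z v" by (simp add: exp_minus field_simps)
    finally show "dist (apply_bcontfun (\<Phi> z) \<xi>) (apply_bcontfun (\<Phi> v) \<xi>) \<le> 1/2 * dist z v"
      by (simp only: \<Phi>)
  qed
  then have "\<exists>!z\<in>UNIV. \<Phi> z = z"
    by (intro Banach_fix[of UNIV "1/2"]) (auto simp: complete_UNIV)
  then obtain z where "\<Phi> z = z" by auto
  then have z: "apply_bcontfun z \<xi> = exp (- (2 * L * \<xi>)) * primitive (g z) \<xi>" if "\<xi> \<in> {0..1}" for \<xi>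
    using \<Phi>[of z] that by (simp add: P_def cl)
  define w where "w \<xi> = \<sigma> + primitive (g z) \<xi>" for \<xi>
  have gw: "g z \<xi> = f \<xi> (w \<xi>)" if "\<xi> \<in> {0..1}" for \<xi>
  proof -
    have "exp (2 * L * \<xi>) * apply_bcontfun z \<xi> = primitive (g z) \<xi>"
      using z[OF that] by (simp add: exp_minus field_simps)
    then show ?thesis by (simp add: g_def w_def)
  qed
  have "solution w"
    unfolding solution_def
  proof
    fix \<xi> :: real assume \<xi>: "\<xi> \<in> {0..1}"
    have "(w has_real_derivative g z \<xi>) (at \<xi> within {0..1})"
      using DERIV_add[OF DERIV_const[of \<sigma>] primitive_deriv[OF cont_g \<xi>]]
      by (simp add: w_def[abs_def])
    then show "(w has_real_derivative f \<xi> (w \<xi>)) (at \<xi> within {0..1})" by (simp only: gw[OF \<xi>])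
  qed
  moreover have "w 0 = \<sigma>" by (simp add: w_def)
  ultimately show ?thesis by blast
qed

text \<open>The flow started at x = 0: \<sigma> labels the characteristic, \<xi> is the position on
  it. Together with its inverse \<open>phi\<close> in the second argument it straightens the
  characteristics.\<close>

definition psi :: "real \<Rightarrow> real \<Rightarrow> real" where
  "psi \<xi> \<sigma> = (SOME w. solution w \<and> w 0 = \<sigma>) \<xi>"

lemma psi_solution: "solution (\<lambda>\<xi>. psi \<xi> \<sigma>)" and psi_0: "psi 0 \<sigma> = \<sigma>"
proof -
  have "solution (SOME w. solution w \<and> w 0 = \<sigma>) \<and> (SOME w. solution w \<and> w 0 = \<sigma>) 0 = \<sigma>"
    using someI_ex[OF solution_exists[of \<sigma>]] .
  note w = this
  show "solution (\<lambda>\<xi>. psi \<xi> \<sigma>)" unfolding psi_def by (rule conjunct1[OF w])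
  show "psi 0 \<sigma> = \<sigma>" unfolding psi_def by (rule conjunct2[OF w])
qed

lemma psi_deriv:
  "\<xi> \<in> {0..1} \<Longrightarrow> ((\<lambda>\<xi>. psi \<xi> \<sigma>) has_real_derivative f \<xi> (psi \<xi> \<sigma>)) (at \<xi> within {0..1})"
  using solution_deriv[OF psi_solution] .

lemma solution_eq_psi:
  assumes "solution w" "\<xi> \<in> {0..1}"
  shows "w \<xi> = psi \<xi> (w 0)"
  using solution_compare[OF assms(1) psi_solution[of "w 0"], of 0 \<xi>] assms(2) by (simp add: psi_0)

lemma psi_Lipschitz1:
  assumes "x \<in> {0..1}" "y \<in> {0..1}"
  shows "\<bar>psi y \<sigma> - psi x \<sigma>\<bar> \<le> L * \<bar>y - x\<bar>"
  using solution_Lipschitz[OF psi_solution assms] .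

lemma psi_Lipschitz2: "x \<in> {0..1} \<Longrightarrow> \<bar>psi x \<sigma> - psi x \<tau>\<bar> \<le> exp L * \<bar>\<sigma> - \<tau>\<bar>"
  using solution_compare[OF psi_solution psi_solution, of 0 x \<sigma> \<tau>] by (simp add: psi_0)

lemma psi_expanding: "x \<in> {0..1} \<Longrightarrow> \<bar>\<sigma> - \<tau>\<bar> \<le> exp L * \<bar>psi x \<sigma> - psi x \<tau>\<bar>"
  using solution_compare[OF psi_solution psi_solution, of x 0 \<sigma> \<tau>] by (simp add: psi_0)

lemma psi_inj: "x \<in> {0..1} \<Longrightarrow> psi x \<sigma> = psi x \<tau> \<longleftrightarrow> \<sigma> = \<tau>"
  using psi_expanding[of x \<sigma> \<tau>] by auto

lemma psi_near: "x \<in> {0..1} \<Longrightarrow> \<bar>psi x \<sigma> - \<sigma>\<bar> \<le> L"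
proof -
  assume x: "x \<in> {0..1}"
  then have "L * \<bar>x - 0\<bar> \<le> L * 1" using L_pos by (intro mult_left_mono) auto
  then show ?thesis using psi_Lipschitz1[of 0 x \<sigma>] x by (simp add: psi_0)
qed

lemma continuous_on_psi2: "x \<in> {0..1} \<Longrightarrow> continuous_on S (psi x)"
  by (rule lipschitz_onI[THEN lipschitz_on_continuous_on, of _ _ "exp L"])
    (auto simp: dist_real_def psi_Lipschitz2)

text \<open>Intermediate value theorem, as \<open>psi x\<close> stays within L of the
  identity.\<close>

lemma psi_surj:
  assumes x: "x \<in> {0..1}"
  shows "\<exists>\<sigma>. psi x \<sigma> = t"
proof -
  have "psi x (t - L) \<le> t" "t \<le> psi x (t + L)" "t - L \<le> t + L"
    using psi_near[OF x, of "t - L"] psi_near[OF x, of "t + L"] L_pos by auto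
  then show ?thesis using IVT'[of "psi x" "t - L" t "t + L"] continuous_on_psi2[OF x] by blast
qed

definition phi :: "real \<Rightarrow> real \<Rightarrow> real" where
  "phi x t = (SOME \<sigma>. psi x \<sigma> = t)"

lemma psi_phi: "x \<in> {0..1} \<Longrightarrow> psi x (phi x t) = t"
  unfolding phi_def using someI_ex[OF psi_surj] .

lemma phi_psi: "x \<in> {0..1} \<Longrightarrow> phi x (psi x \<sigma>) = \<sigma>"
  using psi_inj psi_phi by blast

lemma phi_Lipschitz2: "x \<in> {0..1} \<Longrightarrow> \<bar>phi x s - phi x t\<bar> \<le> exp L * \<bar>s - t\<bar>"
  using psi_expanding[of x "phi x s" "phi x t"] by (simp add: psi_phi)

lemma phi_Lipschitz1:
  assumes "x \<in> {0..1}" "y \<in> {0..1}"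
  shows "\<bar>phi y t - phi x t\<bar> \<le> exp L * (L * \<bar>y - x\<bar>)"
proof -
  have "\<bar>phi y t - phi y (psi y (phi x t))\<bar> \<le> exp L * \<bar>psi x (phi x t) - psi y (phi x t)\<bar>"
    using phi_Lipschitz2[OF assms(2)] assms(1) by (metis psi_phi)
  also have "\<dots> \<le> exp L * (L * \<bar>y - x\<bar>)"
    using psi_Lipschitz1[OF assms(2,1)] by (intro mult_left_mono) (auto simp: abs_minus_commute)
  finally show ?thesis using assms by (simp add: phi_psi)
qed

lemma solution_eq_psi_phi:
  assumes "solution w" "x \<in> {0..1}" "\<xi> \<in> {0..1}"
  shows "w \<xi> = psi \<xi> (phi x (w x))"
  using solution_eq_psi[OF assms(1)] assms(2,3) by (metis phi_psi)

text \<open>The right-hand side is periodic, so a solution shifted by 2 pi is again a solution,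
  determined by its value at 0.\<close>

lemma psi_period:
  assumes "\<xi> \<in> {0..1}"
  shows "psi \<xi> (\<sigma> + 2 * pi) = psi \<xi> \<sigma> + 2 * pi"
proof -
  have "solution (\<lambda>\<xi>. psi \<xi> \<sigma> + 2 * pi)"
    unfolding solution_def using DERIV_add[OF psi_deriv DERIV_const[of "2 * pi"]]
    by (simp add: per_f)
  from solution_eq_psi[OF this assms] show ?thesis by (simp add: psi_0)
qed

lemma phi_period:
  assumes "x \<in> {0..1}"
  shows "phi x (t + 2 * pi) = phi x t + 2 * pi"
  using psi_period[OF assms, of "phi x t"] assms by (metis psi_phi phi_psi)

lemma continuous_on_Lipschitz_strip:
  fixes g :: "real \<Rightarrow> real \<Rightarrow> real"
  assumes "\<And>x y t. x \<in> {0..1} \<Longrightarrow> y \<in> {0..1} \<Longrightarrow> \<bar>g y t - g x t\<bar> \<le> A * \<bar>y - x\<bar>"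
    and "\<And>x s t. x \<in> {0..1} \<Longrightarrow> \<bar>g x s - g x t\<bar> \<le> B * \<bar>s - t\<bar>" and "A \<ge> 0" "B \<ge> 0"
  shows "continuous_on ({0..1} \<times> UNIV) (\<lambda>(x, t). g x t)"
proof (rule lipschitz_onI[THEN lipschitz_on_continuous_on, of _ _ "A + B"], clarsimp)
  fix x s y t :: real assume xy: "0 \<le> x" "x \<le> 1" "0 \<le> y" "y \<le> 1"
  have "\<bar>g x s - g y t\<bar> \<le> \<bar>g x s - g y s\<bar> + \<bar>g y s - g y t\<bar>" by simp
  also have "\<dots> \<le> A * dist x y + B * dist s t"
    using assms(1)[of y x s] assms(2)[of y s t] xy by (simp add: dist_real_def)
  also have "\<dots> \<le> A * dist (x, s) (y, t) + B * dist (x, s) (y, t)"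
    using assms(3,4) dist_fst_le[of "(x, s)" "(y, t)"] dist_snd_le[of "(x, s)" "(y, t)"]
    by (intro add_mono mult_left_mono) auto
  finally show "dist (g x s) (g y t) \<le> (A + B) * dist (x, s) (y, t)"
    by (simp add: dist_real_def distrib_right)
qed (use assms in auto)

lemma continuous_on_psi: "continuous_on ({0..1} \<times> UNIV) (\<lambda>(x, s). psi x s)"
  using L_pos psi_Lipschitz1 psi_Lipschitz2
  by (intro continuous_on_Lipschitz_strip[of psi L "exp L"]) auto

lemma continuous_on_phi: "continuous_on ({0..1} \<times> UNIV) (\<lambda>(x, t). phi x t)"
  using L_pos phi_Lipschitz1 phi_Lipschitz2
  by (intro continuous_on_Lipschitz_strip[of phi "exp L * L" "exp L"]) (auto simp: mult.assoc)

lemma continuous_on_along_psi: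
  assumes "continuous_on ({0..1} \<times> UNIV) (\<lambda>(x, t). g x t)"
  shows "continuous_on ({0..1} \<times> UNIV) (\<lambda>(x, s). g x (psi x s))"
  unfolding case_prod_unfold
  by (rule continuous_on_strip_compose[OF assms])
    (use continuous_on_psi in \<open>auto simp: case_prod_unfold intro!: continuous_on_fst continuous_on_id\<close>)

lemma continuous_on_along_phi:
  assumes "continuous_on ({0..1} \<times> UNIV) (\<lambda>(x, t). g x t)"
  shows "continuous_on ({0..1} \<times> UNIV) (\<lambda>(x, s). g x (phi x s))"
  unfolding case_prod_unfold
  by (rule continuous_on_strip_compose[OF assms])
    (use continuous_on_phi in \<open>auto simp: case_prod_unfold intro!: continuous_on_fst continuous_on_id\<close>)

text \<open>The solution of the variational equation along the characteristic \<sigma> with value 1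
  at \<xi> = 0; it will be the derivative of \<open>psi\<close> in \<sigma>.\<close>

definition psi' :: "real \<Rightarrow> real \<Rightarrow> real" where
  "psi' \<xi> \<sigma> = exp (primitive (\<lambda>\<eta>. ft \<eta> (psi \<eta> \<sigma>)) \<xi>)"

lemma continuous_on_psi': "continuous_on ({0..1} \<times> UNIV) (\<lambda>(x, s). psi' x s)"
  unfolding psi'_def
  using continuous_on_exp[OF continuous_on_primitive[OF continuous_on_along_psi[OF cont_ft]]]
  by (simp add: case_prod_unfold)

lemma continuous_on_ft_psi: "continuous_on {0..1} (\<lambda>\<eta>. ft \<eta> (psi \<eta> \<sigma>))"
  using continuous_on_strip_slice[OF continuous_on_along_psi[OF cont_ft], of "\<lambda>_. \<sigma>"] by simp

lemma psi'_deriv: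
  assumes "\<xi> \<in> {0..1}"
  shows "((\<lambda>\<xi>. psi' \<xi> \<sigma>) has_real_derivative ft \<xi> (psi \<xi> \<sigma>) * psi' \<xi> \<sigma>) (at \<xi> within {0..1})"
  unfolding psi'_def
  using DERIV_chain2[OF DERIV_exp primitive_deriv[OF continuous_on_ft_psi assms]] by (simp add: mult.commute)

lemma psi'_pos: "psi' \<xi> \<sigma> > 0"
  by (simp add: psi'_def)

lemma psi'_le: "\<xi> \<in> {0..1} \<Longrightarrow> psi' \<xi> \<sigma> \<le> exp L"
  using primitive_bound[OF continuous_on_ft_psi, of \<sigma> L 0 \<xi>] bound_ft by (simp add: psi'_def)

text \<open>The difference of two characteristics solves a linear equation whose coefficient is a
  difference quotient of f, so its ratio to h is an exact exponential. The limit h -> 0 can then be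
  taken in the exponent.\<close>

lemma psi_difference:
  assumes "h \<noteq> 0" "\<xi> \<in> {0..1}"
  shows "(psi \<xi> (\<sigma> + h) - psi \<xi> \<sigma>) / h = exp (primitive (\<lambda>\<eta>.
    (f \<eta> (psi \<eta> (\<sigma> + h)) - f \<eta> (psi \<eta> \<sigma>)) / (psi \<eta> (\<sigma> + h) - psi \<eta> \<sigma>)) \<xi>)"
proof -
  define \<delta> where "\<delta> \<eta> = psi \<eta> (\<sigma> + h) - psi \<eta> \<sigma>" for \<eta>
  define A where "A \<eta> = (f \<eta> (psi \<eta> (\<sigma> + h)) - f \<eta> (psi \<eta> \<sigma>)) / \<delta> \<eta>" for \<eta>
  have \<delta>0: "\<delta> \<eta> \<noteq> 0" if "\<eta> \<in> {0..1}" for \<eta> using that assms(1) by (simp add: \<delta>_def psi_inj)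
  have c: "continuous_on {0..1} (\<lambda>\<eta>. psi \<eta> s)" "continuous_on {0..1} (\<lambda>\<eta>. f \<eta> (psi \<eta> s))" for s
    using continuous_on_strip_slice[OF continuous_on_psi, of "\<lambda>_. s"]
      continuous_on_strip_slice[OF continuous_on_along_psi[OF cont_f], of "\<lambda>_. s"] by auto
  have A: "continuous_on {0..1} A"
    unfolding A_def \<delta>_def by (intro continuous_intros c) (use \<delta>0 in \<open>auto simp: \<delta>_def\<close>)
  define E where "E \<eta> = \<delta> \<eta> * exp (- primitive A \<eta>)" for \<eta>
  have "E \<xi> = E 0"
  proof (rule has_field_derivative_zero_constant[of "{0..1}" E, THEN exE])
    fix \<eta> :: real assume \<eta>: "\<eta> \<in> {0..1}"
    have "(\<delta> has_real_derivative A \<eta> * \<delta> \<eta>) (at \<eta> within {0..1})"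
      using DERIV_diff[OF psi_deriv[OF \<eta>] psi_deriv[OF \<eta>], of "\<sigma> + h" \<sigma>] \<delta>0[OF \<eta>]
      by (simp add: \<delta>_def[abs_def] A_def)
    from DERIV_mult[OF this DERIV_chain2[OF DERIV_exp DERIV_minus[OF primitive_deriv[OF A \<eta>]]]]
    show "(E has_real_derivative 0) (at \<eta> within {0..1})"
      unfolding E_def by (rule DERIV_cong) (simp add: algebra_simps)
  next
    fix c assume "\<forall>x\<in>{0..1}. E x = c"
    then show "E \<xi> = E 0" using assms(2) by simp
  qed simp
  also have "E 0 = h" by (simp add: E_def \<delta>_def psi_0)
  finally have "\<delta> \<xi> / h = exp (primitive A \<xi>)"
    using assms(1) by (simp add: E_def exp_minus field_simps)
  then show ?thesis by (simp add: \<delta>_def A_def[abs_def])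
qed

lemma psi_has_deriv2:
  assumes \<xi>: "\<xi> \<in> {0..1}"
  shows "(psi \<xi> has_real_derivative psi' \<xi> \<sigma>) (at \<sigma>)"
  unfolding DERIV_def tendsto_at_iff_sequentially
proof (intro allI impI)
  fix h :: "nat \<Rightarrow> real" assume h: "\<forall>i. h i \<in> UNIV - {0}" "h \<longlonglongrightarrow> 0"
  define A where "A i \<eta> =
    (f \<eta> (psi \<eta> (\<sigma> + h i)) - f \<eta> (psi \<eta> \<sigma>)) / (psi \<eta> (\<sigma> + h i) - psi \<eta> \<sigma>)" for i \<eta>
  have c: "continuous_on {0..1} (\<lambda>\<eta>. psi \<eta> s)" "continuous_on {0..1} (\<lambda>\<eta>. f \<eta> (psi \<eta> s))" for s
    using continuous_on_strip_slice[OF continuous_on_psi, of "\<lambda>_. s"]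
      continuous_on_strip_slice[OF continuous_on_along_psi[OF cont_f], of "\<lambda>_. s"] by auto
  have ne: "psi \<eta> (\<sigma> + h i) \<noteq> psi \<eta> \<sigma>" if "\<eta> \<in> {0..1}" for i \<eta>
    using that h(1) by (simp add: psi_inj)
  have A: "continuous_on {0..1} (A i)" for i
    unfolding A_def by (intro continuous_intros c) (auto simp: ne)
  \<comment> \<open>Dominated convergence with the Lipschitz constant L as majorant. Distinct
    characteristics never meet, so the quotients are taken at points different from the limit point
    and converge to \<open>ft\<close>.\<close>
  have "(\<lambda>i. integral {0..\<xi>} (A i)) \<longlonglongrightarrow> integral {0..\<xi>} (\<lambda>\<eta>. ft \<eta> (psi \<eta> \<sigma>))"
  proof (rule dominated_convergence(2))
    show "A i integrable_on {0..\<xi>}" for i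
      using \<xi> by (intro integrable_continuous_interval continuous_on_subset[OF A]) auto
    show "(\<lambda>_. L) integrable_on {0..\<xi>}" by (rule integrable_const_ivl)
    show "norm (A i \<eta>) \<le> L" if "\<eta> \<in> {0..\<xi>}" for i \<eta>
    proof -
      have "\<eta> \<in> {0..1}" using that \<xi> by auto
      then show ?thesis
        using Lipschitz_f[of \<eta> "psi \<eta> (\<sigma> + h i)" "psi \<eta> \<sigma>"] ne[of \<eta> i]
        by (simp add: A_def field_simps)
    qed
    show "(\<lambda>i. A i \<eta>) \<longlonglongrightarrow> ft \<eta> (psi \<eta> \<sigma>)" if "\<eta> \<in> {0..\<xi>}" for \<eta>
    proof -
      have \<eta>: "\<eta> \<in> {0..1}" using that \<xi> by auto
      have "((\<lambda>y. (f \<eta> y - f \<eta> (psi \<eta> \<sigma>)) / (y - psi \<eta> \<sigma>)) \<longlongrightarrow> ft \<eta> (psi \<eta> \<sigma>)) (at (psi \<eta> \<sigma>))"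
        using deriv_f[OF \<eta>, of "psi \<eta> \<sigma>"] by (simp add: has_field_derivative_iff)
      moreover have "(\<lambda>i. psi \<eta> (\<sigma> + h i)) \<longlonglongrightarrow> psi \<eta> \<sigma>"
      proof -
        have "(\<lambda>i. \<sigma> + h i) \<longlonglongrightarrow> \<sigma> + 0" by (intro tendsto_intros h)
        then show ?thesis
          using continuous_on_tendsto_compose[OF continuous_on_psi2[OF \<eta>, of UNIV]] by simp
      qed
      ultimately show ?thesis
        unfolding A_def using ne[OF \<eta>] by (auto simp: tendsto_at_iff_sequentially o_def)
    qed
  qed
  then have "(\<lambda>i. exp (primitive (A i) \<xi>)) \<longlonglongrightarrow> psi' \<xi> \<sigma>"
    unfolding psi'_def primitive_def by (rule tendsto_exp)
  then show "((\<lambda>h. (psi \<xi> (\<sigma> + h) - psi \<xi> \<sigma>) / h) \<circ> h) \<longlonglongrightarrow> psi' \<xi> \<sigma>"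
    using psi_difference[OF _ \<xi>, of _ \<sigma>] h(1) by (simp add: o_def A_def[abs_def])
qed

lemma phi_has_deriv2:
  assumes x: "x \<in> {0..1}"
  shows "(phi x has_real_derivative inverse (psi' x (phi x t))) (at t)"
proof (rule DERIV_inverse_function[of "psi x" _ "phi x" t "t - 1" "t + 1"])
  show "(psi x has_real_derivative psi' x (phi x t)) (at (phi x t))" by (rule psi_has_deriv2[OF x])
  show "psi' x (phi x t) \<noteq> 0" using psi'_pos[of x "phi x t"] by simp
  show "isCont (phi x) t"
  proof -
    have "continuous_on UNIV (phi x)"
      by (rule lipschitz_onI[THEN lipschitz_on_continuous_on, of _ _ "exp L"])
        (auto simp: dist_real_def phi_Lipschitz2[OF x])
    then show ?thesis by (simp add: continuous_on_eq_continuous_at)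
  qed
qed (simp_all add: psi_phi[OF x])

text \<open>
  With $\sigma(\eta) = \varphi(\eta, y(\eta))$, the curve $\psi(\xi, \sigma(\eta))$ differs from $y(\eta)$
  by the integral of \<open>f\<close> from \<open>\<xi>\<close> to \<open>\<eta>\<close> along a characteristic, hence its derivative at \<open>\<xi>\<close>.
\<close>

lemma phi_along_curve:
  assumes y: "(y has_real_derivative y') (at \<xi> within {0..1})" and \<xi>: "\<xi> \<in> {0..1}"
  shows "((\<lambda>\<eta>. phi \<eta> (y \<eta>)) has_real_derivative (y' - f \<xi> (y \<xi>)) / psi' \<xi> (phi \<xi> (y \<xi>)))
    (at \<xi> within {0..1})"
proof -
  define \<sigma> where "\<sigma> \<eta> = phi \<eta> (y \<eta>)" for \<eta>
  have "\<exists>\<mu>. \<mu> \<in> {0..1} \<and> \<bar>\<mu> - \<xi>\<bar> \<le> \<bar>\<eta> - \<xi>\<bar> \<and>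
      psi \<eta> (\<sigma> \<eta>) - psi \<xi> (\<sigma> \<eta>) = f \<mu> (psi \<mu> (\<sigma> \<eta>)) * (\<eta> - \<xi>)" if "\<eta> \<in> {0..1}" for \<eta>
    using within_deriv_mvt[OF psi_deriv \<xi> that] by metis
  then obtain \<mu> where \<mu>: "\<And>\<eta>. \<eta> \<in> {0..1} \<Longrightarrow> \<mu> \<eta> \<in> {0..1}"
      "\<And>\<eta>. \<eta> \<in> {0..1} \<Longrightarrow> \<bar>\<mu> \<eta> - \<xi>\<bar> \<le> \<bar>\<eta> - \<xi>\<bar>"
      "\<And>\<eta>. \<eta> \<in> {0..1} \<Longrightarrow> psi \<eta> (\<sigma> \<eta>) - psi \<xi> (\<sigma> \<eta>) = f (\<mu> \<eta>) (psi (\<mu> \<eta>) (\<sigma> \<eta>)) * (\<eta> - \<xi>)"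
    by metis
  have near: "\<forall>\<^sub>F \<eta> in at \<xi> within {0..1}. \<eta> \<in> {0..1} \<and> \<eta> \<noteq> \<xi>"
    by (simp add: eventually_at_filter)
  then have near': "\<forall>\<^sub>F \<eta> in at \<xi> within {0..1}. \<eta> \<in> {0..1}"
    by (rule eventually_mono) simp
  have \<mu>_lim: "(\<mu> \<longlongrightarrow> \<xi>) (at \<xi> within {0..1})"
  proof (rule LIM_zero_cancel, rule Lim_null_comparison)
    show "\<forall>\<^sub>F \<eta> in at \<xi> within {0..1}. norm (\<mu> \<eta> - \<xi>) \<le> \<bar>\<eta> - \<xi>\<bar>"
      using near by eventually_elim (use \<mu>(2) in auto)
    show "((\<lambda>\<eta>. \<bar>\<eta> - \<xi>\<bar>) \<longlongrightarrow> 0) (at \<xi> within {0..1})"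
      by (auto intro!: tendsto_eq_intros)
  qed
  have y_lim: "(y \<longlongrightarrow> y \<xi>) (at \<xi> within {0..1})"
    using DERIV_continuous[OF y] by (simp add: continuous_within)
  have \<sigma>_lim: "(\<sigma> \<longlongrightarrow> \<sigma> \<xi>) (at \<xi> within {0..1})"
    unfolding \<sigma>_def
    using continuous_on_tendsto_compose[OF continuous_on_phi tendsto_Pair[OF tendsto_ident_at y_lim]] \<xi> near'
    by simp
  have "((\<lambda>\<eta>. (y \<eta> - y \<xi>) / (\<eta> - \<xi>) - f (\<mu> \<eta>) (psi (\<mu> \<eta>) (\<sigma> \<eta>))) \<longlongrightarrow>
      y' - f \<xi> (psi \<xi> (\<sigma> \<xi>))) (at \<xi> within {0..1})"
  proof (rule tendsto_diff)
    show "((\<lambda>\<eta>. (y \<eta> - y \<xi>) / (\<eta> - \<xi>)) \<longlongrightarrow> y') (at \<xi> within {0..1})"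
      using y by (simp add: has_field_derivative_iff)
    show "((\<lambda>\<eta>. f (\<mu> \<eta>) (psi (\<mu> \<eta>) (\<sigma> \<eta>))) \<longlongrightarrow> f \<xi> (psi \<xi> (\<sigma> \<xi>))) (at \<xi> within {0..1})"
      using continuous_on_tendsto_compose[OF continuous_on_along_psi[OF cont_f]
          tendsto_Pair[OF \<mu>_lim \<sigma>_lim]] \<xi>
        eventually_mono[OF near' \<mu>(1)] by simp
  qed
  moreover have "\<forall>\<^sub>F \<eta> in at \<xi> within {0..1}.
      (y \<eta> - y \<xi>) / (\<eta> - \<xi>) - f (\<mu> \<eta>) (psi (\<mu> \<eta>) (\<sigma> \<eta>)) =
      (psi \<xi> (\<sigma> \<eta>) - psi \<xi> (\<sigma> \<xi>)) / (\<eta> - \<xi>)"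
    using near
  proof eventually_elim
    case (elim \<eta>)
    then have "f (\<mu> \<eta>) (psi (\<mu> \<eta>) (\<sigma> \<eta>)) = (y \<eta> - psi \<xi> (\<sigma> \<eta>)) / (\<eta> - \<xi>)"
      using \<mu>(3)[of \<eta>] by (simp add: \<sigma>_def psi_phi field_simps)
    then show ?case using \<xi> by (simp add: diff_divide_distrib[symmetric] \<sigma>_def psi_phi)
  qed
  ultimately have "((\<lambda>\<eta>. (psi \<xi> (\<sigma> \<eta>) - psi \<xi> (\<sigma> \<xi>)) / (\<eta> - \<xi>)) \<longlongrightarrow>
      y' - f \<xi> (psi \<xi> (\<sigma> \<xi>))) (at \<xi> within {0..1})"
    by (rule Lim_transform_eventually)
  then have z: "((\<lambda>\<eta>. psi \<xi> (\<sigma> \<eta>)) has_real_derivative y' - f \<xi> (y \<xi>)) (at \<xi> within {0..1})"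
    using \<xi> by (simp add: has_field_derivative_iff \<sigma>_def psi_phi)
  \<comment> \<open>The moving curve has been pulled back to the fixed section \<xi>, where
    differentiability of \<open>phi \<xi>\<close> in time is enough.\<close>
  have "(phi \<xi> \<circ> (\<lambda>\<eta>. psi \<xi> (\<sigma> \<eta>)) has_real_derivative
      inverse (psi' \<xi> (phi \<xi> (psi \<xi> (\<sigma> \<xi>)))) * (y' - f \<xi> (y \<xi>))) (at \<xi> within {0..1})"
    by (rule DERIV_image_chain[OF DERIV_subset[OF phi_has_deriv2[OF \<xi>]] z]) simp
  then show ?thesis
    using \<xi> by (simp add: o_def phi_psi \<sigma>_def divide_inverse mult.commute)
qed

end

section \<open>The smoothing estimate\<close>

lemma integral_upper_limit_Lipschitz:
  fixes g :: "real \<Rightarrow> real"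
  assumes g: "continuous_on UNIV g" "\<And>s. \<bar>g s\<bar> \<le> B" and "c \<le> p" "c \<le> q"
  shows "\<bar>integral {c..p} g - integral {c..q} g\<bar> \<le> B * \<bar>p - q\<bar>"
proof -
  have *: "\<bar>integral {c..q} g - integral {c..p} g\<bar> \<le> B * \<bar>q - p\<bar>" if "c \<le> p" "p \<le> q" for p q
  proof -
    have int: "g integrable_on {x..y}" for x y
      by (rule integrable_continuous_interval[OF continuous_on_subset[OF g(1)]]) simp
    have "integral {c..p} g + integral {p..q} g = integral {c..q} g"
      using that int by (rule Henstock_Kurzweil_Integration.integral_combine)
    moreover have "norm (integral {p..q} g) \<le> B * (q - p)"
      by (rule integral_bound) (use that g in \<open>auto intro: continuous_on_subset\<close>)
    ultimately show ?thesis using that by simp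
  qed
  show ?thesis
    using *[of p q] *[of q p] assms(3,4) by (cases "p \<le> q") (auto simp: abs_minus_commute)
qed

text \<open>Leibniz's rule with a moving limit: the integral of h x over {c..y} has partial
  derivatives in x and y, the latter continuous, so it is differentiable in (x, y), and the chain
  rule applies along (\<eta>, u \<eta>). A lower limit c below all values of u avoids oriented
  integrals.\<close>

lemma deriv_integral_variable_limit:
  fixes h h' :: "real \<Rightarrow> real \<Rightarrow> real"
  assumes h: "continuous_on ({0..1} \<times> UNIV) (\<lambda>(x, s). h x s)"
    and h': "continuous_on ({0..1} \<times> UNIV) (\<lambda>(x, s). h' x s)"
    and deriv: "\<And>x s. x \<in> {0..1} \<Longrightarrow> ((\<lambda>x. h x s) has_real_derivative h' x s) (at x within {0..1})"
    and u: "(u has_real_derivative v) (at \<xi> within {0..1})" "u ` {0..1} \<subseteq> {c..d}"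
    and \<xi>: "\<xi> \<in> {0..1}"
  shows "((\<lambda>\<eta>. integral {c..u \<eta>} (h \<eta>)) has_real_derivative
    integral {c..u \<xi>} (h' \<xi>) + h \<xi> (u \<xi>) * v) (at \<xi> within {0..1})"
proof -
  have slice: "continuous_on {p..q} (h x)" if "x \<in> {0..1}" for x p q
    using that by (intro continuous_on_compose2[OF h, of _ "\<lambda>s. (x, s)", simplified]) (auto intro!: continuous_intros)
  have u\<xi>: "u \<xi> \<in> {c..d}" using u(2) \<xi> by blast
  have d1: "((\<lambda>x. integral {c..u \<xi>} (h x)) has_derivative (\<lambda>t. integral {c..u \<xi>} (h' \<xi>) * t))
      (at \<xi> within {0..1})"
  proof -
    have "((\<lambda>x. integral (cbox c (u \<xi>)) (h x)) has_field_derivative integral (cbox c (u \<xi>)) (h' \<xi>))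
        (at \<xi> within {0..1})"
    proof (rule leibniz_rule_field_derivative)
      show "h x integrable_on cbox c (u \<xi>)" if "x \<in> {0..1}" for x
        using integrable_continuous_interval[OF slice[OF that]] by simp
      show "continuous_on ({0..1} \<times> cbox c (u \<xi>)) (\<lambda>(x, t). h' x t)"
        by (rule continuous_on_subset[OF h']) auto
    qed (use deriv \<xi> in auto)
    then show ?thesis by (simp add: has_field_derivative_def)
  qed
  have d2: "((\<lambda>y. integral {c..y} (h x)) has_derivative blinfun_apply (blinfun_mult_right (h x y)))
      (at y within {c..d})" if "x \<in> {0..1}" "y \<in> {c..d}" for x y
    using integral_has_real_derivative[OF slice[OF that(1)] that(2)]
    by (simp add: has_field_derivative_def)
  have "continuous_on ({0..1} \<times> {c..d}) (\<lambda>p. blinfun_mult_right ((\<lambda>(x, y). h x y) p))"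
    by (intro bounded_linear.continuous_on[OF bounded_linear_blinfun_mult_right]
        continuous_on_subset[OF h]) auto
  then have "continuous (at (\<xi>, u \<xi>) within {0..1} \<times> {c..d}) (\<lambda>(x, y). blinfun_mult_right (h x y))"
    using \<xi> u\<xi> by (simp add: continuous_on_eq_continuous_within case_prod_unfold)
  from has_derivative_partialsI[OF d1 d2 this u\<xi>]
  have D: "((\<lambda>(x, y). integral {c..y} (h x)) has_derivative
      (\<lambda>(tx, ty). integral {c..u \<xi>} (h' \<xi>) * tx + h \<xi> (u \<xi>) * ty)) (at (\<xi>, u \<xi>) within {0..1} \<times> {c..d})"
    by simp
  have "((\<lambda>\<eta>. (\<eta>, u \<eta>)) has_derivative (\<lambda>t. (t, v * t))) (at \<xi> within {0..1})"
    using u(1) by (intro has_derivative_Pair has_derivative_ident) (simp add: has_field_derivative_def)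
  from has_derivative_in_compose[OF this, of "\<lambda>(x, y). integral {c..y} (h x)"]
  have "((\<lambda>\<eta>. integral {c..u \<eta>} (h \<eta>)) has_derivative
      (\<lambda>t. integral {c..u \<xi>} (h' \<xi>) * t + h \<xi> (u \<xi>) * (v * t))) (at \<xi> within {0..1})"
    using has_derivative_subset[OF D, of "(\<lambda>\<eta>. (\<eta>, u \<eta>)) ` {0..1}"] u(2)
    by (fastforce simp: case_prod_unfold)
  then show ?thesis
    unfolding has_field_derivative_def
    by (rule has_derivative_eq_rhs) (simp add: fun_eq_iff algebra_simps)
qed

locale two_fields = J: periodic_field fj fjt L + K: periodic_field fk fkt L
  for fj fjt fk fkt L
begin

text \<open>
  The factor \<open>fj - fk\<close> is the derivative of \<open>K.phi \<xi> (J.psi \<xi> \<sigma>)\<close> up to the Jacobian \<open>K.psi'\<close>, so that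
  an integration by parts moves the increment in \<open>\<sigma>\<close> from \<open>H\<close>, which need not be differentiable in
  its second argument, to an integral of \<open>H\<close>.
\<close>

lemma smoothing_estimate:
  assumes q: "\<And>x. x \<in> {0..1} \<Longrightarrow> (q \<sigma> has_real_derivative q' x) (at x within {0..1})"
    and q_bound: "\<And>x \<sigma>. x \<in> {0..1} \<Longrightarrow> \<bar>q \<sigma> x\<bar> \<le> M" "\<And>x. x \<in> {0..1} \<Longrightarrow> \<bar>q' x\<bar> \<le> M"
    and q_Lip: "\<And>x. x \<in> {0..1} \<Longrightarrow> \<bar>q \<tau> x - q \<sigma> x\<bar> \<le> M * \<bar>\<tau> - \<sigma>\<bar>"
    and q_cont: "\<And>\<sigma>. continuous_on {0..1} (q \<sigma>)"
    and H: "continuous_on ({0..1} \<times> UNIV) (\<lambda>(x, s). H x s)"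
    and G: "continuous_on ({0..1} \<times> UNIV) (\<lambda>(x, s). G x s)"
    and HG: "\<And>x s. x \<in> {0..1} \<Longrightarrow> ((\<lambda>x. H x s) has_real_derivative G x s) (at x within {0..1})"
    and bound: "\<And>x s. x \<in> {0..1} \<Longrightarrow> \<bar>H x s\<bar> \<le> N" "\<And>x s. x \<in> {0..1} \<Longrightarrow> \<bar>G x s\<bar> \<le> N"
    and x: "x \<in> {0..1}"
  defines "g \<equiv> \<lambda>\<sigma> \<xi>. q \<sigma> \<xi> * ((fj \<xi> (J.psi \<xi> \<sigma>) - fk \<xi> (J.psi \<xi> \<sigma>)) * H \<xi> (K.phi \<xi> (J.psi \<xi> \<sigma>)))"
  shows "\<bar>primitive (g \<tau>) x - primitive (g \<sigma>) x\<bar> \<le> M * N * (2 * L + (4 + L) * exp L ^ 3) * \<bar>\<tau> - \<sigma>\<bar>"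
proof -
  have pos: "M \<ge> 0" "N \<ge> 0" using q_bound(1)[OF x] bound(1)[OF x] by force+
  \<comment> \<open>The label, with respect to the k-characteristics, of the point at \<xi> on the
    j-characteristic labelled \<sigma>.\<close>
  define u where "u \<sigma> \<xi> = K.phi \<xi> (J.psi \<xi> \<sigma>)" for \<sigma> \<xi>
  define rw where "rw \<sigma> \<xi> = (fj \<xi> (J.psi \<xi> \<sigma>) - fk \<xi> (J.psi \<xi> \<sigma>)) * H \<xi> (u \<sigma> \<xi>)" for \<sigma> \<xi>
  \<comment> \<open>The Jacobian cancels the denominator in the derivative of u, so that h at u
    times this derivative is exactly \<open>rw\<close>.\<close>
  define h where "h \<xi> s = H \<xi> s * K.psi' \<xi> s" for \<xi> s
  define h' where "h' \<xi> s = (G \<xi> s + H \<xi> s * fkt \<xi> (K.psi \<xi> s)) * K.psi' \<xi> s" for \<xi> s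
  have cont_h: "continuous_on ({0..1} \<times> UNIV) (\<lambda>(x, s). h x s)"
    using continuous_on_mult[OF H K.continuous_on_psi'] by (simp add: h_def case_prod_unfold)
  have cont_h': "continuous_on ({0..1} \<times> UNIV) (\<lambda>(x, s). h' x s)"
    using continuous_on_mult[OF continuous_on_add[OF G continuous_on_mult[OF H
      K.continuous_on_along_psi[OF K.cont_ft]]] K.continuous_on_psi']
    by (simp add: h'_def case_prod_unfold)
  have h': "((\<lambda>x. h x s) has_real_derivative h' x s) (at x within {0..1})" if "x \<in> {0..1}" for x s
    using DERIV_mult[OF HG[OF that] K.psi'_deriv[OF that]]
    by (simp add: h_def h'_def algebra_simps)
  have h_bound: "\<bar>h x s\<bar> \<le> N * exp L" if "x \<in> {0..1}" for x s
    unfolding h_def abs_mult using bound(1)[OF that] K.psi'_le[OF that] K.psi'_pos[of x s] pos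
    by (intro mult_mono) auto
  have h'_bound: "\<bar>h' x s\<bar> \<le> N * (1 + L) * exp L" if "x \<in> {0..1}" for x s
  proof -
    have "\<bar>H x s * fkt x (K.psi x s)\<bar> \<le> N * L"
      unfolding abs_mult using bound(1)[OF that] K.bound_ft[OF that] pos by (intro mult_mono) auto
    then have "\<bar>G x s + H x s * fkt x (K.psi x s)\<bar> \<le> N * (1 + L)"
      using bound(2)[OF that, of s] by (simp add: algebra_simps)
    then show ?thesis
      unfolding h'_def abs_mult using K.psi'_le[OF that] K.psi'_pos[of x s] pos J.L_pos
      by (intro mult_mono) auto
  qed
  have u: "(u \<sigma> has_real_derivative (fj \<xi> (J.psi \<xi> \<sigma>) - fk \<xi> (J.psi \<xi> \<sigma>)) / K.psi' \<xi> (u \<sigma> \<xi>))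
      (at \<xi> within {0..1})" if "\<xi> \<in> {0..1}" for \<sigma> \<xi>
    using K.phi_along_curve[OF J.psi_deriv[OF that] that] by (simp add: u_def[abs_def])
  have u_near: "\<bar>u \<sigma> \<xi> - \<sigma>\<bar> \<le> 2 * L" if "\<xi> \<in> {0..1}" for \<sigma> \<xi>
    using J.psi_near[OF that, of \<sigma>] K.psi_near[OF that, of "u \<sigma> \<xi>"] K.psi_phi[OF that, of "J.psi \<xi> \<sigma>"]
    by (simp add: u_def)
  \<comment> \<open>Each of the two flows moves a point by at most L in time, so u stays within 2 L
    of its label, and {c..d} contains both curves.\<close>
  define c where "c = min \<sigma> \<tau> - 2 * L"
  define d where "d = max \<sigma> \<tau> + 2 * L"
  have u_range: "u \<sigma> ` {0..1} \<subseteq> {c..d}" "u \<tau> ` {0..1} \<subseteq> {c..d}"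
    using u_near[of _ \<sigma>] u_near[of _ \<tau>] by (fastforce simp: c_def d_def abs_le_iff)+
  define \<Phi> where "\<Phi> \<sigma> \<xi> = integral {c..u \<sigma> \<xi>} (h \<xi>)" for \<sigma> \<xi>
  define \<Psi> where "\<Psi> \<sigma> \<xi> = integral {c..u \<sigma> \<xi>} (h' \<xi>)" for \<sigma> \<xi>
  have \<Phi>: "(\<Phi> s has_real_derivative \<Psi> s \<xi> + rw s \<xi>) (at \<xi> within {0..1})"
    if "\<xi> \<in> {0..1}" "s \<in> {\<sigma>, \<tau>}" for s \<xi>
  proof -
    have "u s ` {0..1} \<subseteq> {c..d}" using that(2) u_range by blast
    from deriv_integral_variable_limit[OF cont_h cont_h' h' u[OF that(1)] this that(1)]
    have "((\<lambda>\<eta>. integral {c..u s \<eta>} (h \<eta>)) has_real_derivative integral {c..u s \<xi>} (h' \<xi>) +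
      h \<xi> (u s \<xi>) * ((fj \<xi> (J.psi \<xi> s) - fk \<xi> (J.psi \<xi> s)) / K.psi' \<xi> (u s \<xi>)))
      (at \<xi> within {0..1})" .
    moreover have "h \<xi> (u s \<xi>) * ((fj \<xi> (J.psi \<xi> s) - fk \<xi> (J.psi \<xi> s)) / K.psi' \<xi> (u s \<xi>)) = rw s \<xi>"
      using K.psi'_pos[of \<xi> "u s \<xi>"] by (simp add: rw_def h_def)
    ultimately show ?thesis by (simp add: \<Phi>_def[abs_def] \<Psi>_def)
  qed
  define D where "D \<xi> = \<Phi> \<tau> \<xi> - \<Phi> \<sigma> \<xi>" for \<xi>
  define Z where "Z \<xi> = \<Psi> \<tau> \<xi> - \<Psi> \<sigma> \<xi>" for \<xi>
  have D: "(D has_real_derivative Z \<xi> + (rw \<tau> \<xi> - rw \<sigma> \<xi>)) (at \<xi> within {0..1})"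
    if "\<xi> \<in> {0..1}" for \<xi>
    using DERIV_diff[OF \<Phi>[OF that, of \<tau>] \<Phi>[OF that, of \<sigma>]]
    by (simp add: D_def[abs_def] Z_def algebra_simps)
  have uu: "\<bar>u \<tau> \<xi> - u \<sigma> \<xi>\<bar> \<le> exp L ^ 2 * \<bar>\<tau> - \<sigma>\<bar>" if "\<xi> \<in> {0..1}" for \<xi>
  proof -
    have "\<bar>u \<tau> \<xi> - u \<sigma> \<xi>\<bar> \<le> exp L * \<bar>J.psi \<xi> \<tau> - J.psi \<xi> \<sigma>\<bar>"
      unfolding u_def by (rule K.phi_Lipschitz2[OF that])
    also have "\<dots> \<le> exp L * (exp L * \<bar>\<tau> - \<sigma>\<bar>)"
      by (intro mult_left_mono J.psi_Lipschitz2[OF that]) simp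
    finally show ?thesis by (simp add: power2_eq_square)
  qed
  have slice: "continuous_on UNIV (k x)"
    if "continuous_on ({0..1} \<times> UNIV) (\<lambda>(x, s). k x s)" "x \<in> {0..1}" for k :: "real \<Rightarrow> real \<Rightarrow> real" and x
    using that(2)
    by (intro continuous_on_compose2[OF that(1), of _ "\<lambda>s. (x, s)", simplified]) (auto intro!: continuous_intros)
  have D_bound: "\<bar>D \<xi>\<bar> \<le> N * exp L ^ 3 * \<bar>\<tau> - \<sigma>\<bar>"
    and Z_bound: "\<bar>Z \<xi>\<bar> \<le> N * (1 + L) * exp L ^ 3 * \<bar>\<tau> - \<sigma>\<bar>" if \<xi>: "\<xi> \<in> {0..1}" for \<xi>
  proof -
    have "u \<tau> \<xi> \<in> {c..d}" "u \<sigma> \<xi> \<in> {c..d}" using u_range \<xi> by blast+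
    then have cu: "c \<le> u \<tau> \<xi>" "c \<le> u \<sigma> \<xi>" by auto
    have "\<bar>D \<xi>\<bar> \<le> N * exp L * \<bar>u \<tau> \<xi> - u \<sigma> \<xi>\<bar>"
      unfolding D_def \<Phi>_def
      by (rule integral_upper_limit_Lipschitz[OF slice[OF cont_h \<xi>] h_bound[OF \<xi>] cu])
    also have "\<dots> \<le> N * exp L * (exp L ^ 2 * \<bar>\<tau> - \<sigma>\<bar>)"
      using pos by (intro mult_left_mono uu[OF \<xi>]) auto
    finally show "\<bar>D \<xi>\<bar> \<le> N * exp L ^ 3 * \<bar>\<tau> - \<sigma>\<bar>" by (simp add: power3_eq_cube power2_eq_square)
    have "\<bar>Z \<xi>\<bar> \<le> N * (1 + L) * exp L * \<bar>u \<tau> \<xi> - u \<sigma> \<xi>\<bar>"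
      unfolding Z_def \<Psi>_def
      by (rule integral_upper_limit_Lipschitz[OF slice[OF cont_h' \<xi>] h'_bound[OF \<xi>] cu])
    also have "\<dots> \<le> N * (1 + L) * exp L * (exp L ^ 2 * \<bar>\<tau> - \<sigma>\<bar>)"
      using pos J.L_pos by (intro mult_left_mono uu[OF \<xi>]) auto
    finally show "\<bar>Z \<xi>\<bar> \<le> N * (1 + L) * exp L ^ 3 * \<bar>\<tau> - \<sigma>\<bar>"
      by (simp add: power3_eq_cube power2_eq_square)
  qed
  have cont_g: "continuous_on {0..1} (g s)" for s
  proof -
    have c: "continuous_on {0..1} (\<lambda>\<xi>. J.psi \<xi> s)"
      using continuous_on_strip_slice[OF J.continuous_on_psi, of "\<lambda>_. s"] by simp
    show ?thesis
      unfolding g_def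
      by (intro continuous_intros q_cont continuous_on_strip_slice[OF J.cont_f]
          continuous_on_strip_slice[OF K.cont_f] continuous_on_strip_slice[OF H]
          continuous_on_strip_slice[OF K.continuous_on_phi] c)
  qed
  \<comment> \<open>Integration by parts in differentiated form: subtracting the boundary term q D
    cancels the increment of \<open>rw\<close> weighted by q. Only increments of q and of integrals
    over labels remain, all of them Lipschitz in the label.\<close>
  define E where "E \<xi> = primitive (g \<tau>) \<xi> - primitive (g \<sigma>) \<xi> - q \<sigma> \<xi> * D \<xi>" for \<xi>
  define E' where "E' \<xi> = (q \<tau> \<xi> - q \<sigma> \<xi>) * rw \<tau> \<xi> - q' \<xi> * D \<xi> - q \<sigma> \<xi> * Z \<xi>" for \<xi>
  have E: "(E has_real_derivative E' \<xi>) (at \<xi> within {0..1})" if "\<xi> \<in> {0..1}" for \<xi>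
    using DERIV_diff[OF DERIV_diff[OF primitive_deriv[OF cont_g that] primitive_deriv[OF cont_g that]]
        DERIV_mult[OF q[OF that] D[OF that]], of \<tau> \<sigma>]
    unfolding E_def E'_def
    by (rule DERIV_cong) (simp add: g_def rw_def u_def algebra_simps)
  \<comment> \<open>2 L bounds the difference of the two fields; exp L ^ 3 is the Jacobian bound exp
    L times the Lipschitz constant exp L ^ 2 of u; 2 + L collects 1 from D and 1 + L from Z. The
    boundary terms at x and 0 later raise it to 4 + L.\<close>
  define B where "B = M * N * (2 * L + (2 + L) * exp L ^ 3) * \<bar>\<tau> - \<sigma>\<bar>"
  have "\<bar>E' \<xi>\<bar> \<le> B" if \<xi>: "\<xi> \<in> {0..1}" for \<xi>
  proof -
    have "\<bar>rw \<tau> \<xi>\<bar> \<le> 2 * L * N"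
      unfolding rw_def abs_mult
      using J.bound_f[OF \<xi>, of "J.psi \<xi> \<tau>"] K.bound_f[OF \<xi>, of "J.psi \<xi> \<tau>"] bound(1)[OF \<xi>] J.L_pos
      by (intro mult_mono) auto
    then have 1: "\<bar>(q \<tau> \<xi> - q \<sigma> \<xi>) * rw \<tau> \<xi>\<bar> \<le> (M * \<bar>\<tau> - \<sigma>\<bar>) * (2 * L * N)"
      unfolding abs_mult using q_Lip[OF \<xi>] pos by (intro mult_mono) auto
    have 2: "\<bar>q' \<xi> * D \<xi>\<bar> \<le> M * (N * exp L ^ 3 * \<bar>\<tau> - \<sigma>\<bar>)"
      unfolding abs_mult using q_bound(2)[OF \<xi>] D_bound[OF \<xi>] pos by (intro mult_mono) auto
    have 3: "\<bar>q \<sigma> \<xi> * Z \<xi>\<bar> \<le> M * (N * (1 + L) * exp L ^ 3 * \<bar>\<tau> - \<sigma>\<bar>)"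
      unfolding abs_mult using q_bound(1)[OF \<xi>] Z_bound[OF \<xi>] pos by (intro mult_mono) auto
    have "\<bar>E' \<xi>\<bar> \<le> \<bar>(q \<tau> \<xi> - q \<sigma> \<xi>) * rw \<tau> \<xi>\<bar> + \<bar>q' \<xi> * D \<xi>\<bar> + \<bar>q \<sigma> \<xi> * Z \<xi>\<bar>"
      unfolding E'_def by linarith
    also have "\<dots> \<le> B" using 1 2 3 by (simp add: B_def algebra_simps)
    finally show ?thesis .
  qed
  from within_deriv_Lipschitz[OF E this, of 0 x] x
  have "\<bar>E x - E 0\<bar> \<le> B * \<bar>x\<bar>" by simp
  also have "\<dots> \<le> B * 1"
    using x pos J.L_pos by (intro mult_left_mono) (auto simp: B_def)
  finally have "\<bar>E x - E 0\<bar> \<le> B" by simp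
  moreover have "\<bar>q \<sigma> y * D y\<bar> \<le> M * (N * exp L ^ 3 * \<bar>\<tau> - \<sigma>\<bar>)" if "y \<in> {0..1}" for y
    unfolding abs_mult using q_bound(1)[OF that] D_bound[OF that] pos by (intro mult_mono) auto
  from this[OF x] this[of 0]
  have "\<bar>q \<sigma> x * D x\<bar> + \<bar>q \<sigma> 0 * D 0\<bar> \<le> 2 * (M * (N * exp L ^ 3 * \<bar>\<tau> - \<sigma>\<bar>))" by simp
  moreover have "primitive (g \<tau>) x - primitive (g \<sigma>) x = (E x - E 0) + q \<sigma> x * D x - q \<sigma> 0 * D 0"
    by (simp add: E_def)
  ultimately have "\<bar>primitive (g \<tau>) x - primitive (g \<sigma>) x\<bar> \<le> B + 2 * (M * (N * exp L ^ 3 * \<bar>\<tau> - \<sigma>\<bar>))"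
    by linarith
  also have "\<dots> = M * N * (2 * L + (4 + L) * exp L ^ 3) * \<bar>\<tau> - \<sigma>\<bar>"
    by (simp add: B_def algebra_simps)
  finally show ?thesis .
qed

end

section \<open>Maps on the strip\<close>

lemma strip_norm_real: "x \<in> {0..1} \<Longrightarrow> \<bar>strip_apply (u :: real per_strip) x t\<bar> \<le> norm u"
  using strip_norm_upper[of x u t] norm_le_infnorm[of "strip_apply u x t"] by simp

lemma strip_norm_nth: "x \<in> {0..1} \<Longrightarrow> \<bar>strip_apply (u :: (real ^ 'n) per_strip) x t $ j\<bar> \<le> norm u"
  using strip_norm_upper[of x u t] component_le_infnorm_cart[of "strip_apply u x t" j] by simp

lemma line_norm_nth: "\<bar>line_apply (v :: (real ^ 'n) per_line) t $ j\<bar> \<le> norm v"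
  using line_norm_upper[of v t] component_le_infnorm_cart[of "line_apply v t" j] by simp

lemma infnorm_le_componentwise:
  fixes v :: "real ^ 'n"
  assumes "\<And>j. \<bar>v $ j\<bar> \<le> B"
  shows "infnorm v \<le> B"
  unfolding infnorm_cart by (rule cSup_least) (use assms in auto)

lemma strip_norm_least_nth:
  fixes u :: "(real ^ 'n) per_strip"
  assumes "\<And>x t j. x \<in> {0..1} \<Longrightarrow> \<bar>strip_apply u x t $ j\<bar> \<le> B"
  shows "norm u \<le> B"
  using assms by (intro strip_norm_least infnorm_le_componentwise) auto

lemma strip_cont_nth:
  fixes u :: "(real ^ 'n) per_strip"
  shows "continuous_on ({0..1} \<times> UNIV) (\<lambda>(x, t). strip_apply u x t $ j)"
  using continuous_on_component[OF strip_cont[of u]] by (simp add: case_prod_unfold)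

lemma periodic_strip_bounded:
  fixes g :: "real \<Rightarrow> real \<Rightarrow> real"
  assumes g: "continuous_on ({0..1} \<times> UNIV) (\<lambda>(x, t). g x t)"
    and per: "\<And>x t. x \<in> {0..1} \<Longrightarrow> g x (t + 2 * pi) = g x t"
  shows "\<exists>B. \<forall>x\<in>{0..1}. \<forall>t. \<bar>g x t\<bar> \<le> B"
proof -
  define h where "h x t = (if x \<in> {0..1} then g x t else 0)" for x t
  have "continuous_on ({0..1} \<times> UNIV) (\<lambda>(x, t). h x t)"
    using g by (subst continuous_on_cong[OF refl, where g = "\<lambda>(x, t). g x t"]) (auto simp: h_def)
  then have "strip_apply (Strip h) = h" by (intro Strip_apply) (auto simp: h_def per)
  then have "\<bar>g x t\<bar> \<le> norm (Strip h)" if "x \<in> {0..1}" for x t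
    using strip_norm_real[OF that, of "Strip h" t] that by (simp add: h_def)
  then show ?thesis by blast
qed

lemma has_dt_real:
  fixes u w :: "real per_strip"
  assumes "has_dt u w" "x \<in> {0..1}"
  shows "(strip_apply u x has_real_derivative strip_apply w x t) (at t)"
  using assms by (simp add: has_dt_def has_real_derivative_iff_has_vector_derivative)

lemma has_dt_Lipschitz:
  fixes u w :: "real per_strip"
  assumes "has_dt u w" "x \<in> {0..1}"
  shows "\<bar>strip_apply u x s - strip_apply u x t\<bar> \<le> norm w * \<bar>s - t\<bar>"
  using field_differentiable_bound[of UNIV "strip_apply u x" "strip_apply w x" "norm w" s t]
    has_dt_real[OF assms] strip_norm_real[OF assms(2)] by simp

text \<open>Only partial derivatives are given. Continuity of the one in time makes u differentiable
  in both variables jointly, so that the chain rule applies.\<close>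

lemma C1_strip_along_curve:
  fixes u ux ut :: "real per_strip"
  assumes u: "has_dx u ux" "has_dt u ut"
    and y: "(y has_real_derivative v) (at \<xi> within {0..1})" and \<xi>: "\<xi> \<in> {0..1}"
  shows "((\<lambda>\<xi>. strip_apply u \<xi> (y \<xi>)) has_real_derivative
    strip_apply ux \<xi> (y \<xi>) + strip_apply ut \<xi> (y \<xi>) * v) (at \<xi> within {0..1})"
proof -
  have d1: "((\<lambda>x. strip_apply u x (y \<xi>)) has_derivative (\<lambda>t. strip_apply ux \<xi> (y \<xi>) * t))
      (at \<xi> within {0..1})"
    using u(1) \<xi>
    by (auto simp: has_dx_def has_real_derivative_iff_has_vector_derivative[symmetric]
        has_field_derivative_def)
  have d2: "(strip_apply u x has_derivative blinfun_apply (blinfun_mult_right (strip_apply ut x t)))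
      (at t within UNIV)" if "x \<in> {0..1}" "t \<in> UNIV" for x t
    using has_dt_real[OF u(2) that(1)] by (simp add: has_field_derivative_def)
  have "continuous_on ({0..1} \<times> UNIV) (\<lambda>p. blinfun_mult_right ((\<lambda>(x, t). strip_apply ut x t) p))"
    by (intro bounded_linear.continuous_on[OF bounded_linear_blinfun_mult_right] strip_cont)
  then have "continuous (at (\<xi>, y \<xi>) within {0..1} \<times> UNIV)
      (\<lambda>(x, t). blinfun_mult_right (strip_apply ut x t))"
    using \<xi> by (simp add: continuous_on_eq_continuous_within case_prod_unfold)
  from has_derivative_partialsI[OF d1 d2 this UNIV_I]
  have D: "((\<lambda>(x, t). strip_apply u x t) has_derivative
      (\<lambda>(tx, tt). strip_apply ux \<xi> (y \<xi>) * tx + strip_apply ut \<xi> (y \<xi>) * tt))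
      (at (\<xi>, y \<xi>) within {0..1} \<times> UNIV)"
    by simp
  have "((\<lambda>\<eta>. (\<eta>, y \<eta>)) has_derivative (\<lambda>t. (t, v * t))) (at \<xi> within {0..1})"
    using y by (intro has_derivative_Pair has_derivative_ident) (simp add: has_field_derivative_def)
  from has_derivative_in_compose[OF this, of "\<lambda>(x, t). strip_apply u x t"]
  have "((\<lambda>\<eta>. strip_apply u \<eta> (y \<eta>)) has_derivative
      (\<lambda>t. strip_apply ux \<xi> (y \<xi>) * t + strip_apply ut \<xi> (y \<xi>) * (v * t))) (at \<xi> within {0..1})"
    using has_derivative_subset[OF D, of "(\<lambda>\<eta>. (\<eta>, y \<eta>)) ` {0..1}"]
    by (fastforce simp: case_prod_unfold)
  then show ?thesis
    unfolding has_field_derivative_def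
    by (rule has_derivative_eq_rhs) (simp add: fun_eq_iff algebra_simps)
qed

text \<open>On the compact rectangle of one period the hypotheses give equicontinuity. Uniform
  convergence there carries over to the norm by periodicity, and completeness of the space supplies
  the limit.\<close>

lemma strip_Arzela_Ascoli:
  fixes v :: "nat \<Rightarrow> (real ^ 'n) per_strip"
  assumes bound: "\<And>n. norm (v n) \<le> M"
    and Lip: "\<And>n x y s t j. x \<in> {0..1} \<Longrightarrow> y \<in> {0..1} \<Longrightarrow>
      \<bar>strip_apply (v n) x s $ j - strip_apply (v n) y t $ j\<bar> \<le> C * (\<bar>x - y\<bar> + \<bar>s - t\<bar>)"
  shows "\<exists>r. strict_mono r \<and> convergent (\<lambda>n. v (r n))"
proof -
  define S :: "(real \<times> real) set" where "S = {0..1} \<times> {0..2 * pi}"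
  define F where "F n p = strip_apply (v n) (fst p) (snd p)" for n p
  define N where "N = sqrt (real CARD('n))"
  have N: "N > 0" by (simp add: N_def)
  have norm_le: "norm w \<le> N * B" if "\<And>j. \<bar>w $ j\<bar> \<le> B" for w :: "real ^ 'n" and B
  proof -
    have "norm w \<le> N * infnorm w" using norm_le_infnorm[of w] by (simp add: N_def)
    also have "\<dots> \<le> N * B" using infnorm_le_componentwise[OF that] N by (intro mult_left_mono) auto
    finally show ?thesis .
  qed
  obtain g r where g: "strict_mono (r :: nat \<Rightarrow> nat)"
    "\<And>e. 0 < e \<Longrightarrow> \<exists>N. \<forall>n x. n \<ge> N \<and> x \<in> S \<longrightarrow> norm (F (r n) x - g x) < e"
  proof (rule Arzela_Ascoli[of S F "N * M"])
    show "compact S" unfolding S_def by (intro compact_Times compact_Icc)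
    show "norm (F n p) \<le> N * M" if "p \<in> S" for n p
    proof (rule norm_le)
      fix j
      have "fst p \<in> {0..1}" using that by (auto simp: S_def)
      then show "\<bar>F n p $ j\<bar> \<le> M"
        unfolding F_def using bound[of n] by (rule order_trans[OF strip_norm_nth])
    qed
    show "\<exists>d>0. \<forall>n y. y \<in> S \<and> norm (x - y) < d \<longrightarrow> norm (F n x - F n y) < e"
      if x: "x \<in> S" and e: "e > 0" for x e
    proof -
      \<comment> \<open>2 d bounds the sum of the coordinate differences, N passes from components
        to the Euclidean norm, and the 1 keeps the estimate strict even for C = 0.\<close>
      define d where "d = e / (N * (\<bar>C\<bar> * 2) + 1)"
      have d: "d > 0" using e N by (simp add: d_def add_nonneg_pos)
      have "norm (F n x - F n y) < e" if y: "y \<in> S" "norm (x - y) < d" for n y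
      proof -
        have "\<bar>fst x - fst y\<bar> \<le> norm (x - y)" "\<bar>snd x - snd y\<bar> \<le> norm (x - y)"
          using dist_fst_le[of x y] dist_snd_le[of x y] by (simp_all add: dist_real_def dist_norm)
        then have sum: "\<bar>fst x - fst y\<bar> + \<bar>snd x - snd y\<bar> \<le> 2 * d" using y(2) by linarith
        have "\<bar>(F n x - F n y) $ j\<bar> \<le> \<bar>C\<bar> * (2 * d)" for j
        proof -
          have "\<bar>(F n x - F n y) $ j\<bar> \<le> C * (\<bar>fst x - fst y\<bar> + \<bar>snd x - snd y\<bar>)"
            using Lip[of "fst x" "fst y" n "snd x" j "snd y"] x y(1) by (auto simp: F_def S_def)
          also have "\<dots> \<le> \<bar>C\<bar> * (2 * d)" using sum by (intro mult_mono) auto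
          finally show ?thesis .
        qed
        then have "norm (F n x - F n y) \<le> N * (\<bar>C\<bar> * (2 * d))" by (rule norm_le)
        also have "\<dots> < (N * (\<bar>C\<bar> * 2) + 1) * d" using d by (simp add: algebra_simps)
        also have "\<dots> = e" 
        proof -
          have "N * (\<bar>C\<bar> * 2) + 1 > 0" using N by (simp add: add_nonneg_pos)
          then show ?thesis unfolding d_def by simp
        qed
        finally show ?thesis .
      qed
      then show ?thesis using d by blast
    qed
  qed metis
  have "Cauchy (\<lambda>n. v (r n))"
  proof (rule metric_CauchyI)
    fix e :: real assume "e > 0"
    then obtain n0 where n0: "\<And>n p. n \<ge> n0 \<Longrightarrow> p \<in> S \<Longrightarrow> norm (F (r n) p - g p) < e / 4"
      using g(2)[of "e / 4"] by auto
    have "dist (v (r m)) (v (r n)) < e" if mn: "m \<ge> n0" "n \<ge> n0" for m n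
    proof -
      have "norm (v (r m) - v (r n)) \<le> e / 2"
      proof (rule strip_norm_least)
        fix x t :: real assume x: "x \<in> {0..1}"
        obtain s where s: "s \<in> {0..2 * pi}"
          "strip_apply (v (r m) - v (r n)) x t = strip_apply (v (r m) - v (r n)) x s"
          using periodic_reduce[of "strip_apply (v (r m) - v (r n)) x" t] strip_per[OF x] by metis
        have p: "(x, s) \<in> S" using x s(1) by (simp add: S_def)
        have "infnorm (strip_apply (v (r m) - v (r n)) x t) \<le> norm (F (r m) (x, s) - F (r n) (x, s))"
          unfolding s(2) using infnorm_le_norm by (simp add: F_def strip_apply_minus)
        also have "\<dots> \<le> norm (F (r m) (x, s) - g (x, s)) + norm (F (r n) (x, s) - g (x, s))"
          using norm_triangle_ineq4[of "F (r m) (x, s) - g (x, s)" "F (r n) (x, s) - g (x, s)"] by simp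
        also have "\<dots> \<le> e / 2" using n0[OF mn(1) p] n0[OF mn(2) p] by simp
        finally show "infnorm (strip_apply (v (r m) - v (r n)) x t) \<le> e / 2" .
      qed
      then show ?thesis using \<open>e > 0\<close> by (simp add: dist_norm)
    qed
    then show "\<exists>M. \<forall>m\<ge>M. \<forall>n\<ge>M. dist (v (r m)) (v (r n)) < e" by blast
  qed
  then show ?thesis using g(1) Cauchy_convergent_iff by blast
qed

section \<open>Functions bounded and Lipschitz in time, with one constant for both\<close>

definition bounded_Lipschitz :: "real \<Rightarrow> (real \<Rightarrow> real \<Rightarrow> real) \<Rightarrow> bool" where
  "bounded_Lipschitz M g \<longleftrightarrow>
     (\<forall>x\<in>{0..1}. \<forall>s t. \<bar>g x s\<bar> \<le> M \<and> \<bar>g x s - g x t\<bar> \<le> M * \<bar>s - t\<bar>)"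

lemma bounded_LipschitzD:
  assumes "bounded_Lipschitz M g" "x \<in> {0..1}"
  shows "\<bar>g x s\<bar> \<le> M" "\<bar>g x s - g x t\<bar> \<le> M * \<bar>s - t\<bar>"
  using assms by (auto simp: bounded_Lipschitz_def)

lemma bounded_Lipschitz_nonneg: "bounded_Lipschitz M g \<Longrightarrow> M \<ge> 0"
  using bounded_LipschitzD(1)[of M g 0 0] by auto

lemma bounded_Lipschitz_mult:
  assumes g: "bounded_Lipschitz M g" and h: "bounded_Lipschitz N h"
  shows "bounded_Lipschitz (2 * M * N) (\<lambda>x s. g x s * h x s)"
  unfolding bounded_Lipschitz_def
proof (intro ballI allI conjI)
  fix x s t :: real assume x: "x \<in> {0..1}"
  note G = bounded_LipschitzD[OF g x] bounded_Lipschitz_nonneg[OF g]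
  note H = bounded_LipschitzD[OF h x] bounded_Lipschitz_nonneg[OF h]
  have "\<bar>g x s * h x s\<bar> \<le> M * N" unfolding abs_mult using G H by (intro mult_mono) auto
  also have "\<dots> \<le> 2 * M * N" using G(3) H(3) by simp
  finally show "\<bar>g x s * h x s\<bar> \<le> 2 * M * N" .
  have 1: "\<bar>g x s * (h x s - h x t)\<bar> \<le> M * (N * \<bar>s - t\<bar>)"
    unfolding abs_mult using G H by (intro mult_mono) auto
  have 2: "\<bar>(g x s - g x t) * h x t\<bar> \<le> (M * \<bar>s - t\<bar>) * N"
    unfolding abs_mult using G H by (intro mult_mono) auto
  have "\<bar>g x s * h x s - g x t * h x t\<bar> = \<bar>g x s * (h x s - h x t) + (g x s - g x t) * h x t\<bar>"
    by (simp add: algebra_simps)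
  also have "\<dots> \<le> M * (N * \<bar>s - t\<bar>) + (M * \<bar>s - t\<bar>) * N" using 1 2 by linarith
  finally show "\<bar>g x s * h x s - g x t * h x t\<bar> \<le> 2 * M * N * \<bar>s - t\<bar>"
    by (simp add: algebra_simps)
qed

lemma bounded_Lipschitz_uminus: "bounded_Lipschitz M g \<Longrightarrow> bounded_Lipschitz M (\<lambda>x s. - g x s)"
  unfolding bounded_Lipschitz_def by (auto simp: abs_minus_commute)

lemma bounded_Lipschitz_exp:
  assumes g: "bounded_Lipschitz M g"
  shows "bounded_Lipschitz (exp M * (1 + M)) (\<lambda>x s. exp (g x s))"
  unfolding bounded_Lipschitz_def
proof (intro ballI allI conjI)
  fix x s t :: real assume x: "x \<in> {0..1}"
  note G = bounded_LipschitzD[OF g x] bounded_Lipschitz_nonneg[OF g]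
  have "exp (g x s) \<le> exp M" using G(1)[of s] by simp
  also have "\<dots> \<le> exp M * (1 + M)" using G(3) by (simp add: distrib_left)
  finally show "\<bar>exp (g x s)\<bar> \<le> exp M * (1 + M)" by simp
  have "norm (exp (g x s) - exp (g x t)) \<le> exp M * norm (g x s - g x t)"
  proof (rule field_differentiable_bound[of "{-M..M}" exp exp])
    show "(exp has_field_derivative exp z) (at z within {- M..M})" for z :: real
      by (rule has_field_derivative_at_within) (rule DERIV_exp)
  qed (use G(1)[of s] G(1)[of t] in auto)
  also have "\<dots> \<le> exp M * ((1 + M) * \<bar>s - t\<bar>)"
    using G(2)[of s t] by (intro mult_left_mono) (auto simp: distrib_right)
  finally show "\<bar>exp (g x s) - exp (g x t)\<bar> \<le> exp M * (1 + M) * \<bar>s - t\<bar>" by simp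
qed

lemma bounded_Lipschitz_strip:
  assumes "has_dt u w"
  shows "bounded_Lipschitz (norm u + norm w) (strip_apply (u :: real per_strip))"
  unfolding bounded_Lipschitz_def
proof (intro ballI allI conjI)
  fix x s t :: real assume x: "x \<in> {0..1}"
  show "\<bar>strip_apply u x s\<bar> \<le> norm u + norm w"
    using strip_norm_real[OF x, of u s] norm_ge_zero[of w] by linarith
  have "norm w * \<bar>s - t\<bar> \<le> (norm u + norm w) * \<bar>s - t\<bar>" by (intro mult_right_mono) auto
  then show "\<bar>strip_apply u x s - strip_apply u x t\<bar> \<le> (norm u + norm w) * \<bar>s - t\<bar>"
    using has_dt_Lipschitz[OF assms x, of s t] by linarith
qed

lemma bounded_Lipschitz_primitive:
  assumes g: "bounded_Lipschitz M g" and c: "\<And>s. continuous_on {0..1} (\<lambda>x. g x s)"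
  shows "bounded_Lipschitz M (\<lambda>x s. primitive (\<lambda>y. g y s) x)"
  unfolding bounded_Lipschitz_def
proof (intro ballI allI conjI)
  fix x s t :: real assume x: "x \<in> {0..1}"
  show "\<bar>primitive (\<lambda>y. g y s) x\<bar> \<le> M"
    using primitive_bound[OF c[of s], of M 0 x] bounded_LipschitzD(1)[OF g] x by simp
  have "continuous_on {0..1} (\<lambda>y. g y s - g y t)" by (intro continuous_intros c)
  from primitive_bound[OF this, of "M * \<bar>s - t\<bar>" 0 x]
  show "\<bar>primitive (\<lambda>y. g y s) x - primitive (\<lambda>y. g y t) x\<bar> \<le> M * \<bar>s - t\<bar>"
    using bounded_LipschitzD(2)[OF g] x by (simp add: primitive_diff[OF c c])
qed

lemma (in periodic_field) bounded_Lipschitz_f: "bounded_Lipschitz L f"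
  unfolding bounded_Lipschitz_def using bound_f Lipschitz_f by auto

lemma (in periodic_field) bounded_Lipschitz_along_psi:
  assumes g: "bounded_Lipschitz M g"
  shows "bounded_Lipschitz (M * exp L) (\<lambda>x s. g x (psi x s))"
  unfolding bounded_Lipschitz_def
proof (intro ballI allI conjI)
  fix x s t :: real assume x: "x \<in> {0..1}"
  note G = bounded_LipschitzD[OF g x] bounded_Lipschitz_nonneg[OF g]
  have "M * 1 \<le> M * exp L" using G(3) L_pos by (intro mult_left_mono) auto
  then show "\<bar>g x (psi x s)\<bar> \<le> M * exp L" using G(1)[of "psi x s"] by linarith
  have "M * \<bar>psi x s - psi x t\<bar> \<le> M * (exp L * \<bar>s - t\<bar>)"
    using psi_Lipschitz2[OF x] G(3) by (rule mult_left_mono)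
  then show "\<bar>g x (psi x s) - g x (psi x t)\<bar> \<le> M * exp L * \<bar>s - t\<bar>"
    using G(2)[of "psi x s" "psi x t"] by (simp add: mult.assoc)
qed

section \<open>The solution operators\<close>

locale hyperbolic_system =
  fixes idx :: "'n::finite \<Rightarrow> nat" and m :: nat
    and a :: "'n \<Rightarrow> real per_strip"
    and b :: "'n \<Rightarrow> 'n \<Rightarrow> real per_strip"
    and R :: "(real ^ 'n) per_strip \<Rightarrow> (real ^ 'n) per_line"
  assumes a_C1: "a j \<in> C1_strip"
    and b_C1: "b j k \<in> C1_strip"
    and a_nonzero: "x \<in> {0..1} \<Longrightarrow> a j x t \<noteq> 0"
    and b_factor: "j \<noteq> k \<Longrightarrow>
      \<exists>b'\<in>C1_strip. \<forall>x\<in>{0..1}. \<forall>t. b j k x t = b' x t * (a k x t - a j x t)"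
    and R: "bounded_linear R"
begin

definition a_t :: "'n \<Rightarrow> real per_strip" where
  "a_t j = (SOME w. has_dt (a j) w)"

lemma has_dt_a: "has_dt (a j) (a_t j)"
  using a_C1[of j] unfolding a_t_def C1_strip_def by (auto intro: someI_ex)

definition slope :: "'n \<Rightarrow> real \<Rightarrow> real \<Rightarrow> real" where
  "slope j x t = 1 / a j x t"

definition slope_t :: "'n \<Rightarrow> real \<Rightarrow> real \<Rightarrow> real" where
  "slope_t j x t = - a_t j x t / (a j x t * a j x t)"

lemma periodic_field_slope_ex: "\<exists>L. \<forall>j. periodic_field (slope j) (slope_t j) L"
proof -
  have c: "continuous_on ({0..1} \<times> UNIV) (\<lambda>p. strip_apply u (fst p) (snd p))" for u :: "real per_strip"
    using strip_cont[of u] by (simp add: case_prod_unfold)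
  have c1: "continuous_on ({0..1} \<times> UNIV) (\<lambda>(x, t). slope j x t)" for j
    unfolding slope_def case_prod_unfold using a_nonzero by (intro continuous_intros c) auto
  have c2: "continuous_on ({0..1} \<times> UNIV) (\<lambda>(x, t). slope_t j x t)" for j
    unfolding slope_t_def case_prod_unfold using a_nonzero by (intro continuous_intros c) auto
  have "\<exists>B. \<forall>x\<in>{0..1}. \<forall>t. \<bar>slope j x t\<bar> \<le> B" for j
    by (rule periodic_strip_bounded[OF c1]) (simp add: slope_def strip_per)
  then obtain B1 where B1: "\<And>j x t. x \<in> {0..1} \<Longrightarrow> \<bar>slope j x t\<bar> \<le> B1 j" by metis
  have "\<exists>B. \<forall>x\<in>{0..1}. \<forall>t. \<bar>slope_t j x t\<bar> \<le> B" for j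
    by (rule periodic_strip_bounded[OF c2]) (simp add: slope_t_def strip_per)
  then obtain B2 where B2: "\<And>j x t. x \<in> {0..1} \<Longrightarrow> \<bar>slope_t j x t\<bar> \<le> B2 j" by metis
  have pos: "B1 j \<ge> 0" "B2 j \<ge> 0" for j using B1[of 0 j] B2[of 0 j] by force+
  \<comment> \<open>One constant for all of the finitely many fields; the 1 makes it
    positive.\<close>
  define L where "L = 1 + (\<Sum>j\<in>UNIV. B1 j + B2 j)"
  have "B1 j + B2 j \<le> (\<Sum>j\<in>UNIV. B1 j + B2 j)" for j
    using pos by (intro member_le_sum) auto
  then have "B1 j + B2 j + 1 \<le> L" for j by (simp add: L_def)
  then have L: "B1 j \<le> L" "B2 j \<le> L" for j using pos[of j] by (smt (verit))+
  have "periodic_field (slope j) (slope_t j) L" for j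
  proof
    show "(slope j x has_real_derivative slope_t j x t) (at t)" if "x \<in> {0..1}" for x t
      using DERIV_divide[OF DERIV_const[of 1] has_dt_real[OF has_dt_a[of j] that, of t]
          a_nonzero[OF that, of j t]]
      by (simp add: slope_def[abs_def] slope_t_def)
    show "\<bar>slope j x t\<bar> \<le> L" "\<bar>slope_t j x t\<bar> \<le> L" if "x \<in> {0..1}" for x t
      using B1[OF that] B2[OF that] L by (meson order_trans)+
    show "slope j x (t + 2 * pi) = slope j x t" if "x \<in> {0..1}" for x t
      using that by (simp add: slope_def strip_per)
    show "L > 0" using pos by (simp add: L_def add_pos_nonneg sum_nonneg)
  qed (rule c1 c2)+
  then show ?thesis by blast
qed

definition L :: real where
  "L = (SOME L. \<forall>j. periodic_field (slope j) (slope_t j) L)"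

sublocale ch: periodic_field "slope j" "slope_t j" L for j
  using someI_ex[OF periodic_field_slope_ex] by (simp add: L_def)

text \<open>\<open>phi\<close> carries (x, t) back to the label of its characteristic at x = 0, and
  \<open>psi\<close> follows that characteristic to \<xi>. The description denotes because all
  solutions through (x, t) agree on [0,1].\<close>

lemma char_curve_eq:
  assumes "\<xi> \<in> {0..1}" "x \<in> {0..1}"
  shows "char_curve a j \<xi> x t = ch.psi j \<xi> (ch.phi j x t)"
  unfolding char_curve_def
proof (rule the_equality)
  show "\<exists>w. w x = t \<and> (\<forall>\<eta>\<in>{0..1}. (w has_real_derivative 1 / a j \<eta> (w \<eta>)) (at \<eta> within {0..1})) \<and>
      w \<xi> = ch.psi j \<xi> (ch.phi j x t)"
    using ch.psi_solution[of j "ch.phi j x t"] assms(2)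
    by (intro exI[of _ "\<lambda>\<eta>. ch.psi j \<eta> (ch.phi j x t)"])
      (simp add: ch.psi_phi ch.solution_def slope_def)
next
  fix y assume "\<exists>w. w x = t \<and> (\<forall>\<eta>\<in>{0..1}. (w has_real_derivative 1 / a j \<eta> (w \<eta>)) (at \<eta> within {0..1})) \<and>
      w \<xi> = y"
  then obtain w where w: "w x = t" "ch.solution j w" "w \<xi> = y"
    by (auto simp: ch.solution_def slope_def)
  show "y = ch.psi j \<xi> (ch.phi j x t)"
    using ch.solution_eq_psi_phi[OF w(2) assms(2,1)] w(1,3) by simp
qed

section \<open>Coefficients and operators in characteristic coordinates\<close>

definition beta :: "'n \<Rightarrow> real \<Rightarrow> real \<Rightarrow> real" where
  "beta j x t = b j j x t * slope j x t"

text \<open>The exponent of \<open>c_coeff\<close> counted from 0: on the characteristic \<sigma>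
  the coefficient from x to \<xi> is the exponential of a difference of two values of P, whatever
  the order of x and \<xi>.\<close>

definition P :: "'n \<Rightarrow> real \<Rightarrow> real \<Rightarrow> real" where
  "P j x \<sigma> = primitive (\<lambda>\<eta>. beta j \<eta> (ch.psi j \<eta> \<sigma>)) x"

lemma continuous_on_beta: "continuous_on ({0..1} \<times> UNIV) (\<lambda>(x, t). beta j x t)"
  using continuous_on_mult[OF strip_cont[of "b j j"] ch.cont_f[of j]]
  by (simp add: beta_def case_prod_unfold)

lemma continuous_on_P: "continuous_on ({0..1} \<times> UNIV) (\<lambda>(x, s). P j x s)"
  unfolding P_def by (rule continuous_on_primitive[OF ch.continuous_on_along_psi[OF continuous_on_beta]])

lemma continuous_on_beta_psi: "continuous_on {0..1} (\<lambda>x. beta j x (ch.psi j x \<sigma>))"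
  using continuous_on_strip_slice[OF ch.continuous_on_along_psi[OF continuous_on_beta], of "\<lambda>_. \<sigma>"]
  by simp

lemma P_deriv:
  "x \<in> {0..1} \<Longrightarrow> ((\<lambda>x. P j x \<sigma>) has_real_derivative beta j x (ch.psi j x \<sigma>)) (at x within {0..1})"
  unfolding P_def by (rule primitive_deriv[OF continuous_on_beta_psi])

lemma P_period: "x \<in> {0..1} \<Longrightarrow> P j x (\<sigma> + 2 * pi) = P j x \<sigma>"
  unfolding P_def
  by (rule primitive_cong) (auto simp: beta_def slope_def ch.psi_period strip_per)

lemma bounded_Lipschitz_beta: "\<exists>M. bounded_Lipschitz M (beta j)"
proof -
  obtain w where "has_dt (b j j) w" using b_C1[of j j] unfolding C1_strip_def by blast
  from bounded_Lipschitz_mult[OF bounded_Lipschitz_strip[OF this] ch.bounded_Lipschitz_f[of j]]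
  show ?thesis unfolding beta_def by blast
qed

lemma bounded_Lipschitz_P: "\<exists>M. bounded_Lipschitz M (P j)"
proof -
  obtain M where "bounded_Lipschitz M (beta j)" using bounded_Lipschitz_beta by blast
  from bounded_Lipschitz_primitive[OF ch.bounded_Lipschitz_along_psi[OF this] continuous_on_beta_psi]
  show ?thesis unfolding P_def[abs_def] by blast
qed

lemma c_coeff_eq:
  assumes "\<xi> \<in> {0..1}" "x \<in> {0..1}"
  shows "c_coeff a b j \<xi> x t = exp (P j \<xi> (ch.phi j x t) - P j x (ch.phi j x t))"
proof -
  have "(LBINT \<eta>=x..\<xi>. b j j \<eta> (char_curve a j \<eta> x t) / a j \<eta> (char_curve a j \<eta> x t)) =
      (LBINT \<eta>=x..\<xi>. beta j \<eta> (ch.psi j \<eta> (ch.phi j x t)))"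
  proof (rule interval_integral_cong)
    fix \<eta> assume "\<eta> \<in> einterval (min (ereal x) (ereal \<xi>)) (max (ereal x) (ereal \<xi>))"
    then have "\<eta> \<in> {0..1}" using assms by (auto simp: einterval_def min_def max_def split: if_splits)
    then show "b j j \<eta> (char_curve a j \<eta> x t) / a j \<eta> (char_curve a j \<eta> x t) =
        beta j \<eta> (ch.psi j \<eta> (ch.phi j x t))"
      using assms(2) by (simp add: char_curve_eq beta_def slope_def)
  qed
  then show ?thesis
    unfolding c_coeff_def P_def using LBINT_eq_primitive[OF continuous_on_beta_psi assms(2,1)] by simp
qed

definition xb :: "'n \<Rightarrow> real" where
  "xb = bdry_pt idx m"

lemma xb: "xb j \<in> {0..1}"
  by (simp add: xb_def bdry_pt_def)

text \<open>
  A family of functions is described in the coordinates \<open>(x, \<sigma>)\<close>, where \<open>\<sigma>\<close> is the time at which the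
  \<open>j\<close>-th characteristic passes $x = 0$, together with its derivative in \<open>x\<close> along the characteristics.
  In these coordinates, \<open>FH\<close> and \<open>CH\<close> below are the operators $F$ and $C$; \<open>FG\<close> and \<open>CG\<close> are
  their derivatives.
\<close>

definition transported ::
  "real \<Rightarrow> ('n \<Rightarrow> real \<Rightarrow> real \<Rightarrow> real) \<Rightarrow> ('n \<Rightarrow> real \<Rightarrow> real \<Rightarrow> real) \<Rightarrow> bool" where
  "transported N H G \<longleftrightarrow> (\<forall>j.
     continuous_on ({0..1} \<times> UNIV) (\<lambda>(x, s). H j x s) \<and>
     continuous_on ({0..1} \<times> UNIV) (\<lambda>(x, s). G j x s) \<and>
     (\<forall>x\<in>{0..1}. \<forall>s. ((\<lambda>x. H j x s) has_real_derivative G j x s) (at x within {0..1}) \<and>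
        \<bar>H j x s\<bar> \<le> N \<and> \<bar>G j x s\<bar> \<le> N \<and> H j x (s + 2 * pi) = H j x s))"

lemma transportedD:
  assumes "transported N H G"
  shows "continuous_on ({0..1} \<times> UNIV) (\<lambda>(x, s). H j x s)"
    and "continuous_on ({0..1} \<times> UNIV) (\<lambda>(x, s). G j x s)"
    and "x \<in> {0..1} \<Longrightarrow> ((\<lambda>x. H j x s) has_real_derivative G j x s) (at x within {0..1})"
    and "x \<in> {0..1} \<Longrightarrow> \<bar>H j x s\<bar> \<le> N" and "x \<in> {0..1} \<Longrightarrow> \<bar>G j x s\<bar> \<le> N"
    and "x \<in> {0..1} \<Longrightarrow> H j x (s + 2 * pi) = H j x s"
  using assms unfolding transported_def by blast+

text \<open>The way back from (x, \<sigma>) to (x, t), where each component has its own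
  flow.\<close>

definition Lift :: "('n \<Rightarrow> real \<Rightarrow> real \<Rightarrow> real) \<Rightarrow> (real ^ 'n) per_strip" where
  "Lift H = Strip (\<lambda>x t. if x \<in> {0..1} then \<chi> j. H j x (ch.phi j x t) else 0)"

lemma Lift_apply:
  assumes "transported N H G"
  shows "strip_apply (Lift H) = (\<lambda>x t. if x \<in> {0..1} then \<chi> j. H j x (ch.phi j x t) else 0)"
  unfolding Lift_def
proof (rule Strip_apply)
  have "continuous_on ({0..1} \<times> UNIV) (\<lambda>p. \<chi> j. H j (fst p) (ch.phi j (fst p) (snd p)))"
    using ch.continuous_on_along_phi[OF transportedD(1)[OF assms]]
    by (intro continuous_on_vec_lambda) (simp add: case_prod_unfold)
  then show "continuous_on ({0..1} \<times> UNIV)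
      (\<lambda>(x, t). if x \<in> {0..1} then \<chi> j. H j x (ch.phi j x t) else 0)"
    by (subst continuous_on_cong[OF refl, where
      g = "\<lambda>p. \<chi> j. H j (fst p) (ch.phi j (fst p) (snd p))"]) auto
qed (use transportedD(6)[OF assms] in \<open>auto simp: ch.phi_period\<close>)

text \<open>The integral in F without the factor exp (- P j x \<sigma>), which does not depend on
  \<xi>. Counted from 0, it serves both boundary points.\<close>

definition Gam :: "'n \<Rightarrow> (real ^ 'n) per_strip \<Rightarrow> real \<Rightarrow> real \<Rightarrow> real" where
  "Gam j f x \<sigma> = primitive (\<lambda>\<xi>. exp (P j \<xi> \<sigma>) *
     (f \<xi> (ch.psi j \<xi> \<sigma>) $ j * slope j \<xi> (ch.psi j \<xi> \<sigma>))) x"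

definition FH :: "(real ^ 'n) per_strip \<Rightarrow> 'n \<Rightarrow> real \<Rightarrow> real \<Rightarrow> real" where
  "FH f j x \<sigma> = exp (- P j x \<sigma>) * (Gam j f x \<sigma> - Gam j f (xb j) \<sigma>)"

definition FG :: "(real ^ 'n) per_strip \<Rightarrow> 'n \<Rightarrow> real \<Rightarrow> real \<Rightarrow> real" where
  "FG f j x \<sigma> = f x (ch.psi j x \<sigma>) $ j * slope j x (ch.psi j x \<sigma>) - beta j x (ch.psi j x \<sigma>) * FH f j x \<sigma>"

definition CH :: "(real ^ 'n) per_strip \<Rightarrow> 'n \<Rightarrow> real \<Rightarrow> real \<Rightarrow> real" where
  "CH v j x \<sigma> = exp (P j (xb j) \<sigma> - P j x \<sigma>) * R v (ch.psi j (xb j) \<sigma>) $ j"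

definition CG :: "(real ^ 'n) per_strip \<Rightarrow> 'n \<Rightarrow> real \<Rightarrow> real \<Rightarrow> real" where
  "CG v j x \<sigma> = - beta j x (ch.psi j x \<sigma>) * CH v j x \<sigma>"

lemma uniform_bounds:
  obtains M where "M \<ge> 0" "\<And>j. bounded_Lipschitz M (P j)" "\<And>j. bounded_Lipschitz M (beta j)"
proof -
  obtain M1 where M1: "\<And>j. bounded_Lipschitz (M1 j) (P j)" using bounded_Lipschitz_P by metis
  obtain M2 where M2: "\<And>j. bounded_Lipschitz (M2 j) (beta j)" using bounded_Lipschitz_beta by metis
  have pos: "M1 j \<ge> 0" "M2 j \<ge> 0" for j using M1 M2 bounded_Lipschitz_nonneg by blast+
  define M where "M = (\<Sum>j\<in>UNIV. M1 j + M2 j)"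
  have "M1 j + M2 j \<le> M" for j unfolding M_def using pos by (intro member_le_sum) auto
  then have le: "M1 j \<le> M" "M2 j \<le> M" for j using pos[of j] by (smt (verit))+
  have mono: "bounded_Lipschitz M g" if "bounded_Lipschitz N g" "N \<le> M" for N g
    using that unfolding bounded_Lipschitz_def by (meson abs_ge_zero mult_right_mono order_trans)
  show thesis
  proof (rule that[of M])
    show "M \<ge> 0" using pos by (simp add: M_def sum_nonneg)
  qed (use mono M1 M2 le in blast)+
qed

lemma Gam_integrand_cont:
  "continuous_on ({0..1} \<times> UNIV) (\<lambda>(\<xi>, \<sigma>). exp (P j \<xi> \<sigma>) *
     (strip_apply f \<xi> (ch.psi j \<xi> \<sigma>) $ j * slope j \<xi> (ch.psi j \<xi> \<sigma>)))"
  using continuous_on_mult[OF continuous_on_exp[OF continuous_on_P] continuous_on_mult[OF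
      ch.continuous_on_along_psi[OF strip_cont_nth[of f j]] ch.continuous_on_along_psi[OF ch.cont_f]]]
  by (simp add: case_prod_unfold)

lemma Gam_integrand_cont1:
  "continuous_on {0..1} (\<lambda>\<xi>. exp (P j \<xi> \<sigma>) *
     (strip_apply f \<xi> (ch.psi j \<xi> \<sigma>) $ j * slope j \<xi> (ch.psi j \<xi> \<sigma>)))"
  using continuous_on_strip_slice[OF Gam_integrand_cont, of "\<lambda>_. \<sigma>"] by simp

lemma Gam_bound:
  assumes "\<And>x s. x \<in> {0..1} \<Longrightarrow> \<bar>P j x s\<bar> \<le> M" "x \<in> {0..1}" "y \<in> {0..1}"
  shows "\<bar>Gam j f y \<sigma> - Gam j f x \<sigma>\<bar> \<le> exp M * (norm f * L)"
  unfolding Gam_def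
proof (rule primitive_bound[OF Gam_integrand_cont1 _ assms(2,3)])
  fix \<xi> :: real assume \<xi>: "\<xi> \<in> {0..1}"
  have "exp (P j \<xi> \<sigma>) \<le> exp M" using assms(1)[OF \<xi>, of \<sigma>] by simp
  then show "\<bar>exp (P j \<xi> \<sigma>) * (strip_apply f \<xi> (ch.psi j \<xi> \<sigma>) $ j * slope j \<xi> (ch.psi j \<xi> \<sigma>))\<bar>
      \<le> exp M * (norm f * L)"
    unfolding abs_mult using strip_norm_nth[OF \<xi>] ch.bound_f[OF \<xi>] ch.L_pos
    by (intro mult_mono) auto
qed

text \<open>Along a characteristic, FH solves a linear first order equation driven by f, so its
  derivative there is bounded by the sup norm of f. A bound linear in this norm serves both the
  boundedness of F and the compactness argument.\<close>

lemma FH_transported: "\<exists>N. \<forall>f. transported (N * norm f) (FH f) (FG f)"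
proof -
  obtain M where M: "M \<ge> 0" "\<And>j. bounded_Lipschitz M (P j)" "\<And>j. bounded_Lipschitz M (beta j)"
    using uniform_bounds by metis
  note MP = bounded_LipschitzD(1)[OF M(2)]
  define K where "K = exp M * (exp M * L)"
  define N where "N = K + (L + M * K)"
  have K: "K \<ge> 0" using ch.L_pos by (simp add: K_def)
  have FH_bound: "\<bar>FH f j x \<sigma>\<bar> \<le> K * norm f" if "x \<in> {0..1}" for f j x \<sigma>
  proof -
    have "exp (- P j x \<sigma>) \<le> exp M" using MP[OF that, of j \<sigma>] by simp
    then have "\<bar>FH f j x \<sigma>\<bar> \<le> exp M * (exp M * (norm f * L))"
      unfolding FH_def abs_mult using Gam_bound[OF MP xb that] by (intro mult_mono) auto
    then show ?thesis by (simp add: K_def mult_ac)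
  qed
  have cont_Gam: "continuous_on ({0..1} \<times> UNIV) (\<lambda>(x, s). Gam j f x s)" for j f
    unfolding Gam_def by (rule continuous_on_primitive[OF Gam_integrand_cont])
  have cont_FH: "continuous_on ({0..1} \<times> UNIV) (\<lambda>(x, s). FH f j x s)" for j f
  proof -
    have "continuous_on ({0..1} \<times> UNIV) (\<lambda>p. Gam j f (xb j) (snd p))"
      using xb by (intro continuous_on_strip_compose[OF cont_Gam]) (auto intro!: continuous_intros)
    from continuous_on_mult[OF continuous_on_exp[OF continuous_on_minus[OF continuous_on_P]]
        continuous_on_diff[OF cont_Gam this]]
    show ?thesis by (simp add: FH_def case_prod_unfold)
  qed
  have "transported (N * norm f) (FH f) (FG f)" for f
    unfolding transported_def
  proof (intro allI conjI ballI)
    fix j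
    show "continuous_on ({0..1} \<times> UNIV) (\<lambda>(x, s). FH f j x s)" by (rule cont_FH)
    show "continuous_on ({0..1} \<times> UNIV) (\<lambda>(x, s). FG f j x s)"
      using continuous_on_diff[OF continuous_on_mult[OF ch.continuous_on_along_psi[OF strip_cont_nth[of f j]]
          ch.continuous_on_along_psi[OF ch.cont_f]] continuous_on_mult[OF
          ch.continuous_on_along_psi[OF continuous_on_beta] cont_FH]]
      by (simp add: FG_def case_prod_unfold)
    fix x s :: real assume x: "x \<in> {0..1}"
    have "((\<lambda>x. Gam j f x s - Gam j f (xb j) s) has_real_derivative
        exp (P j x s) * (f x (ch.psi j x s) $ j * slope j x (ch.psi j x s))) (at x within {0..1})"
      using DERIV_diff[OF primitive_deriv[OF Gam_integrand_cont1 x] DERIV_const] unfolding Gam_def by simp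
    from DERIV_mult[OF DERIV_chain2[OF DERIV_exp DERIV_minus[OF P_deriv[OF x]]] this]
    show "((\<lambda>x. FH f j x s) has_real_derivative FG f j x s) (at x within {0..1})"
      unfolding FH_def FG_def
      by (rule DERIV_cong) (simp add: FH_def algebra_simps exp_minus)
    have "K * norm f \<le> N * norm f" using K M(1) ch.L_pos by (intro mult_right_mono) (auto simp: N_def)
    then show "\<bar>FH f j x s\<bar> \<le> N * norm f" using FH_bound[OF x, of f j s] by linarith
    have 1: "\<bar>f x (ch.psi j x s) $ j * slope j x (ch.psi j x s)\<bar> \<le> norm f * L"
      unfolding abs_mult using strip_norm_nth[OF x] ch.bound_f[OF x] by (intro mult_mono) auto
    have 2: "\<bar>beta j x (ch.psi j x s) * FH f j x s\<bar> \<le> M * (K * norm f)"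
      unfolding abs_mult using bounded_LipschitzD(1)[OF M(3) x] FH_bound[OF x] M(1)
      by (intro mult_mono) auto
    have "\<bar>FG f j x s\<bar> \<le> norm f * L + M * (K * norm f)" unfolding FG_def using 1 2 by linarith
    also have "\<dots> \<le> N * norm f" using K by (simp add: N_def algebra_simps)
    finally show "\<bar>FG f j x s\<bar> \<le> N * norm f" .
    have "Gam j f y (s + 2 * pi) = Gam j f y s" if "y \<in> {0..1}" for y
      unfolding Gam_def using that
      by (intro primitive_cong) (auto simp: P_period ch.psi_period strip_per slope_def)
    then show "FH f j x (s + 2 * pi) = FH f j x s" using x xb by (simp add: FH_def P_period)
  qed
  then show ?thesis by blast
qed

text \<open>The boundary datum is constant along a characteristic: x enters CH only through the
  exponential weight, so that its derivative is controlled by the sup norm of R v.\<close>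

lemma CH_transported: "\<exists>N. \<forall>v. transported (N * norm v) (CH v) (CG v)"
proof -
  obtain M where M: "M \<ge> 0" "\<And>j. bounded_Lipschitz M (P j)" "\<And>j. bounded_Lipschitz M (beta j)"
    using uniform_bounds by metis
  note MP = bounded_LipschitzD(1)[OF M(2)]
  obtain r where r: "r \<ge> 0" "\<And>v. norm (R v) \<le> norm v * r"
    using bounded_linear.nonneg_bounded[OF R] by blast
  define K where "K = exp (2 * M) * r"
  define N where "N = K + M * K"
  have K: "K \<ge> 0" using r(1) by (simp add: K_def)
  have CH_bound: "\<bar>CH v j x \<sigma>\<bar> \<le> K * norm v" if "x \<in> {0..1}" for v j x \<sigma>
  proof -
    have "exp (P j (xb j) \<sigma> - P j x \<sigma>) \<le> exp (2 * M)"
      using MP[OF that, of j \<sigma>] MP[OF xb, of j j \<sigma>] by simp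
    moreover have "\<bar>R v (ch.psi j (xb j) \<sigma>) $ j\<bar> \<le> r * norm v"
      using line_norm_nth[of "R v" "ch.psi j (xb j) \<sigma>" j] r(2)[of v] by (simp add: mult.commute)
    ultimately have "\<bar>CH v j x \<sigma>\<bar> \<le> exp (2 * M) * (r * norm v)"
      unfolding CH_def abs_mult by (intro mult_mono) auto
    then show ?thesis by (simp add: K_def mult_ac)
  qed
  have cont_CH: "continuous_on ({0..1} \<times> UNIV) (\<lambda>(x, s). CH v j x s)" for j v
  proof -
    have 1: "continuous_on ({0..1} \<times> UNIV) (\<lambda>p. P j (xb j) (snd p))"
      using xb by (intro continuous_on_strip_compose[OF continuous_on_P]) (auto intro!: continuous_intros)
    have "continuous_on ({0..1} \<times> UNIV) (\<lambda>p. ch.psi j (xb j) (snd p))"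
      using xb by (intro continuous_on_strip_compose[OF ch.continuous_on_psi]) (auto intro!: continuous_intros)
    then have 2: "continuous_on ({0..1} \<times> UNIV) (\<lambda>p. R v (ch.psi j (xb j) (snd p)) $ j)"
      by (intro continuous_on_component continuous_on_compose2[OF line_cont]) auto
    show ?thesis
      using continuous_on_mult[OF continuous_on_exp[OF continuous_on_diff[OF 1 continuous_on_P]] 2]
      by (simp add: CH_def case_prod_unfold)
  qed
  have "transported (N * norm v) (CH v) (CG v)" for v
    unfolding transported_def
  proof (intro allI conjI ballI)
    fix j
    show "continuous_on ({0..1} \<times> UNIV) (\<lambda>(x, s). CH v j x s)" by (rule cont_CH)
    show "continuous_on ({0..1} \<times> UNIV) (\<lambda>(x, s). CG v j x s)"
      using continuous_on_mult[OF continuous_on_minus[OF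
          ch.continuous_on_along_psi[OF continuous_on_beta]] cont_CH]
      by (simp add: CG_def case_prod_unfold)
    fix x s :: real assume x: "x \<in> {0..1}"
    show "((\<lambda>x. CH v j x s) has_real_derivative CG v j x s) (at x within {0..1})"
      using DERIV_mult[OF DERIV_chain2[OF DERIV_exp DERIV_diff[OF DERIV_const P_deriv[OF x]]] DERIV_const]
      unfolding CH_def CG_def by (rule DERIV_cong) (simp add: CH_def)
    have "K * norm v \<le> N * norm v" using K M(1) by (intro mult_right_mono) (auto simp: N_def)
    then show "\<bar>CH v j x s\<bar> \<le> N * norm v" using CH_bound[OF x, of v j s] by linarith
    have "\<bar>CG v j x s\<bar> \<le> M * (K * norm v)"
      unfolding CG_def abs_mult using bounded_LipschitzD(1)[OF M(3) x] CH_bound[OF x] M(1)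
      by (intro mult_mono) auto
    also have "\<dots> \<le> N * norm v" using K by (simp add: N_def algebra_simps)
    finally show "\<bar>CG v j x s\<bar> \<le> N * norm v" .
    show "CH v j x (s + 2 * pi) = CH v j x s"
      using x xb by (simp add: CH_def P_period ch.psi_period line_per)
  qed
  then show ?thesis by blast
qed

lemma FH_add: "x \<in> {0..1} \<Longrightarrow> FH (f + g) j x \<sigma> = FH f j x \<sigma> + FH g j x \<sigma>"
proof -
  have "Gam j (f + g) x \<sigma> = Gam j f x \<sigma> + Gam j g x \<sigma>" if "x \<in> {0..1}" for x
    unfolding Gam_def
    by (subst primitive_add[symmetric, OF Gam_integrand_cont1 Gam_integrand_cont1 that])
      (simp add: strip_apply_plus algebra_simps)
  then show "x \<in> {0..1} \<Longrightarrow> ?thesis" using xb by (simp add: FH_def algebra_simps)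
qed

lemma FH_scaleR: "FH (r *\<^sub>R f) j x \<sigma> = r * FH f j x \<sigma>"
proof -
  have "Gam j (r *\<^sub>R f) x \<sigma> = r * Gam j f x \<sigma>" for x
    unfolding Gam_def
    by (subst primitive_cmult[symmetric]) (simp add: strip_apply_scaleR algebra_simps)
  then show ?thesis by (simp add: FH_def algebra_simps)
qed

lemma CH_add: "CH (u + v) j x \<sigma> = CH u j x \<sigma> + CH v j x \<sigma>"
  by (simp add: CH_def linear_add[OF bounded_linear.linear[OF R]] line_apply_plus distrib_left)

lemma CH_scaleR: "CH (r *\<^sub>R v) j x \<sigma> = r * CH v j x \<sigma>"
  by (simp add: CH_def linear_scale[OF bounded_linear.linear[OF R]] line_apply_scaleR)

lemma bounded_linear_Lift:
  assumes H: "\<And>v. transported (N * norm v) (H v) (G v)"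
    and add: "\<And>u v j x s. x \<in> {0..1} \<Longrightarrow> H (u + v) j x s = H u j x s + H v j x s"
    and scale: "\<And>r v j x s. x \<in> {0..1} \<Longrightarrow> H (r *\<^sub>R v) j x s = r * H v j x s"
  shows "bounded_linear (\<lambda>v. Lift (H v))"
proof (rule bounded_linear_intro)
  note A = Lift_apply[OF H]
  show "Lift (H (u + v)) = Lift (H u) + Lift (H v)" for u v
    by (rule strip_eqI) (simp add: A strip_apply_plus add vec_eq_iff)
  show "Lift (H (r *\<^sub>R v)) = r *\<^sub>R Lift (H v)" for r v
    by (rule strip_eqI) (simp add: A strip_apply_scaleR scale vec_eq_iff)
  show "norm (Lift (H v)) \<le> norm v * N" for v
    by (rule strip_norm_least_nth) (simp add: A transportedD(4)[OF H] mult.commute)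
qed

definition Fop :: "(real ^ 'n) per_strip \<Rightarrow> (real ^ 'n) per_strip" where
  "Fop f = Lift (FH f)"

definition Cop :: "(real ^ 'n) per_strip \<Rightarrow> (real ^ 'n) per_strip" where
  "Cop v = Lift (CH v)"

lemma Fop_apply: "x \<in> {0..1} \<Longrightarrow> Fop f x t $ j = FH f j x (ch.phi j x t)"
proof -
  obtain N where "transported (N * norm f) (FH f) (FG f)" using FH_transported by blast
  from Lift_apply[OF this] show "x \<in> {0..1} \<Longrightarrow> ?thesis" by (simp add: Fop_def)
qed

lemma Cop_apply: "x \<in> {0..1} \<Longrightarrow> Cop v x t $ j = CH v j x (ch.phi j x t)"
proof -
  obtain N where "transported (N * norm v) (CH v) (CG v)" using CH_transported by blast
  from Lift_apply[OF this] show "x \<in> {0..1} \<Longrightarrow> ?thesis" by (simp add: Cop_def)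
qed

lemma bounded_linear_Fop: "bounded_linear Fop"
proof -
  obtain N where "\<And>f. transported (N * norm f) (FH f) (FG f)" using FH_transported by blast
  from bounded_linear_Lift[OF this FH_add FH_scaleR] show ?thesis by (simp add: Fop_def[abs_def])
qed

lemma bounded_linear_Cop: "bounded_linear Cop"
proof -
  obtain N where "\<And>v. transported (N * norm v) (CH v) (CG v)" using CH_transported by blast
  from bounded_linear_Lift[OF this CH_add CH_scaleR] show ?thesis by (simp add: Cop_def[abs_def])
qed

lemma Cop_eq_boundary_operator: "Cop = boundary_operator idx m a b R"
proof
  fix v
  show "Cop v = boundary_operator idx m a b R v"
    unfolding Cop_def Lift_def boundary_operator_def
    by (rule arg_cong[of _ _ Strip])
      (auto simp: fun_eq_iff vec_eq_iff c_coeff_eq char_curve_eq CH_def xb_def bdry_pt_def)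
qed

definition Bop :: "(real ^ 'n) per_strip \<Rightarrow> (real ^ 'n) per_strip" where
  "Bop u = Strip (\<lambda>x t. if x \<in> {0..1} then \<chi> j. \<Sum>k\<in>UNIV - {j}. b j k x t * u x t $ k else 0)"

lemma Bop_apply:
  "strip_apply (Bop u) = (\<lambda>x t. if x \<in> {0..1} then \<chi> j. \<Sum>k\<in>UNIV - {j}. b j k x t * u x t $ k else 0)"
  unfolding Bop_def
proof (rule Strip_apply)
  have "continuous_on ({0..1} \<times> UNIV)
      (\<lambda>p. \<chi> j. \<Sum>k\<in>UNIV - {j}. b j k (fst p) (snd p) * u (fst p) (snd p) $ k)"
    using strip_cont[of "b _ _"] strip_cont_nth[of u]
    by (intro continuous_on_vec_lambda continuous_on_sum continuous_on_mult)
      (simp_all add: case_prod_unfold)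
  then show "continuous_on ({0..1} \<times> UNIV)
      (\<lambda>(x, t). if x \<in> {0..1} then \<chi> j. \<Sum>k\<in>UNIV - {j}. b j k x t * u x t $ k else 0)"
    by (subst continuous_on_cong[OF refl, where
      g = "\<lambda>p. \<chi> j. \<Sum>k\<in>UNIV - {j}. b j k (fst p) (snd p) * u (fst p) (snd p) $ k"]) auto
qed (auto simp: strip_per)

lemma bounded_linear_Bop: "bounded_linear Bop"
proof (rule bounded_linear_intro)
  show "Bop (u + v) = Bop u + Bop v" for u v
    by (rule strip_eqI)
      (simp add: Bop_apply strip_apply_plus vec_eq_iff distrib_left sum.distrib)
  show "Bop (r *\<^sub>R v) = r *\<^sub>R Bop v" for r v
    by (rule strip_eqI)
      (simp add: Bop_apply strip_apply_scaleR vec_eq_iff sum_distrib_left mult_ac)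
  show "norm (Bop u) \<le> norm u * (\<Sum>j\<in>UNIV. \<Sum>k\<in>UNIV. norm (b j k))" for u
  proof (rule strip_norm_least_nth)
    fix x t j assume x: "x \<in> {0..1::real}"
    have "\<bar>\<Sum>k\<in>UNIV - {j}. b j k x t * u x t $ k\<bar> \<le> (\<Sum>k\<in>UNIV - {j}. norm (b j k) * norm u)"
      unfolding real_norm_def[symmetric]
    proof (rule sum_norm_le)
      fix k
      show "norm (b j k x t * u x t $ k) \<le> norm (b j k) * norm u"
        unfolding real_norm_def abs_mult
        using strip_norm_real[OF x] strip_norm_nth[OF x] by (intro mult_mono) auto
    qed
    also have "\<dots> \<le> (\<Sum>k\<in>UNIV. norm (b j k) * norm u)" by (intro sum_mono2) auto
    also have "\<dots> \<le> (\<Sum>j\<in>UNIV. \<Sum>k\<in>UNIV. norm (b j k) * norm u)"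
      by (rule member_le_sum[of j UNIV "\<lambda>j. \<Sum>k\<in>UNIV. norm (b j k) * norm u"]) (auto intro!: sum_nonneg)
    finally show "\<bar>Bop u x t $ j\<bar> \<le> norm u * (\<Sum>j\<in>UNIV. \<Sum>k\<in>UNIV. norm (b j k))"
      using x by (simp add: Bop_apply sum_distrib_left mult.commute)
  qed
qed

text \<open>Pulling exp (- P j x \<sigma>) out of \<open>d_coeff\<close> leaves the integrand of
  \<open>Gam\<close>. The function h is prescribed only pointwise, so that both the source term and
  the coupling sum, a component of \<open>Bop u\<close>, are covered.\<close>

lemma LBINT_d_coeff:
  fixes f :: "(real ^ 'n) per_strip"
  assumes x: "x \<in> {0..1}"
    and h: "\<And>\<xi>. \<xi> \<in> {0..1} \<Longrightarrow> h \<xi> = f \<xi> (ch.psi j \<xi> (ch.phi j x t)) $ j"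
  shows "(LBINT \<xi>=xb j..x. d_coeff a b j \<xi> x t * h \<xi>) = FH f j x (ch.phi j x t)"
proof -
  define \<sigma> where "\<sigma> = ch.phi j x t"
  define g where "g \<xi> = exp (P j \<xi> \<sigma>) * (f \<xi> (ch.psi j \<xi> \<sigma>) $ j * slope j \<xi> (ch.psi j \<xi> \<sigma>))" for \<xi>
  have g: "continuous_on {0..1} g" unfolding g_def by (rule Gam_integrand_cont1)
  have "(LBINT \<xi>=xb j..x. d_coeff a b j \<xi> x t * h \<xi>) = (LBINT \<xi>=xb j..x. exp (- P j x \<sigma>) * g \<xi>)"
  proof (rule interval_integral_cong)
    fix \<xi> assume "\<xi> \<in> einterval (min (ereal (xb j)) (ereal x)) (max (ereal (xb j)) (ereal x))"
    then have "\<xi> \<in> {0..1}"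
      using xb[of j] x by (auto simp: einterval_def min_def max_def split: if_splits)
    then show "d_coeff a b j \<xi> x t * h \<xi> = exp (- P j x \<sigma>) * g \<xi>"
      using x by (simp add: d_coeff_def c_coeff_eq char_curve_eq h g_def \<sigma>_def slope_def exp_diff
        exp_minus divide_inverse)
  qed
  also have "\<dots> = primitive (\<lambda>\<xi>. exp (- P j x \<sigma>) * g \<xi>) x - primitive (\<lambda>\<xi>. exp (- P j x \<sigma>) * g \<xi>) (xb j)"
    by (intro LBINT_eq_primitive continuous_intros g x xb)
  also have "\<dots> = FH f j x \<sigma>"
    by (simp only: primitive_cmult FH_def Gam_def g_def right_diff_distrib)
  finally show ?thesis by (simp add: \<sigma>_def)
qed

lemma continuous_solution_iff:
  "continuous_solution idx m a b R f u \<longleftrightarrow> u = Cop u - Fop (Bop u) + Fop f"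
proof -
  have rhs: "c_coeff a b j (xb j) x t * R u (char_curve a j (xb j) x t) $ j
      - (LBINT \<xi>=xb j..x. d_coeff a b j \<xi> x t *
          (\<Sum>k\<in>UNIV - {j}. b j k \<xi> (char_curve a j \<xi> x t) * u \<xi> (char_curve a j \<xi> x t) $ k))
      + (LBINT \<xi>=xb j..x. d_coeff a b j \<xi> x t * f \<xi> (char_curve a j \<xi> x t) $ j)
      = (Cop u - Fop (Bop u) + Fop f) x t $ j" if x: "x \<in> {0..1}" for j x t
  proof -
    have "(LBINT \<xi>=xb j..x. d_coeff a b j \<xi> x t *
        (\<Sum>k\<in>UNIV - {j}. b j k \<xi> (char_curve a j \<xi> x t) * u \<xi> (char_curve a j \<xi> x t) $ k))
        = FH (Bop u) j x (ch.phi j x t)"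
      using x by (intro LBINT_d_coeff) (auto simp: Bop_apply char_curve_eq)
    moreover have "(LBINT \<xi>=xb j..x. d_coeff a b j \<xi> x t * f \<xi> (char_curve a j \<xi> x t) $ j)
        = FH f j x (ch.phi j x t)"
      using x by (intro LBINT_d_coeff) (auto simp: char_curve_eq)
    ultimately show ?thesis
      using x xb[of j]
      by (simp add: strip_apply_plus strip_apply_minus Fop_apply Cop_apply CH_def c_coeff_eq char_curve_eq)
  qed
  have "continuous_solution idx m a b R f u \<longleftrightarrow>
      (\<forall>j. \<forall>x\<in>{0..1}. \<forall>t. u x t $ j = (Cop u - Fop (Bop u) + Fop f) x t $ j)"
    unfolding continuous_solution_def Let_def xb_def[symmetric] using rhs by simp
  also have "\<dots> \<longleftrightarrow> u = Cop u - Fop (Bop u) + Fop f"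
    by (metis strip_eqI vec_eq_iff)
  finally show ?thesis .
qed

text \<open>This weight remains once the difference of the two slopes has been split off from b j k
  / a j. Here the differentiability of b' and of a k enters, since the integration by parts in
  \<open>smoothing_estimate\<close> differentiates the weight along the j-th
  characteristics.\<close>

lemma weight_regular:
  fixes j k :: 'n and b' :: "real per_strip"
  assumes b': "b' \<in> C1_strip"
  defines "q \<equiv> \<lambda>\<sigma> \<xi>. exp (P j \<xi> \<sigma>) * (strip_apply b' \<xi> (ch.psi j \<xi> \<sigma>) * a k \<xi> (ch.psi j \<xi> \<sigma>))"
  shows "\<exists>M q'. \<forall>x\<in>{0..1}. \<forall>\<sigma> \<tau>. (q \<sigma> has_real_derivative q' \<sigma> x) (at x within {0..1}) \<and>
    \<bar>q \<sigma> x\<bar> \<le> M \<and> \<bar>q' \<sigma> x\<bar> \<le> M \<and> \<bar>q \<tau> x - q \<sigma> x\<bar> \<le> M * \<bar>\<tau> - \<sigma>\<bar>"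
proof -
  obtain bx bt where b'x: "has_dx b' bx" "has_dt b' bt" using b' unfolding C1_strip_def by blast
  obtain ax where ax: "has_dx (a k) ax" using a_C1[of k] unfolding C1_strip_def by blast
  note a_dt = has_dt_a[of k]
  obtain MP where MP: "bounded_Lipschitz MP (P j)" using bounded_Lipschitz_P by blast
  obtain Mb where Mb: "bounded_Lipschitz Mb (beta j)" using bounded_Lipschitz_beta by blast
  have "\<exists>M. bounded_Lipschitz M (\<lambda>x s. q s x)"
    unfolding q_def
    using bounded_Lipschitz_mult[OF bounded_Lipschitz_exp[OF MP]
        bounded_Lipschitz_mult[OF ch.bounded_Lipschitz_along_psi[OF bounded_Lipschitz_strip[OF b'x(2)]]
          ch.bounded_Lipschitz_along_psi[OF bounded_Lipschitz_strip[OF a_dt]]]] by blast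
  then obtain M0 where M0: "bounded_Lipschitz M0 (\<lambda>x s. q s x)" ..
  define q' where "q' \<sigma> x = beta j x (ch.psi j x \<sigma>) * q \<sigma> x +
     exp (P j x \<sigma>) * ((bx x (ch.psi j x \<sigma>) + bt x (ch.psi j x \<sigma>) * slope j x (ch.psi j x \<sigma>)) * a k x (ch.psi j x \<sigma>) +
     (ax x (ch.psi j x \<sigma>) + a_t k x (ch.psi j x \<sigma>) * slope j x (ch.psi j x \<sigma>)) * b' x (ch.psi j x \<sigma>))" for \<sigma> x
  have deriv: "(q \<sigma> has_real_derivative q' \<sigma> x) (at x within {0..1})" if x: "x \<in> {0..1}" for x \<sigma>
    using DERIV_mult[OF DERIV_chain2[OF DERIV_exp P_deriv[OF x, of j \<sigma>]] DERIV_mult[OF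
        C1_strip_along_curve[OF b'x ch.psi_deriv[OF x] x] C1_strip_along_curve[OF ax a_dt ch.psi_deriv[OF x] x]]]
    unfolding q_def q'_def by (rule DERIV_cong) (simp add: algebra_simps)
  define M1 where "M1 = Mb * M0 + exp MP * ((norm bx + norm bt * L) * norm (a k) + (norm ax + norm (a_t k) * L) * norm b')"
  have q'_bound: "\<bar>q' \<sigma> x\<bar> \<le> M1" if x: "x \<in> {0..1}" for x \<sigma>
  proof -
    have e: "\<bar>exp (P j x \<sigma>)\<bar> \<le> exp MP" using bounded_LipschitzD(1)[OF MP x, of \<sigma>] by simp
    note B = strip_norm_real[OF x] ch.bound_f[OF x]
    have sum: "\<bar>u x s + v x s * slope j x s\<bar> \<le> norm u + norm v * L" for u v :: "real per_strip" and s
    proof -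
      have "\<bar>v x s * slope j x s\<bar> \<le> norm v * L" unfolding abs_mult using B by (intro mult_mono) auto
      then show ?thesis using B(1)[of u s] by linarith
    qed
    have Lpos: "L \<ge> 0" using ch.L_pos by simp
    have 1: "\<bar>beta j x (ch.psi j x \<sigma>) * q \<sigma> x\<bar> \<le> Mb * M0"
      unfolding abs_mult using bounded_LipschitzD(1)[OF Mb x] bounded_LipschitzD(1)[OF M0 x]
        bounded_Lipschitz_nonneg[OF Mb] by (intro mult_mono) auto
    define A1 where "A1 = (bx x (ch.psi j x \<sigma>) + bt x (ch.psi j x \<sigma>) * slope j x (ch.psi j x \<sigma>)) * a k x (ch.psi j x \<sigma>)"
    define A2 where "A2 = (ax x (ch.psi j x \<sigma>) + a_t k x (ch.psi j x \<sigma>) * slope j x (ch.psi j x \<sigma>)) * b' x (ch.psi j x \<sigma>)"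
    have 2: "\<bar>A1\<bar> \<le> (norm bx + norm bt * L) * norm (a k)"
      unfolding abs_mult A1_def using sum B(1) Lpos by (intro mult_mono) auto
    have 3: "\<bar>A2\<bar> \<le> (norm ax + norm (a_t k) * L) * norm b'"
      unfolding abs_mult A2_def using sum B(1) Lpos by (intro mult_mono) auto
    have "\<bar>exp (P j x \<sigma>) * (A1 + A2)\<bar> \<le>
        exp MP * ((norm bx + norm bt * L) * norm (a k) + (norm ax + norm (a_t k) * L) * norm b')"
      unfolding abs_mult using e 2 3 by (intro mult_mono) auto
    then show ?thesis using 1 unfolding q'_def M1_def A1_def[symmetric] A2_def[symmetric] by linarith
  qed
  show ?thesis
  proof (intro exI ballI allI conjI)
    fix x \<sigma> \<tau> :: real assume x: "x \<in> {0..1}"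
    show "(q \<sigma> has_real_derivative q' \<sigma> x) (at x within {0..1})" by (rule deriv[OF x])
    note Q = bounded_LipschitzD[OF M0 x] 
    show "\<bar>q \<sigma> x\<bar> \<le> max M0 M1" using Q(1)[of \<sigma>] by simp
    show "\<bar>q' \<sigma> x\<bar> \<le> max M0 M1" using q'_bound[OF x, of \<sigma>] by simp
    have "M0 * \<bar>\<tau> - \<sigma>\<bar> \<le> max M0 M1 * \<bar>\<tau> - \<sigma>\<bar>" by (intro mult_right_mono) auto
    then show "\<bar>q \<tau> x - q \<sigma> x\<bar> \<le> max M0 M1 * \<bar>\<tau> - \<sigma>\<bar>" using Q(2)[of \<tau> \<sigma>] by linarith
  qed
qed

text \<open>Each term of the coupling sum is an integral of the form treated in
  \<open>smoothing_estimate\<close>, with H v k read in k-coordinates along a j-characteristic. The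
  resulting constant involves v only through its norm.\<close>

lemma Gam_Bop_Lipschitz:
  assumes H: "\<And>v. transported (N * norm v) (H v) (G v)"
  shows "\<exists>C. \<forall>(v :: (real ^ 'n) per_strip) x \<sigma> \<tau>. x \<in> {0..1} \<longrightarrow>
    \<bar>Gam j (Bop (Lift (H v))) x \<tau> - Gam j (Bop (Lift (H v))) x \<sigma>\<bar> \<le> C * norm v * \<bar>\<tau> - \<sigma>\<bar>"
proof -
  have "\<forall>k. \<exists>b'. k \<noteq> j \<longrightarrow> b' \<in> C1_strip \<and> (\<forall>x\<in>{0..1}. \<forall>t. b j k x t = b' x t * (a k x t - a j x t))"
    using b_factor[of j] by metis
  then obtain b' where b': "\<And>k. k \<noteq> j \<Longrightarrow> b' k \<in> C1_strip"
    "\<And>k x t. k \<noteq> j \<Longrightarrow> x \<in> {0..1} \<Longrightarrow> b j k x t = b' k x t * (a k x t - a j x t)" by metis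
  define q where "q k \<sigma> \<xi> = exp (P j \<xi> \<sigma>) * (b' k \<xi> (ch.psi j \<xi> \<sigma>) * a k \<xi> (ch.psi j \<xi> \<sigma>))" for k \<sigma> \<xi>
  have "\<forall>k. \<exists>M q'. k \<noteq> j \<longrightarrow> (\<forall>x\<in>{0..1}. \<forall>\<sigma> \<tau>. (q k \<sigma> has_real_derivative q' \<sigma> x) (at x within {0..1}) \<and>
    \<bar>q k \<sigma> x\<bar> \<le> M \<and> \<bar>q' \<sigma> x\<bar> \<le> M \<and> \<bar>q k \<tau> x - q k \<sigma> x\<bar> \<le> M * \<bar>\<tau> - \<sigma>\<bar>)"
    unfolding q_def using weight_regular[OF b'(1)] by blast
  then obtain M q' where q: "\<And>k x \<sigma> \<tau>. k \<noteq> j \<Longrightarrow> x \<in> {0..1} \<Longrightarrow>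
      (q k \<sigma> has_real_derivative q' k \<sigma> x) (at x within {0..1}) \<and>
      \<bar>q k \<sigma> x\<bar> \<le> M k \<and> \<bar>q' k \<sigma> x\<bar> \<le> M k \<and> \<bar>q k \<tau> x - q k \<sigma> x\<bar> \<le> M k * \<bar>\<tau> - \<sigma>\<bar>" by metis
  define K where "K = 2 * L + (4 + L) * exp L ^ 3"
  define g where "g v k \<sigma> \<xi> = q k \<sigma> \<xi> * ((slope j \<xi> (ch.psi j \<xi> \<sigma>) - slope k \<xi> (ch.psi j \<xi> \<sigma>)) *
      H v k \<xi> (ch.phi k \<xi> (ch.psi j \<xi> \<sigma>)))" for v k \<sigma> \<xi>
  have q_cont: "continuous_on {0..1} (q k \<sigma>)" if "k \<noteq> j" for k \<sigma>
    using q[OF that] by (intro DERIV_continuous_on) blast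
  have est: "\<bar>primitive (g v k \<tau>) x - primitive (g v k \<sigma>) x\<bar> \<le> M k * (N * norm v) * K * \<bar>\<tau> - \<sigma>\<bar>"
    if k: "k \<noteq> j" and x: "x \<in> {0..1}" for k x \<sigma> \<tau> v
  proof -
    interpret tf: two_fields "slope j" "slope_t j" "slope k" "slope_t k" L by unfold_locales
    show ?thesis
      unfolding K_def g_def
      by (rule tf.smoothing_estimate[where q' = "q' k \<sigma>" and G = "G v k", OF _ _ _ _ q_cont[OF k]
          transportedD(1)[OF H] transportedD(2)[OF H] transportedD(3)[OF H] transportedD(4)[OF H]
          transportedD(5)[OF H] x]) (use q[OF k] in auto)
  qed
  have cont: "continuous_on {0..1} (g v k \<sigma>)" if "k \<noteq> j" for v k \<sigma>
  proof -
    have c: "continuous_on {0..1} (\<lambda>\<xi>. ch.psi j \<xi> \<sigma>)"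
      using continuous_on_strip_slice[OF ch.continuous_on_psi, of "\<lambda>_. \<sigma>"] by simp
    show ?thesis
      unfolding g_def
      by (intro continuous_intros q_cont[OF that] continuous_on_strip_slice[OF ch.cont_f]
          continuous_on_strip_slice[OF transportedD(1)[OF H]]
          continuous_on_strip_slice[OF ch.continuous_on_phi] c)
  qed
  have Gam_eq: "Gam j (Bop (Lift (H v))) x \<sigma> = (\<Sum>k\<in>UNIV - {j}. primitive (g v k \<sigma>) x)"
    if x: "x \<in> {0..1}" for v x \<sigma>
  proof -
    have "Gam j (Bop (Lift (H v))) x \<sigma> = primitive (\<lambda>\<xi>. \<Sum>k\<in>UNIV - {j}. g v k \<sigma> \<xi>) x"
      unfolding Gam_def
    proof (rule primitive_cong[OF x])
      fix \<xi> :: real assume \<xi>: "\<xi> \<in> {0..1}"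
      \<comment> \<open>The factorisation of b j k in terms of slopes: b' (a k - a j) / a j = b' a k
        (1 / a j - 1 / a k).\<close>
      have "exp (P j \<xi> \<sigma>) * (b j k \<xi> (ch.psi j \<xi> \<sigma>) * h * slope j \<xi> (ch.psi j \<xi> \<sigma>)) =
          q k \<sigma> \<xi> * ((slope j \<xi> (ch.psi j \<xi> \<sigma>) - slope k \<xi> (ch.psi j \<xi> \<sigma>)) * h)"
        if "k \<noteq> j" for k h
        using a_nonzero[OF \<xi>] by (simp add: q_def slope_def b'(2)[OF that \<xi>] field_simps)
      note factor = this
      show "exp (P j \<xi> \<sigma>) * (strip_apply (Bop (Lift (H v))) \<xi> (ch.psi j \<xi> \<sigma>) $ j *
          slope j \<xi> (ch.psi j \<xi> \<sigma>)) = (\<Sum>k\<in>UNIV - {j}. g v k \<sigma> \<xi>)"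
        using \<xi>
        by (simp add: Bop_apply Lift_apply[OF H] g_def sum_distrib_left sum_distrib_right)
          (intro sum.cong refl factor, simp)
    qed
    also have "\<dots> = (\<Sum>k\<in>UNIV - {j}. primitive (g v k \<sigma>) x)"
      by (rule primitive_sum[OF _ cont x]) auto
    finally show ?thesis .
  qed
  show ?thesis
  proof (intro exI allI impI)
    fix v :: "(real ^ 'n) per_strip" and x \<sigma> \<tau> :: real assume x: "x \<in> {0..1}"
    have "\<bar>\<Sum>k\<in>UNIV - {j}. primitive (g v k \<tau>) x - primitive (g v k \<sigma>) x\<bar>
        \<le> (\<Sum>k\<in>UNIV - {j}. M k * (N * norm v) * K * \<bar>\<tau> - \<sigma>\<bar>)"
      unfolding real_norm_def[symmetric] by (rule sum_norm_le) (use est x in auto)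
    then show "\<bar>Gam j (Bop (Lift (H v))) x \<tau> - Gam j (Bop (Lift (H v))) x \<sigma>\<bar>
        \<le> (\<Sum>k\<in>UNIV - {j}. M k * N * K) * norm v * \<bar>\<tau> - \<sigma>\<bar>"
      by (simp add: Gam_eq[OF x] sum_subtractf sum_distrib_left sum_distrib_right mult_ac)
  qed
qed

text \<open>For bounded v, the functions FH (W v) are Lipschitz in \<sigma> by
  \<open>Gam_Bop_Lipschitz\<close>, and in x because FG is bounded. As \<open>phi\<close> is
  Lipschitz in both variables, this persists in the coordinates (x, t), and Arzela-Ascoli
  applies.\<close>

lemma compact_map_Fop_Bop:
  assumes H: "\<And>v. transported (N * norm v) (H v) (G v)"
  shows "compact_map (\<lambda>v :: (real ^ 'n) per_strip. Fop (Bop (Lift (H v))))"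
proof -
  define W where "W v = Bop (Lift (H v))" for v
  obtain C where C: "\<And>j v x \<sigma> \<tau>. x \<in> {0..1} \<Longrightarrow>
      \<bar>Gam j (W v) x \<tau> - Gam j (W v) x \<sigma>\<bar> \<le> C j * norm v * \<bar>\<tau> - \<sigma>\<bar>"
    unfolding W_def using Gam_Bop_Lipschitz[OF H] by metis
  define CC where "CC = (\<Sum>j\<in>UNIV. \<bar>C j\<bar>)"
  have CC: "C j \<le> CC" "CC \<ge> 0" for j
    using member_le_sum[of j UNIV "\<lambda>j. \<bar>C j\<bar>"] by (auto simp: CC_def sum_nonneg)
  obtain M where M: "M \<ge> 0" "\<And>j. bounded_Lipschitz M (P j)"
    using uniform_bounds by metis
  note MP = bounded_LipschitzD(1)[OF M(2)]
  define E where "E = exp M * (1 + M)"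
  have E: "bounded_Lipschitz E (\<lambda>x s. exp (- P j x s))" for j
    unfolding E_def by (intro bounded_Lipschitz_exp bounded_Lipschitz_uminus M(2))
  have E0: "E \<ge> 0" using bounded_Lipschitz_nonneg[OF E] .
  obtain NF where NF: "\<And>f. transported (NF * norm f) (FH f) (FG f)" using FH_transported by blast
  obtain KB where KB: "KB \<ge> 0" "\<And>u. norm (Bop u) \<le> norm u * KB"
    using bounded_linear.nonneg_bounded[OF bounded_linear_Bop] by blast
  obtain KF where KF: "KF \<ge> 0" "\<And>u. norm (Fop u) \<le> norm u * KF"
    using bounded_linear.nonneg_bounded[OF bounded_linear_Fop] by blast
  have W: "norm (W v) \<le> N * KB * norm v" for v
  proof -
    have "norm (Lift (H v)) \<le> N * norm v"
      by (rule strip_norm_least_nth) (simp add: Lift_apply[OF H] transportedD(4)[OF H])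
    then have "norm (Lift (H v)) * KB \<le> N * norm v * KB" using KB(1) by (rule mult_right_mono)
    then show ?thesis using KB(2)[of "Lift (H v)"] by (simp add: W_def mult_ac)
  qed
  show ?thesis
    unfolding W_def[symmetric]
  proof (rule compact_mapI)
    fix v :: "nat \<Rightarrow> (real ^ 'n) per_strip" and B assume B: "\<And>n. norm (v n) \<le> B"
    have B0: "B \<ge> 0" using B[of 0] norm_ge_zero order_trans by blast
    define B' where "B' = \<bar>N\<bar> * KB * B"
    have B'0: "B' \<ge> 0" using KB(1) B0 by (simp add: B'_def)
    have WB: "norm (W (v n)) \<le> B'" for n
    proof -
      have "N * KB * norm (v n) \<le> \<bar>N\<bar> * KB * B"
        using B[of n] KB(1) by (intro mult_mono) auto
      then show ?thesis using W[of "v n"] by (simp add: B'_def)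
    qed
    define D1 where "D1 = \<bar>NF\<bar> * B'"
    have x_Lip: "\<bar>FH (W (v n)) j x \<sigma> - FH (W (v n)) j y \<sigma>\<bar> \<le> D1 * \<bar>x - y\<bar>"
      if "x \<in> {0..1}" "y \<in> {0..1}" for n j x y \<sigma>
    proof (rule within_deriv_Lipschitz[OF transportedD(3)[OF NF] _ that(2,1)])
      fix z :: real assume z: "z \<in> {0..1}"
      have "NF * norm (W (v n)) \<le> D1"
        unfolding D1_def using WB[of n] by (intro mult_mono) auto
      then show "\<bar>FG (W (v n)) j z \<sigma>\<bar> \<le> D1"
        using transportedD(5)[OF NF[of "W (v n)"] z, of j \<sigma>] by linarith
    qed
    \<comment> \<open>Product rule for the weight exp (- P) times a difference of two values of
      \<open>Gam\<close>: E bounds the weight and its Lipschitz constant, 2 counts the endpoints x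
      and \<open>xb j\<close>, and \<open>exp M * (B' * L)\<close> bounds the difference
      itself.\<close>
    define D2 where "D2 = E * (2 * (CC * B)) + E * (exp M * (B' * L))"
    have D2: "D2 \<ge> 0" using E0 CC(2) B0 B'0 ch.L_pos by (simp add: D2_def)
    have s_Lip: "\<bar>FH (W (v n)) j x \<tau> - FH (W (v n)) j x \<sigma>\<bar> \<le> D2 * \<bar>\<tau> - \<sigma>\<bar>"
      if x: "x \<in> {0..1}" for n j x \<sigma> \<tau>
    proof -
      define \<Gamma> where "\<Gamma> s = Gam j (W (v n)) x s - Gam j (W (v n)) (xb j) s" for s
      have "C j * norm (v n) * \<bar>\<tau> - \<sigma>\<bar> \<le> CC * B * \<bar>\<tau> - \<sigma>\<bar>"
        using CC B by (intro mult_right_mono mult_mono) auto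
      then have 1: "\<bar>\<Gamma> \<tau> - \<Gamma> \<sigma>\<bar> \<le> 2 * (CC * B) * \<bar>\<tau> - \<sigma>\<bar>"
        using C[OF x, where j = j and v = "v n" and \<tau> = \<tau> and \<sigma> = \<sigma>]
          C[OF xb[of j], where j = j and v = "v n" and \<tau> = \<tau> and \<sigma> = \<sigma>] unfolding \<Gamma>_def by linarith
      have "\<bar>\<Gamma> \<sigma>\<bar> \<le> exp M * (norm (W (v n)) * L)"
        unfolding \<Gamma>_def by (rule Gam_bound[OF MP xb x])
      also have "\<dots> \<le> exp M * (B' * L)"
        using WB[of n] ch.L_pos by (intro mult_left_mono mult_right_mono) auto
      finally have 2: "\<bar>\<Gamma> \<sigma>\<bar> \<le> exp M * (B' * L)" .
      have 3: "\<bar>exp (- P j x \<tau>) * (\<Gamma> \<tau> - \<Gamma> \<sigma>)\<bar> \<le> E * (2 * (CC * B) * \<bar>\<tau> - \<sigma>\<bar>)"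
        unfolding abs_mult using bounded_LipschitzD(1)[OF E[of j] x, of \<tau>] 1 E0 by (intro mult_mono) auto
      have 4: "\<bar>(exp (- P j x \<tau>) - exp (- P j x \<sigma>)) * \<Gamma> \<sigma>\<bar> \<le> (E * \<bar>\<tau> - \<sigma>\<bar>) * (exp M * (B' * L))"
        unfolding abs_mult using bounded_LipschitzD(2)[OF E[of j] x, of \<tau> \<sigma>] 2 E0 by (intro mult_mono) auto
      have "FH (W (v n)) j x \<tau> - FH (W (v n)) j x \<sigma> =
          exp (- P j x \<tau>) * (\<Gamma> \<tau> - \<Gamma> \<sigma>) + (exp (- P j x \<tau>) - exp (- P j x \<sigma>)) * \<Gamma> \<sigma>"
        by (simp add: FH_def \<Gamma>_def algebra_simps)
      then have "\<bar>FH (W (v n)) j x \<tau> - FH (W (v n)) j x \<sigma>\<bar> \<le>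
          E * (2 * (CC * B) * \<bar>\<tau> - \<sigma>\<bar>) + (E * \<bar>\<tau> - \<sigma>\<bar>) * (exp M * (B' * L))"
        using 3 4 by linarith
      also have "\<dots> = D2 * \<bar>\<tau> - \<sigma>\<bar>" by (simp add: D2_def algebra_simps)
      finally show ?thesis .
    qed
    show "\<exists>r. strict_mono r \<and> convergent (\<lambda>n. Fop (W (v (r n))))"
    proof (rule strip_Arzela_Ascoli)
      show "norm (Fop (W (v n))) \<le> B' * KF" for n
        using KF(2)[of "W (v n)"] mult_right_mono[OF WB[of n] KF(1)] by linarith
      fix n j and x y s t :: real assume x: "x \<in> {0..1}" and y: "y \<in> {0..1}"
      let ?F = "FH (W (v n)) j"
      have "\<bar>ch.phi j x s - ch.phi j y t\<bar> \<le> \<bar>ch.phi j x s - ch.phi j y s\<bar> + \<bar>ch.phi j y s - ch.phi j y t\<bar>"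
        by linarith
      also have "\<dots> \<le> exp L * (L * \<bar>x - y\<bar>) + exp L * \<bar>s - t\<bar>"
        by (intro add_mono ch.phi_Lipschitz1 ch.phi_Lipschitz2 x y)
      finally have "D2 * \<bar>ch.phi j x s - ch.phi j y t\<bar> \<le> D2 * (exp L * (L * \<bar>x - y\<bar>) + exp L * \<bar>s - t\<bar>)"
        using D2 by (rule mult_left_mono)
      \<comment> \<open>Move along the characteristic through (x, s) from x to y, then change the
        label at fixed y.\<close>
      moreover have "\<bar>?F x (ch.phi j x s) - ?F y (ch.phi j y t)\<bar> \<le>
          D1 * \<bar>x - y\<bar> + D2 * \<bar>ch.phi j x s - ch.phi j y t\<bar>"
        using x_Lip[OF x y, of n j "ch.phi j x s"] s_Lip[OF y, of n j "ch.phi j x s" "ch.phi j y t"]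
        by linarith
      moreover have "D1 * \<bar>x - y\<bar> + D2 * (exp L * (L * \<bar>x - y\<bar>) + exp L * \<bar>s - t\<bar>) \<le>
          (D1 + D2 * exp L * L + D2 * exp L) * (\<bar>x - y\<bar> + \<bar>s - t\<bar>)"
      proof -
        have "0 \<le> D1 * \<bar>s - t\<bar> + D2 * exp L * L * \<bar>s - t\<bar> + D2 * exp L * \<bar>x - y\<bar>"
          using D2 B'0 ch.L_pos by (simp add: D1_def)
        then show ?thesis by (simp add: algebra_simps)
      qed
      ultimately show "\<bar>Fop (W (v n)) x s $ j - Fop (W (v n)) y t $ j\<bar> \<le>
          (D1 + D2 * exp L * L + D2 * exp L) * (\<bar>x - y\<bar> + \<bar>s - t\<bar>)"
        using x y by (simp add: Fop_apply)
    qed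
  qed
qed

lemma compact_map_Fop_Bop_Fop: "compact_map (\<lambda>v. Fop (Bop (Fop v)))"
proof -
  obtain N where "\<And>f. transported (N * norm f) (FH f) (FG f)" using FH_transported by blast
  from compact_map_Fop_Bop[OF this] show ?thesis by (simp only: Fop_def[symmetric])
qed

lemma compact_map_Fop_Bop_Cop: "compact_map (\<lambda>v. Fop (Bop (Cop v)))"
proof -
  obtain N where "\<And>v. transported (N * norm v) (CH v) (CG v)" using CH_transported by blast
  from compact_map_Fop_Bop[OF this] show ?thesis by (simp only: Cop_def[symmetric])
qed

end

theorem theorem1p2:
  fixes idx :: "'n::finite \<Rightarrow> nat" and m :: nat
    and a :: "'n \<Rightarrow> real per_strip"
    and b :: "'n \<Rightarrow> 'n \<Rightarrow> real per_strip"
    and R :: "(real ^ 'n) per_strip \<Rightarrow> (real ^ 'n) per_line"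
    and K :: "(real ^ 'n) per_strip set"
  assumes idx: "bij_betw idx UNIV {1..CARD('n)}"
    and m: "m \<le> CARD('n)"
    and a_C1: "\<And>j. a j \<in> C1_strip"
    and b_C1: "\<And>j k. b j k \<in> C1_strip"
    and a_nonzero: "\<And>j x t. x \<in> {0..1} \<Longrightarrow> a j x t \<noteq> 0"
    and b_factor: "\<And>j k. j \<noteq> k \<Longrightarrow>
      \<exists>b'\<in>C1_strip. \<forall>x\<in>{0..1}. \<forall>t. b j k x t = b' x t * (a k x t - a j x t)"
    and R_bounded_linear: "bounded_linear R"
    and R_C1: "\<And>u. u \<in> C1_strip \<Longrightarrow> R u \<in> C1_line"
    and R_C1_bounded: "\<exists>M. \<forall>u\<in>C1_strip. norm_C1_line (R u) \<le> M * norm_C1_strip u"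
    and C_contr: "\<exists>l. onorm (boundary_operator idx m a b R ^^ l) < 1"
    and K_def: "K = {u. continuous_solution idx m a b R 0 u}"
  shows "finite_dimensional K \<and>
      (let S = {f. \<exists>u. continuous_solution idx m a b R f u}
       in subspace S \<and> closed S \<and> has_codimension S (dim K)) \<and>
      (dim K = 0 \<longrightarrow> (\<forall>f. \<exists>!u. continuous_solution idx m a b R f u))"
proof -
  interpret hyperbolic_system idx m a b R
    by (rule hyperbolic_system.intro) (fact a_C1 b_C1 a_nonzero b_factor R_bounded_linear)+
  obtain l where "onorm (Cop ^^ l) < 1"
    using C_contr unfolding Cop_eq_boundary_operator by blast
  note Fredholm = Fredholm_alternative_boundary_problem[OF bounded_linear_Cop bounded_linear_Fop
      bounded_linear_Bop this compact_map_Fop_Bop_Fop compact_map_Fop_Bop_Cop continuous_solution_iff]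
  show ?thesis
    unfolding Let_def K_def using Fredholm by blast
qed

end
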